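(* Let $\mathcal C$ be an algebraic motion of $(G,\lambda)$, let $G'$ be a subgraph of $G$, and let $f\colon\mathcal C\to\mathcal C'$ be the projection of $\mathcal C$ to the coordinates of the vertices of $G'$, where the image $\mathcal C'$ is an algebraic motion of $G'$ (an irreducible curve). Let $\delta'$ be a NAC-coloring of $G'$ and let $\{\delta_1,\dots,\delta_k\}=\{\delta\in\mathrm{NAC}(G)\colon \delta|_{E_{G'}}=\delta'\}$. Then $$\sum_{i=1}^k\mu(\delta_i,\mathcal C)=\mu(\delta',\mathcal C')\cdot\deg(f).$$
   Context: Graphs are finite and simple. For a labeling $\lambda\colon E_G\to\mathbb{R}_{>0}$ and a fixed edge $\bar u\bar v$, an algebraic motion of $(G,\lambda)$ is an irreducible algebraic curve $\mathcal C$ contained in the complex zero set of $x_{\bar u}=y_{\bar u}=0$, $x_{\bar v}=\lambda(\bar u\bar v)$, $y_{\bar v}=0$, $(x_u-x_v)^2+(y_u-y_v)^2=\lambda(uv)^2$ ($uv\in E_G$), in variables $(x_u,y_u)$, $u\in V_G$. $F(\mathcal C)$ is its complex function field. For $uv\in E_G$, $W_{u,v}=(x_v-x_u)+i(y_v-y_u)$; for a valuation $\nu$ write $\nu(W_e)$ for $e=uv$ (independent of orientation). $F(\mathcal C')$ is viewed as a subfield of $F(\mathcal C)$ via $f$, and $\deg(f)=[F(\mathcal C):F(\mathcal C')]$. $\mathrm{NAC}(G)$ is the set of NAC-colorings of $G$: surjective maps $\delta\colon E_G\to\{\text{red},\text{blue}\}$ such that each cycle is monochromatic or has at least two edges of each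 color. $\mathrm{Val}(\mathcal C)$ is the set of valuations of $F(\mathcal C)$ that are trivial on $\mathbb{C}$ and surjective onto $\mathbb{Z}$. For $\delta\in\mathrm{NAC}(G)$ and $\nu\in\mathrm{Val}(\mathcal C)$, $\mathrm{gap}(\delta,\nu)=\max\{0,\ \min_{e:\delta(e)=\text{red}}\nu(W_e)-\max_{e:\delta(e)=\text{blue}}\nu(W_e)\}$, and $\mu(\delta,\mathcal C)=\sum_{\nu\in\mathrm{Val}(\mathcal C)}\mathrm{gap}(\delta,\nu)$ (a finite sum). The quantities $\mu(\delta',\mathcal C')$ for $G'$ are defined in the same way using $F(\mathcal C')$ and the edges of $G'$. *)

theory Defs
  imports Complex_Main "HOL-Library.FuncSet" "HOL-Algebra.Finite_Extensions" "HOL-Algebra.Generated_Fields"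
begin

section \<open>Affine varieties over the complex numbers\<close>

text \<open>The affine space with coordinates indexed by \<open>I\<close> consists of the functions
  \<open>I \<rightarrow>\<^sub>E UNIV\<close>; \<open>I\<close> is always finite below. As the complex field is infinite, polynomials in
  these coordinates are the same as polynomial functions on this space.\<close>

definition affine_space :: "'i set \<Rightarrow> ('i \<Rightarrow> complex) set" where
  "affine_space I = (I \<rightarrow>\<^sub>E UNIV)"

inductive_set poly_funs :: "'i set \<Rightarrow> (('i \<Rightarrow> complex) \<Rightarrow> complex) set" for I where
  const: "(\<lambda>x. c) \<in> poly_funs I"
| coord: "i \<in> I \<Longrightarrow> (\<lambda>x. x i) \<in> poly_funs I"
| add: "\<lbrakk>p \<in> poly_funs I; q \<in> poly_funs I\<rbrakk> \<Longrightarrow> (\<lambda>x. p x + q x) \<in> poly_funs I"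
| mult: "\<lbrakk>p \<in> poly_funs I; q \<in> poly_funs I\<rbrakk> \<Longrightarrow> (\<lambda>x. p x * q x) \<in> poly_funs I"

definition zero_locus :: "'i set \<Rightarrow> (('i \<Rightarrow> complex) \<Rightarrow> complex) set \<Rightarrow> ('i \<Rightarrow> complex) set" where
  "zero_locus I P = {x \<in> affine_space I. \<forall>p\<in>P. p x = 0}"

definition algebraic_set :: "'i set \<Rightarrow> ('i \<Rightarrow> complex) set \<Rightarrow> bool" where
  "algebraic_set I S \<longleftrightarrow> (\<exists>P. P \<subseteq> poly_funs I \<and> S = zero_locus I P)"

definition zariski_closure :: "'i set \<Rightarrow> ('i \<Rightarrow> complex) set \<Rightarrow> ('i \<Rightarrow> complex) set" where
  "zariski_closure I S = \<Inter>{Z. algebraic_set I Z \<and> S \<subseteq> Z}"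

definition irreducible_variety :: "'i set \<Rightarrow> ('i \<Rightarrow> complex) set \<Rightarrow> bool" where
  "irreducible_variety I S \<longleftrightarrow> algebraic_set I S \<and> S \<noteq> {} \<and>
     (\<forall>A B. algebraic_set I A \<and> algebraic_set I B \<and> S = A \<union> B \<longrightarrow> S = A \<or> S = B)"

definition coord_ring :: "'i set \<Rightarrow> ('i \<Rightarrow> complex) set \<Rightarrow> (('i \<Rightarrow> complex) \<Rightarrow> complex) ring" where
  "coord_ring I S =
     \<lparr>carrier = (\<lambda>p. restrict p S) ` poly_funs I,
      mult = (\<lambda>f g. \<lambda>x\<in>S. f x * g x), one = (\<lambda>x\<in>S. 1),
      zero = (\<lambda>x\<in>S. 0), add = (\<lambda>f g. \<lambda>x\<in>S. f x + g x)\<rparr>"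


section \<open>The field of fractions of a domain\<close>

definition frac_rel :: "('a, 'b) ring_scheme \<Rightarrow> (('a \<times> 'a) \<times> ('a \<times> 'a)) set" where
  "frac_rel R = {((a, b), (c, d)).
     a \<in> carrier R \<and> b \<in> carrier R - {\<zero>\<^bsub>R\<^esub>} \<and> c \<in> carrier R \<and> d \<in> carrier R - {\<zero>\<^bsub>R\<^esub>} \<and>
     a \<otimes>\<^bsub>R\<^esub> d = c \<otimes>\<^bsub>R\<^esub> b}"

definition fraction :: "('a, 'b) ring_scheme \<Rightarrow> 'a \<Rightarrow> 'a \<Rightarrow> ('a \<times> 'a) set" where
  "fraction R a b = frac_rel R `` {(a, b)}"

definition frac_field :: "('a, 'b) ring_scheme \<Rightarrow> ('a \<times> 'a) set ring" where
  "frac_field R =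
     \<lparr>carrier = (carrier R \<times> (carrier R - {\<zero>\<^bsub>R\<^esub>})) // frac_rel R,
      mult = (\<lambda>A B. \<Union>(a, b)\<in>A. \<Union>(c, d)\<in>B. fraction R (a \<otimes>\<^bsub>R\<^esub> c) (b \<otimes>\<^bsub>R\<^esub> d)),
      one = fraction R \<one>\<^bsub>R\<^esub> \<one>\<^bsub>R\<^esub>,
      zero = fraction R \<zero>\<^bsub>R\<^esub> \<one>\<^bsub>R\<^esub>,
      add = (\<lambda>A B. \<Union>(a, b)\<in>A. \<Union>(c, d)\<in>B.
               fraction R (a \<otimes>\<^bsub>R\<^esub> d \<oplus>\<^bsub>R\<^esub> c \<otimes>\<^bsub>R\<^esub> b) (b \<otimes>\<^bsub>R\<^esub> d))\<rparr>"


section \<open>Function fields, curves and valuations\<close>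

type_synonym 'i ratfun = "((('i \<Rightarrow> complex) \<Rightarrow> complex) \<times> (('i \<Rightarrow> complex) \<Rightarrow> complex)) set"

definition function_field :: "'i set \<Rightarrow> ('i \<Rightarrow> complex) set \<Rightarrow> 'i ratfun ring" where
  "function_field I S = frac_field (coord_ring I S)"

definition regular :: "'i set \<Rightarrow> ('i \<Rightarrow> complex) set \<Rightarrow> (('i \<Rightarrow> complex) \<Rightarrow> complex) \<Rightarrow> 'i ratfun" where
  "regular I S p = fraction (coord_ring I S) (restrict p S) \<one>\<^bsub>coord_ring I S\<^esub>"

definition constants :: "'i set \<Rightarrow> ('i \<Rightarrow> complex) set \<Rightarrow> 'i ratfun set" where
  "constants I S = (\<lambda>c. regular I S (\<lambda>x. c)) ` UNIV"

text \<open>The dimension of an irreducible variety is the transcendence degree of its function field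
  over the complex numbers. It is one if a single element forms a transcendence basis.\<close>

definition irreducible_curve :: "'i set \<Rightarrow> ('i \<Rightarrow> complex) set \<Rightarrow> bool" where
  "irreducible_curve I S \<longleftrightarrow> irreducible_variety I S \<and>
     (let F = function_field I S; K = constants I S in
        \<exists>t \<in> carrier F. ring.transcendental F K t \<and>
          (\<forall>z \<in> carrier F. ring.algebraic F (generate_field F (insert t K)) z))"

text \<open>A valuation is given by its values on the nonzero elements; it is \<open>undefined\<close> elsewhere, so
  that distinct elements of \<open>Val\<close> are distinct as valuations.\<close>

definition Val :: "'i set \<Rightarrow> ('i \<Rightarrow> complex) set \<Rightarrow> ('i ratfun \<Rightarrow> int) set" where
  "Val I S = (let F = function_field I S; U = carrier F - {\<zero>\<^bsub>F\<^esub>} in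
     {\<nu> \<in> U \<rightarrow>\<^sub>E UNIV.
        (\<forall>a\<in>U. \<forall>b\<in>U. \<nu> (a \<otimes>\<^bsub>F\<^esub> b) = \<nu> a + \<nu> b) \<and>
        (\<forall>a\<in>U. \<forall>b\<in>U. a \<oplus>\<^bsub>F\<^esub> b \<noteq> \<zero>\<^bsub>F\<^esub> \<longrightarrow> min (\<nu> a) (\<nu> b) \<le> \<nu> (a \<oplus>\<^bsub>F\<^esub> b)) \<and>
        (\<forall>c \<in> constants I S - {\<zero>\<^bsub>F\<^esub>}. \<nu> c = 0) \<and>
        \<nu> ` U = UNIV})"


section \<open>Projections and their degree\<close>

definition projection :: "'i set \<Rightarrow> ('i \<Rightarrow> complex) \<Rightarrow> ('i \<Rightarrow> complex)" where
  "projection J x = restrict x J"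

text \<open>For \<open>J \<subseteq> I\<close> and \<open>Y\<close> the closure of the projection of \<open>S\<close> to the coordinates in \<open>J\<close>, this is
  the field embedding of the function field of \<open>Y\<close> into that of \<open>S\<close> by composition with the
  projection.\<close>

definition pullback ::
  "'i set \<Rightarrow> ('i \<Rightarrow> complex) set \<Rightarrow> 'i set \<Rightarrow> 'i ratfun \<Rightarrow> 'i ratfun" where
  "pullback I S J A = (\<Union>(a, b)\<in>A. fraction (coord_ring I S)
     (\<lambda>x\<in>S. a (projection J x)) (\<lambda>x\<in>S. b (projection J x)))"

definition projection_degree ::
  "'i set \<Rightarrow> ('i \<Rightarrow> complex) set \<Rightarrow> 'i set \<Rightarrow> ('i \<Rightarrow> complex) set \<Rightarrow> nat" where
  "projection_degree I S J Y =
     ring.dim (function_field I S)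
       (pullback I S J ` carrier (function_field J Y)) (carrier (function_field I S))"


section \<open>Graphs and NAC-colorings\<close>

definition fin_graph :: "'v set \<Rightarrow> 'v set set \<Rightarrow> bool" where
  "fin_graph V E \<longleftrightarrow> finite V \<and> (\<forall>e\<in>E. e \<subseteq> V \<and> card e = 2)"

definition subgraph_of :: "'v set \<Rightarrow> 'v set set \<Rightarrow> 'v set \<Rightarrow> 'v set set \<Rightarrow> bool" where
  "subgraph_of V' E' V E \<longleftrightarrow> fin_graph V' E' \<and> V' \<subseteq> V \<and> E' \<subseteq> E"

definition cycle_edges :: "'v list \<Rightarrow> 'v set set" where
  "cycle_edges vs = {{vs ! i, vs ! (Suc i mod length vs)} |i. i < length vs}"

definition cycles :: "'v set set \<Rightarrow> 'v set set set" where
  "cycles E = {cycle_edges vs |vs. distinct vs \<and> 3 \<le> length vs \<and> cycle_edges vs \<subseteq> E}"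

datatype color = Red | Blue

definition NAC :: "'v set set \<Rightarrow> ('v set \<Rightarrow> color) set" where
  "NAC E = {\<delta> \<in> E \<rightarrow>\<^sub>E UNIV. \<delta> ` E = UNIV \<and>
     (\<forall>C \<in> cycles E. (\<exists>c. \<forall>e\<in>C. \<delta> e = c) \<or> (\<forall>c. 2 \<le> card {e\<in>C. \<delta> e = c}))}"


section \<open>Algebraic motions\<close>

datatype axis = Xaxis | Yaxis

definition coords :: "'v set \<Rightarrow> ('v \<times> axis) set" where
  "coords V = V \<times> UNIV"

definition config_space ::
  "'v set \<Rightarrow> 'v set set \<Rightarrow> ('v set \<Rightarrow> real) \<Rightarrow> 'v \<Rightarrow> 'v \<Rightarrow> ('v \<times> axis \<Rightarrow> complex) set" where
  "config_space V E lam u0 v0 = {\<rho> \<in> affine_space (coords V).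
     \<rho> (u0, Xaxis) = 0 \<and> \<rho> (u0, Yaxis) = 0 \<and>
     \<rho> (v0, Xaxis) = complex_of_real (lam {u0, v0}) \<and> \<rho> (v0, Yaxis) = 0 \<and>
     (\<forall>u v. {u, v} \<in> E \<longrightarrow>
        (\<rho> (u, Xaxis) - \<rho> (v, Xaxis))\<^sup>2 + (\<rho> (u, Yaxis) - \<rho> (v, Yaxis))\<^sup>2
          = (complex_of_real (lam {u, v}))\<^sup>2)}"

definition algebraic_motion ::
  "'v set \<Rightarrow> 'v set set \<Rightarrow> ('v set \<Rightarrow> real) \<Rightarrow> 'v \<Rightarrow> 'v \<Rightarrow> ('v \<times> axis \<Rightarrow> complex) set \<Rightarrow> bool" where
  "algebraic_motion V E lam u0 v0 C \<longleftrightarrow> {u0, v0} \<in> E \<and>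
     irreducible_curve (coords V) C \<and> C \<subseteq> config_space V E lam u0 v0"

definition W :: "'v set \<Rightarrow> ('v \<times> axis \<Rightarrow> complex) set \<Rightarrow> 'v \<Rightarrow> 'v \<Rightarrow> ('v \<times> axis) ratfun" where
  "W V C u v = regular (coords V) C
     (\<lambda>\<rho>. (\<rho> (v, Xaxis) - \<rho> (u, Xaxis)) + \<i> * (\<rho> (v, Yaxis) - \<rho> (u, Yaxis)))"

text \<open>On an algebraic motion, \<open>W V C u v\<close> is nonzero for every edge \<open>{u, v}\<close>, since it divides the
  nonzero constant \<open>(lam {u, v})\<^sup>2\<close>. Hence its value is never infinite, and it is the same for
  \<open>W V C v u = - W V C u v\<close>, so the following is well defined.\<close>

definition edge_val ::
  "'v set \<Rightarrow> ('v \<times> axis \<Rightarrow> complex) set \<Rightarrow> (('v \<times> axis) ratfun \<Rightarrow> int) \<Rightarrow> 'v set \<Rightarrow> int" where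
  "edge_val V C \<nu> e = (THE n. \<exists>u v. e = {u, v} \<and> n = \<nu> (W V C u v))"

definition gap ::
  "'v set \<Rightarrow> 'v set set \<Rightarrow> ('v \<times> axis \<Rightarrow> complex) set \<Rightarrow> ('v set \<Rightarrow> color) \<Rightarrow>
   (('v \<times> axis) ratfun \<Rightarrow> int) \<Rightarrow> int" where
  "gap V E C \<delta> \<nu> = max 0
     (Min (edge_val V C \<nu> ` {e\<in>E. \<delta> e = Red}) - Max (edge_val V C \<nu> ` {e\<in>E. \<delta> e = Blue}))"

text \<open>\<open>Val\<close> is infinite, but only finitely many valuations contribute. The sum is taken over these,
  because \<open>sum\<close> is zero on infinite index sets.\<close>

definition mu ::
  "'v set \<Rightarrow> 'v set set \<Rightarrow> ('v \<times> axis \<Rightarrow> complex) set \<Rightarrow> ('v set \<Rightarrow> color) \<Rightarrow> int" where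
  "mu V E C \<delta> = (\<Sum>\<nu> \<in> {\<nu> \<in> Val (coords V) C. gap V E C \<delta> \<nu> \<noteq> 0}. gap V E C \<delta> \<nu>)"

end

theory Submission
  imports Defs "HOL-Computational_Algebra.Fundamental_Theorem_Algebra"
begin

text \<open>For a valuation \<open>\<nu>\<close> of \<open>F(C)\<close>, coloring an edge red iff its value is at least a threshold
  \<open>n\<close> gives a NAC-coloring as soon as both colors occur: around a cycle the \<open>W\<^sub>e\<close> sum to zero, and so do
  their conjugates \<open>\<lambda>(e)\<^sup>2 / W\<^sub>e\<close>, so the minimal value is attained twice. The gap of a coloring
  counts the thresholds inducing it; hence the gaps of the extensions of \<open>\<delta>'\<close> add up to the gap of
  \<open>\<delta>'\<close> with respect to the restriction of \<open>\<nu>\<close> to \<open>F(C')\<close>, and this restriction is a multiple \<open>e \<cdot> \<nu>'\<close> of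
  some \<open>\<nu>' \<in> Val(C')\<close> whenever the gap is positive. The theorem follows from the fundamental identity
  \<open>\<Sum> e = deg f\<close>, summed over the \<open>\<nu>\<close> above a given \<open>\<nu>'\<close>.

  The inequality \<open>\<le>\<close> of the identity is the independence of a family built by weak approximation. For the
  converse, take \<open>x \<in> F(C')\<close> with a pole at \<open>\<nu>'\<close>: a dimension count for the spaces of functions with
  bounded poles shows that the degree of the polar divisor of \<open>x\<close> is multiplied by at least
  \<open>deg f\<close> when passing from \<open>F(C')\<close> to \<open>F(C)\<close>.\<close>

section \<open>Polynomials in one element and valuations\<close>

text \<open>Both function fields are given as sets of formal fractions, while values, degrees and
  the inclusion have to be compared between them. They are therefore realized inside one field type,
  an ultrapower of the complex numbers: evaluation at a family of points that avoids the zeros of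
  more and more functions is an injective homomorphism, a substitute for the generic point. The
  points for C' are the projections of those for C, so the inclusion of F(C') in F(C) becomes
  literal. The dimension count rests on the bound \<open>1 + deg D\<close> for the functions with
  poles bounded by D, hence on the fact that a function without poles is constant. This is the
  obstacle that brings in the existence of places: a ring maximal among those that contain
  \<open>1 / y\<close> and omit \<open>y\<close> is a valuation ring, and finiteness of F(C) over
  C(x) makes it discrete. All residue fields are C. No completions or integral closures enter;
  integrality over C[x] occurs only as an inequality between values.\<close>

lemma poly_induct_linear [consumes 1, case_names const linear]:
  fixes p :: "complex poly"
  assumes "p \<noteq> 0" and "\<And>c. c \<noteq> 0 \<Longrightarrow> P [:c:]"
    and "\<And>z q. q \<noteq> 0 \<Longrightarrow> P q \<Longrightarrow> P ([:- z, 1:] * q)"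
  shows "P p"
  using assms(1)
proof (induction "Polynomial.degree p" arbitrary: p rule: less_induct)
  case less
  show ?case
  proof (cases "Polynomial.degree p = 0")
    case True
    then obtain c where "p = [:c:]" by (meson degree_eq_zeroE)
    with less.prems assms(2) show ?thesis by simp
  next
    case False
    then obtain z where "poly p z = 0"
      by (metis fundamental_theorem_of_algebra constant_degree)
    then obtain q where q: "p = [:- z, 1:] * q"
      by (metis dvdE poly_eq_0_iff_dvd)
    with less.prems have "q \<noteq> 0" by auto
    have "Polynomial.degree p = Suc (Polynomial.degree q)"
      unfolding q using \<open>q \<noteq> 0\<close> by (subst degree_mult_eq) auto
    then have "P q" using less.hyps[of q] \<open>q \<noteq> 0\<close> by simp
    from assms(3)[OF \<open>q \<noteq> 0\<close> this] show ?thesis unfolding q .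
  qed
qed

locale complex_subfield =
  fixes \<iota> :: "complex \<Rightarrow> 'k::field"
  assumes iota_1 [simp]: "\<iota> 1 = 1"
    and iota_add: "\<iota> (a + b) = \<iota> a + \<iota> b"
    and iota_mult: "\<iota> (a * b) = \<iota> a * \<iota> b"
begin

lemma iota_0 [simp]: "\<iota> 0 = 0"
  using iota_add[of 0 1] by simp

lemma iota_minus: "\<iota> (- a) = - \<iota> a"
  using iota_add[of "-a" a] by (simp add: eq_neg_iff_add_eq_0)

lemma iota_eq_0_iff [simp]: "\<iota> a = 0 \<longleftrightarrow> a = 0"
proof
  assume "\<iota> a = 0"
  then show "a = 0"
    using iota_mult[of a "inverse a"] by (cases "a = 0") auto
qed simp

lemma iota_inverse: "\<iota> (inverse a) = inverse (\<iota> a)"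
  by (cases "a = 0") (auto simp: iota_mult[symmetric] intro!: inverse_unique[symmetric])

definition ev :: "complex poly \<Rightarrow> 'k \<Rightarrow> 'k" where
  "ev p x = poly (map_poly \<iota> p) x"

lemma ev_0 [simp]: "ev 0 x = 0"
  by (simp add: ev_def)

lemma ev_pCons [simp]: "ev (pCons a p) x = \<iota> a + x * ev p x"
  by (simp add: ev_def map_poly_pCons)

lemma ev_1 [simp]: "ev 1 x = 1"
  by (simp add: one_pCons)

lemma ev_add: "ev (p + q) x = ev p x + ev q x"
proof -
  have "map_poly \<iota> (p + q) = map_poly \<iota> p + map_poly \<iota> q"
    by (rule poly_eqI) (simp add: coeff_map_poly iota_add)
  then show ?thesis by (simp add: ev_def)
qed

lemma ev_smult: "ev (smult c p) x = \<iota> c * ev p x"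
  by (induction p) (auto simp: iota_mult algebra_simps)

lemma ev_minus: "ev (- p) x = - ev p x"
  using ev_smult[of "-1" p x] by (simp add: iota_minus)

lemma ev_mult: "ev (p * q) x = ev p x * ev q x"
  by (induction p) (auto simp: ev_add ev_smult algebra_simps)

lemma ev_sum: "ev (sum f I) x = (\<Sum>i\<in>I. ev (f i) x)"
  by (induction I rule: infinite_finite_induct) (auto simp: ev_add)

lemma ev_monom: "ev (Polynomial.monom c n) x = \<iota> c * x ^ n"
  by (induction n) (auto simp: monom_0 monom_Suc)

lemma ev_altdef: "ev p x = (\<Sum>i\<le>Polynomial.degree p. \<iota> (Polynomial.coeff p i) * x ^ i)"
proof -
  have "ev p x = ev (\<Sum>i\<le>Polynomial.degree p. Polynomial.monom (Polynomial.coeff p i) i) x"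
    by (simp only: poly_as_sum_of_monoms)
  then show ?thesis by (simp add: ev_sum ev_monom)
qed

text \<open>Since C is algebraically closed, \<open>p\<close> splits into linear factors and each
  \<open>x - \<iota> z\<close> is nonzero: an element that is not constant is
  transcendental.\<close>

lemma ev_nonzero:
  assumes "x \<notin> range \<iota>" "p \<noteq> 0"
  shows "ev p x \<noteq> 0"
  using assms(2)
proof (induction p rule: poly_induct_linear)
  case (linear z q)
  have "x - \<iota> z \<noteq> 0" using assms(1) by auto
  with linear show ?case by (simp add: ev_mult iota_minus del: mult_pCons_left)
qed simp

section \<open>Valuations over the constants and the ultrametric inequality\<close>

definition valuation_on :: "'k set \<Rightarrow> ('k \<Rightarrow> int) \<Rightarrow> bool" where
  "valuation_on A v \<longleftrightarrow>
     (\<forall>a\<in>A - {0}. \<forall>b\<in>A - {0}. v (a * b) = v a + v b) \<and>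
     (\<forall>a\<in>A - {0}. \<forall>b\<in>A - {0}. a + b \<noteq> 0 \<longrightarrow> min (v a) (v b) \<le> v (a + b)) \<and>
     (\<forall>c. c \<noteq> 0 \<longrightarrow> v (\<iota> c) = 0)"

definition Vals :: "'k set \<Rightarrow> ('k \<Rightarrow> int) set" where
  "Vals A = {v \<in> (A - {0}) \<rightarrow>\<^sub>E UNIV. valuation_on A v \<and> v ` (A - {0}) = UNIV}"

text \<open>Encodes the convention that 0 has infinite value; \<open>v 0\<close> itself carries no
  information, so lower bounds go through this predicate.\<close>

definition vge :: "('k \<Rightarrow> int) \<Rightarrow> 'k \<Rightarrow> int \<Rightarrow> bool" where
  "vge v a n \<longleftrightarrow> a = 0 \<or> n \<le> v a"

lemma vge_0 [simp]: "vge v 0 n" by (simp add: vge_def)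

lemma vge_mono: "vge v a n \<Longrightarrow> m \<le> n \<Longrightarrow> vge v a m"
  by (auto simp: vge_def)

end

text \<open>The field is a subset of an ambient field type and not a type of its own, so that
  \<open>F\<close> and a subfield \<open>F'\<close> share their arithmetic and an inclusion needs no
  embedding.\<close>

locale extension_field = complex_subfield \<iota> for \<iota> :: "complex \<Rightarrow> 'k::field" +
  fixes F :: "'k set"
  assumes iota_mem [simp, intro]: "\<iota> c \<in> F"
    and add_mem [intro]: "a \<in> F \<Longrightarrow> b \<in> F \<Longrightarrow> a + b \<in> F"
    and mult_mem [intro]: "a \<in> F \<Longrightarrow> b \<in> F \<Longrightarrow> a * b \<in> F"
    and inverse_mem [intro]: "a \<in> F \<Longrightarrow> inverse a \<in> F"
begin

lemma zero_mem [simp, intro]: "0 \<in> F"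
  using iota_mem[of 0] by simp

lemma one_mem [simp, intro]: "1 \<in> F"
  using iota_mem[of 1] by simp

lemma uminus_mem [intro]: "a \<in> F \<Longrightarrow> - a \<in> F"
  using mult_mem[OF iota_mem[of "-1"], of a] by (simp add: iota_minus)

lemma diff_mem [intro]: "a \<in> F \<Longrightarrow> b \<in> F \<Longrightarrow> a - b \<in> F"
  using add_mem[of a "-b"] by auto

lemma divide_mem [intro]: "a \<in> F \<Longrightarrow> b \<in> F \<Longrightarrow> a / b \<in> F"
  unfolding divide_inverse by auto

lemma power_mem [intro]: "a \<in> F \<Longrightarrow> a ^ n \<in> F"
  by (induction n) auto

lemma sum_mem [intro]: "(\<And>i. i \<in> I \<Longrightarrow> f i \<in> F) \<Longrightarrow> sum f I \<in> F"
  by (induction I rule: infinite_finite_induct) auto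

lemma ev_mem [intro]: "x \<in> F \<Longrightarrow> ev p x \<in> F"
  by (induction p) auto

context
  fixes v assumes v: "valuation_on F v"
begin

lemma val_mult: "a \<in> F \<Longrightarrow> b \<in> F \<Longrightarrow> a \<noteq> 0 \<Longrightarrow> b \<noteq> 0 \<Longrightarrow> v (a * b) = v a + v b"
  using v by (auto simp: valuation_on_def)

lemma val_add: "a \<in> F \<Longrightarrow> b \<in> F \<Longrightarrow> a \<noteq> 0 \<Longrightarrow> b \<noteq> 0 \<Longrightarrow> a + b \<noteq> 0 \<Longrightarrow> min (v a) (v b) \<le> v (a + b)"
  using v by (auto simp: valuation_on_def)

lemma val_iota: "c \<noteq> 0 \<Longrightarrow> v (\<iota> c) = 0"
  using v by (auto simp: valuation_on_def)

lemma val_1: "v 1 = 0"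
  using val_iota[of 1] by simp

lemma val_uminus: "a \<in> F \<Longrightarrow> a \<noteq> 0 \<Longrightarrow> v (- a) = v a"
  using val_mult[OF iota_mem[of "-1"], of a] val_iota[of "-1"] by (simp add: iota_minus)

lemma val_inverse: "a \<in> F \<Longrightarrow> a \<noteq> 0 \<Longrightarrow> v (inverse a) = - v a"
  using val_mult[of a "inverse a"] val_1 inverse_mem[of a] by (auto simp: eq_neg_iff_add_eq_0 add.commute)

lemma val_divide: "a \<in> F \<Longrightarrow> b \<in> F \<Longrightarrow> a \<noteq> 0 \<Longrightarrow> b \<noteq> 0 \<Longrightarrow> v (a / b) = v a - v b"
  unfolding divide_inverse by (subst val_mult) (auto simp: val_inverse)

lemma val_power: "a \<in> F \<Longrightarrow> a \<noteq> 0 \<Longrightarrow> v (a ^ n) = int n * v a"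
  by (induction n) (auto simp: val_1 val_mult power_mem algebra_simps)

lemma vge_add: "a \<in> F \<Longrightarrow> b \<in> F \<Longrightarrow> vge v a n \<Longrightarrow> vge v b n \<Longrightarrow> vge v (a + b) n"
  using val_add[of a b] unfolding vge_def by (cases "a = 0"; cases "b = 0"; fastforce)

lemma vge_uminus: "a \<in> F \<Longrightarrow> vge v a n \<Longrightarrow> vge v (- a) n"
  using val_uminus[of a] unfolding vge_def by (cases "a = 0") auto

lemma vge_diff: "a \<in> F \<Longrightarrow> b \<in> F \<Longrightarrow> vge v a n \<Longrightarrow> vge v b n \<Longrightarrow> vge v (a - b) n"
  using vge_add[of a "-b" n] vge_uminus[of b n] by auto

lemma vge_mult: "a \<in> F \<Longrightarrow> b \<in> F \<Longrightarrow> vge v a n \<Longrightarrow> vge v b m \<Longrightarrow> vge v (a * b) (n + m)"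
  using val_mult[of a b] unfolding vge_def by (cases "a = 0"; cases "b = 0"; auto)

lemma vge_iota: "vge v (\<iota> c) 0"
  using val_iota[of c] by (cases "c = 0") (auto simp: vge_def)

lemma vge_power: "a \<in> F \<Longrightarrow> vge v a n \<Longrightarrow> vge v (a ^ m) (int m * n)"
  using val_power[of a m] by (cases "a = 0"; cases "m = 0") (auto simp: vge_def val_1 intro: mult_left_mono)

lemma vge_sum: "(\<And>i. i \<in> I \<Longrightarrow> f i \<in> F) \<Longrightarrow> (\<And>i. i \<in> I \<Longrightarrow> vge v (f i) n) \<Longrightarrow> vge v (sum f I) n"
proof (induction I rule: infinite_finite_induct)
  case (insert x I)
  then show ?case by (auto intro!: vge_add sum_mem)
qed auto

lemma vge_ev: "x \<in> F \<Longrightarrow> vge v x 0 \<Longrightarrow> vge v (ev p x) 0"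
proof (induction p)
  case (pCons a p)
  have "vge v (x * ev p x) (0 + 0)" using pCons by (intro vge_mult) auto
  with pCons show ?case by (auto intro!: vge_add vge_iota)
qed auto

lemma val_add_eq:
  assumes "a \<in> F" "b \<in> F" "a \<noteq> 0" "vge v b (v a + 1)"
  shows "a + b \<noteq> 0" "v (a + b) = v a"
proof -
  have nz: False if "a + b = 0"
  proof -
    have "b = - a" using that by (simp add: eq_neg_iff_add_eq_0 add.commute)
    with assms val_uminus[of a] show False by (auto simp: vge_def)
  qed
  then show "a + b \<noteq> 0" by blast
  have "vge v (a + b) (v a)" using assms by (intro vge_add) (auto simp: vge_def)
  moreover have False if "v a + 1 \<le> v (a + b)"
  proof -
    have "vge v (a + b - b) (v a + 1)"
      using assms that by (intro vge_diff) (auto simp: vge_def)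
    then show False using assms by (auto simp: vge_def)
  qed
  ultimately show "v (a + b) = v a" using nz by (force simp: vge_def)
qed

text \<open>A single term of strictly least value cannot be cancelled. Most independence arguments
  below consist in finding such a term.\<close>

lemma val_sum_dominant:
  assumes "finite I" "k \<in> I" "\<And>i. i \<in> I \<Longrightarrow> f i \<in> F" "f k \<noteq> 0"
    and "\<And>i. i \<in> I \<Longrightarrow> i \<noteq> k \<Longrightarrow> vge v (f i) (v (f k) + 1)"
  shows "sum f I \<noteq> 0" "v (sum f I) = v (f k)"
proof -
  have "sum f I = f k + sum f (I - {k})" using assms by (simp add: sum.remove)
  moreover have "vge v (sum f (I - {k})) (v (f k) + 1)" using assms by (intro vge_sum) auto
  moreover have "sum f (I - {k}) \<in> F" using assms by auto
  ultimately show "sum f I \<noteq> 0" "v (sum f I) = v (f k)"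
    using val_add_eq[of "f k" "sum f (I - {k})"] assms by auto
qed

text \<open>At a pole of \<open>x\<close> the leading monomial dominates. The factor of
  \<open>v x\<close> is the degree, the same at every pole of \<open>x\<close>; this uniformity is
  what \<open>ramification_family\<close> asks of coefficients.\<close>

lemma val_ev_pole:
  assumes "x \<in> F" "x \<noteq> 0" "v x < 0" "p \<noteq> 0"
  shows "ev p x \<noteq> 0" "v (ev p x) = int (Polynomial.degree p) * v x"
proof -
  let ?f = "\<lambda>i. \<iota> (Polynomial.coeff p i) * x ^ i" and ?n = "Polynomial.degree p"
  have lc: "Polynomial.coeff p ?n \<noteq> 0" using assms(4) by simp
  have fn: "v (?f ?n) = int ?n * v x"
    using lc assms by (subst val_mult) (auto simp: val_iota val_power power_mem)
  have "vge v (?f i) (v (?f ?n) + 1)" if "i \<in> {..?n}" "i \<noteq> ?n" for i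
  proof (cases "Polynomial.coeff p i = 0")
    case False
    then have "v (?f i) = int i * v x"
      using assms by (subst val_mult) (auto simp: val_iota val_power power_mem)
    moreover have "int ?n * v x < int i * v x"
      using that assms(3) by (intro mult_strict_right_mono_neg) auto
    ultimately show ?thesis unfolding fn by (simp add: vge_def)
  qed auto
  then have "(\<Sum>i\<le>?n. ?f i) \<noteq> 0" "v (\<Sum>i\<le>?n. ?f i) = v (?f ?n)"
    using assms lc by (intro val_sum_dominant; auto)+
  then show "ev p x \<noteq> 0" "v (ev p x) = int ?n * v x"
    using fn by (auto simp: ev_altdef)
qed

end

lemma valuation_not_iota:
  assumes "valuation_on F v" "v x \<noteq> 0" "x \<noteq> 0"
  shows "x \<notin> range \<iota>"
  using assms val_iota by auto

lemma ValsD: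
  assumes "v \<in> Vals F"
  shows "valuation_on F v" "v \<in> (F - {0}) \<rightarrow>\<^sub>E UNIV" "\<exists>a. a \<in> F \<and> a \<noteq> 0 \<and> v a = n"
proof -
  have "n \<in> v ` (F - {0})" using assms by (auto simp: Vals_def)
  then show "\<exists>a. a \<in> F \<and> a \<noteq> 0 \<and> v a = n" by auto
qed (use assms in \<open>auto simp: Vals_def\<close>)

end

section \<open>Independent families from valuations\<close>

text \<open>One argument for two kinds of scalars: \<open>act\<close> stands for polynomials in
  \<open>x\<close> acting by \<open>ev p x * y\<close>, or for multiplication by elements of a
  subfield. A longer family is cut down to \<open>N\<close> members and the other coefficients are
  set to 0.\<close>

lemma dependent_reindex:
  fixes act :: "'c::zero \<Rightarrow> 'y \<Rightarrow> 'm::comm_monoid_add"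
  assumes N: "\<And>w::nat \<Rightarrow> 'y. \<forall>i<N. w i \<in> F \<Longrightarrow>
      \<exists>c. (\<forall>i<N. c i \<in> A) \<and> (\<exists>i<N. c i \<noteq> 0) \<and> (\<Sum>i<N. act (c i) (w i)) = 0"
    and A: "0 \<in> A" "\<And>y. act 0 y = 0"
    and I: "finite I" "N \<le> card I" "w ` I \<subseteq> F"
  shows "\<exists>c. (\<forall>i\<in>I. c i \<in> A) \<and> (\<exists>i\<in>I. c i \<noteq> 0) \<and> (\<Sum>i\<in>I. act (c i) (w i)) = 0"
proof -
  obtain J where J: "J \<subseteq> I" "card J = N" by (meson I(2) obtain_subset_with_card_n)
  have "finite J" using J I finite_subset by blast
  then obtain h where h: "bij_betw h {..<N} J"
    using ex_bij_betw_nat_finite[of J] J by (auto simp: lessThan_atLeast0)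
  have "\<forall>i<N. w (h i) \<in> F" using bij_betwE[OF h] J(1) I(3) by blast
  from N[OF this] obtain c where c: "\<forall>i<N. c i \<in> A" "\<exists>i<N. c i \<noteq> 0" "(\<Sum>i<N. act (c i) (w (h i))) = 0"
    by blast
  define d where "d = (\<lambda>i. if i \<in> J then c (the_inv_into {..<N} h i) else 0)"
  have dh: "d (h i) = c i" if "i < N" for i
    using that h by (auto simp: d_def bij_betw_def the_inv_into_f_f)
  have "(\<Sum>i\<in>I. act (d i) (w i)) = (\<Sum>i\<in>J. act (d i) (w i))"
    using J I A by (intro sum.mono_neutral_right) (auto simp: d_def)
  also have "\<dots> = (\<Sum>i<N. act (d (h i)) (w (h i)))"
    using sum.reindex_bij_betw[OF h, of "\<lambda>i. act (d i) (w i)"] by simp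
  also have "\<dots> = 0" using c(3) by (simp add: dh)
  finally have s: "(\<Sum>i\<in>I. act (d i) (w i)) = 0" .
  have "d i \<in> A" if "i \<in> I" for i
  proof (cases "i \<in> J")
    case True
    then obtain k where "k < N" "i = h k" using h by (auto simp: bij_betw_def)
    then show ?thesis using c(1) dh by simp
  qed (simp add: d_def A)
  moreover from c(2) obtain i where "i < N" "c i \<noteq> 0" by blast
  then have "h i \<in> I" "d (h i) \<noteq> 0" using h J dh by (auto simp: bij_betw_def)
  ultimately show ?thesis using s by blast
qed

text \<open>The axiom says that \<open>F\<close> is a finite extension of C(x) for every nonconstant
  \<open>x\<close>. Denominators are cleared, because the values of polynomials in \<open>x\<close>
  are easy to control.\<close>

locale curve_field = extension_field \<iota> F for \<iota> :: "complex \<Rightarrow> 'k::field" and F :: "'k set" +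
  assumes bounded_rank: "x \<in> F \<Longrightarrow> x \<notin> range \<iota> \<Longrightarrow>
    \<exists>N. \<forall>w::nat \<Rightarrow> 'k. (\<forall>i<N. w i \<in> F) \<longrightarrow>
      (\<exists>p. (\<exists>i<N. p i \<noteq> 0) \<and> (\<Sum>i<N. ev (p i) x * w i) = 0)"
begin

lemma dependent_family:
  assumes "x \<in> F" "x \<notin> range \<iota>"
  shows "\<exists>N. \<forall>(I::'a set) w. finite I \<longrightarrow> N \<le> card I \<longrightarrow> w ` I \<subseteq> F \<longrightarrow>
    (\<exists>p. (\<exists>i\<in>I. p i \<noteq> 0) \<and> (\<Sum>i\<in>I. ev (p i) x * w i) = 0)"
proof -
  obtain N where N: "\<forall>w::nat \<Rightarrow> 'k. (\<forall>i<N. w i \<in> F) \<longrightarrow>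
      (\<exists>p. (\<exists>i<N. p i \<noteq> 0) \<and> (\<Sum>i<N. ev (p i) x * w i) = 0)"
    using bounded_rank[OF assms] by (elim exE) (rule that)
  have "\<exists>p. (\<exists>i\<in>I. p i \<noteq> 0) \<and> (\<Sum>i\<in>I. ev (p i) x * w i) = 0"
    if "finite I" "N \<le> card I" "w ` I \<subseteq> F" for I :: "'a set" and w
    using dependent_reindex[where A = UNIV and act = "\<lambda>p y. ev p x * y" and F = F and N = N, OF _ _ _ that] N
    by simp
  then show ?thesis by blast
qed

lemma algebraic_relation:
  assumes "x \<in> F" "x \<notin> range \<iota>" "y \<in> F"
  obtains p and N :: nat where "\<exists>i<N. p i \<noteq> 0" "(\<Sum>i<N. ev (p i) x * y ^ i) = 0"
proof -
  obtain N where N: "\<And>w::nat \<Rightarrow> 'k. (\<forall>i<N. w i \<in> F) \<Longrightarrow>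
      \<exists>p. (\<exists>i<N. p i \<noteq> 0) \<and> (\<Sum>i<N. ev (p i) x * w i) = 0"
    using bounded_rank[OF assms(1,2)] by metis
  have "\<forall>i<N. y ^ i \<in> F" using assms by auto
  from N[OF this] that show thesis by blast
qed

text \<open>If no \<open>a - c\<close> had positive value, \<open>v\<close> would be trivial on the polynomials in \<open>a\<close>, hence on
  the field, which is algebraic over them.\<close>

lemma residue:
  assumes "v \<in> Vals F" "a \<in> F" "vge v a 0"
  shows "\<exists>c. vge v (a - \<iota> c) 1"
proof (rule ccontr)
  assume neg: "\<nexists>c. vge v (a - \<iota> c) 1"
  note v = ValsD(1)[OF assms(1)]
  have nz: "a - \<iota> c \<noteq> 0" for c using neg unfolding vge_def by blast
  then have a: "a \<notin> range \<iota>" by auto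
  have v0: "v (a - \<iota> c) = 0" for c
  proof -
    have "vge v (a - \<iota> c) 0" using assms by (intro vge_diff[OF v] vge_iota[OF v]) auto
    moreover have "\<not> 1 \<le> v (a - \<iota> c)" using neg by (auto simp: vge_def)
    ultimately show ?thesis using nz[of c] by (auto simp: vge_def)
  qed
  have triv: "v (ev p a) = 0" if "p \<noteq> 0" for p
    using that
  proof (induction p rule: poly_induct_linear)
    case (linear z q)
    have "ev q a \<noteq> 0" using ev_nonzero[OF a] linear(1) by blast
    with linear show ?case using nz[of z] v0[of z] assms(2) val_mult[OF v, of "a - \<iota> z" "ev q a"]
      by (simp add: ev_mult iota_minus diff_mem ev_mem del: mult_pCons_left)
  qed (simp add: val_iota[OF v])
  obtain z where z: "z \<in> F" "z \<noteq> 0" "v z = 1" using ValsD(3)[OF assms(1)] by blast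
  obtain p and N :: nat where p: "\<exists>i<N. p i \<noteq> 0" "(\<Sum>i<N. ev (p i) a * z ^ i) = 0"
    using algebraic_relation[OF assms(2) a z(1)] by blast
  \<comment> \<open>The coefficients have value 0 and \<open>z\<close> has value 1, so the i-th
    nonzero term has value i and the lowest one dominates.\<close>
  define k where "k = (LEAST i. i < N \<and> p i \<noteq> 0)"
  have k: "k < N" "p k \<noteq> 0"
    using LeastI_ex[OF p(1)[unfolded Bex_def]] unfolding k_def by auto
  have least: "p i = 0" if "i < k" for i
    using not_less_Least[of i "\<lambda>i. i < N \<and> p i \<noteq> 0"] that k unfolding k_def by auto
  have val: "v (ev (p i) a * z ^ i) = int i" "ev (p i) a * z ^ i \<noteq> 0" if "p i \<noteq> 0" for i
    using that triv[OF that] ev_nonzero[OF a that] assms(2) z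
    by (auto simp: val_mult[OF v] val_power[OF v] power_mem ev_mem)
  have "(\<Sum>i<N. ev (p i) a * z ^ i) \<noteq> 0"
  proof (rule val_sum_dominant[OF v])
    show "vge v (ev (p i) a * z ^ i) (v (ev (p k) a * z ^ k) + 1)" if "i \<in> {..<N}" "i \<noteq> k" for i
      using val[of i] val[of k] k least[of i] that by (cases "p i = 0") (auto simp: vge_def)
  qed (use k val assms z in auto)
  with p(2) show False by simp
qed

text \<open>The leading coefficient of a relation for \<open>y\<close> over C[x] makes
  \<open>y\<close> integral: if the product had negative value, the top term of the relation would
  be the unique smallest one. Since \<open>q\<close> is read off from the relation, it serves all
  \<open>v\<close> at once.\<close>

lemma integral_multiple:
  assumes "x \<in> F" "x \<notin> range \<iota>" "y \<in> F"
  shows "\<exists>q. q \<noteq> 0 \<and> (\<forall>v. valuation_on F v \<longrightarrow> vge v x 0 \<longrightarrow> vge v (ev q x * y) 0)"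
proof -
  obtain p and N :: nat where p: "\<exists>i<N. p i \<noteq> 0" "(\<Sum>i<N. ev (p i) x * y ^ i) = 0"
    using algebraic_relation[OF assms] by blast
  define m where "m = Max {i. i < N \<and> p i \<noteq> 0}"
  have "m \<in> {i. i < N \<and> p i \<noteq> 0}" unfolding m_def using p(1) by (intro Max_in) auto
  then have m: "m < N" "p m \<noteq> 0" by auto
  have above: "p i = 0" if "i < N" "m < i" for i
    using that Max_ge[of "{i. i < N \<and> p i \<noteq> 0}" i] by (fastforce simp: m_def)
  show ?thesis
  proof (intro exI[of _ "p m"] conjI allI impI m)
    fix v assume v: "valuation_on F v" and x0: "vge v x 0"
    show "vge v (ev (p m) x * y) 0"
    proof (rule ccontr)
      assume neg: "\<not> vge v (ev (p m) x * y) 0"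
      have nz: "ev (p m) x \<noteq> 0" "y \<noteq> 0" using neg by (auto simp: vge_def)
      have sum_neg: "v (ev (p m) x) + v y < 0"
        using neg val_mult[OF v, of "ev (p m) x" y] ev_mem[of x "p m"] assms nz by (auto simp: vge_def)
      have pos: "vge v (ev (p i) x) 0" for i using vge_ev[OF v assms(1) x0] .
      have vm: "v (ev (p m) x * y ^ m) = v (ev (p m) x) + int m * v y"
        using assms nz by (subst val_mult[OF v]) (auto simp: val_power[OF v])
      have "(\<Sum>i<N. ev (p i) x * y ^ i) \<noteq> 0"
      proof (rule val_sum_dominant[OF v])
        fix i assume i: "i \<in> {..<N}" "i \<noteq> m"
        show "vge v (ev (p i) x * y ^ i) (v (ev (p m) x * y ^ m) + 1)"
        proof (cases "p i = 0")
          case False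
          with i above have "i < m" by force
          then obtain k where k: "m = i + Suc k" using less_iff_Suc_add by (metis add_Suc_right)
          have "vge v (ev (p i) x * y ^ i) (0 + int i * v y)"
            using assms pos[of i] by (intro vge_mult[OF v] vge_power[OF v]) (auto simp: vge_def)
          moreover have "v (ev (p m) x) + int m * v y + 1 \<le> int i * v y"
          proof -
            have "v y < 0" using pos[of m] nz sum_neg by (auto simp: vge_def)
            then have "int k * v y \<le> 0" by (simp add: mult_nonneg_nonpos)
            then show ?thesis using sum_neg unfolding k by (simp add: algebra_simps)
          qed
          ultimately show ?thesis unfolding vm by (auto intro: vge_mono)
        qed auto
      qed (use m nz assms in auto)
      with p(2) show False by simp
    qed
  qed
qed

text \<open>An inclusion of valuation rings makes \<open>v\<close> vanish on the units of
  \<open>u\<close>, so \<open>v\<close> is \<open>v t\<close> times \<open>u\<close> for a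
  uniformizer \<open>t\<close> of \<open>u\<close>. Both are normalized to be surjective, which
  forces the factor 1.\<close>

lemma Vals_eqI:
  assumes u: "u \<in> Vals F" and v: "v \<in> Vals F"
    and le: "\<And>a. a \<in> F \<Longrightarrow> a \<noteq> 0 \<Longrightarrow> 0 \<le> u a \<Longrightarrow> 0 \<le> v a"
  shows "u = v"
proof -
  note U = ValsD(1)[OF u] and V = ValsD(1)[OF v]
  have zero: "v a = 0" if "a \<in> F" "a \<noteq> 0" "u a = 0" for a
    using le[of a] le[of "inverse a"] that val_inverse[OF U, of a] val_inverse[OF V, of a]
    by (simp add: inverse_mem)
  obtain t where t: "t \<in> F" "t \<noteq> 0" "u t = 1" using ValsD(3)[OF u] by blast
  have pow: "v a = u a * v t" if a: "a \<in> F" "a \<noteq> 0" for a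
  proof (cases "0 \<le> u a")
    case True
    then have "u (a / t ^ nat (u a)) = 0"
      using t a by (simp add: val_divide[OF U] val_power[OF U] power_mem)
    from zero[OF _ _ this] show ?thesis
      using t a True by (simp add: val_divide[OF V] val_power[OF V] power_mem divide_mem)
  next
    case False
    then have "u (a * t ^ nat (- u a)) = 0"
      using t a by (simp add: val_mult[OF U] val_power[OF U] power_mem)
    from zero[OF _ _ this] show ?thesis
      using t a False by (simp add: val_mult[OF V] val_power[OF V] power_mem mult_mem)
  qed
  obtain s where s: "s \<in> F" "s \<noteq> 0" "v s = 1" using ValsD(3)[OF v] by blast
  have "0 \<le> v t" using le[of t] t by simp
  moreover have "u s * v t = 1" using pow[of s] s by simp
  ultimately have "v t = 1" using zmult_eq_1_iff[of "u s" "v t"] by auto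
  then have "u a = v a" if "a \<in> F - {0}" for a using pow[of a] that by simp
  then show ?thesis using ValsD(2)[OF u] ValsD(2)[OF v] by (intro PiE_ext) auto
qed

section \<open>Weak approximation for finitely many valuations\<close>

lemma separate_two:
  assumes u: "u \<in> Vals F" and v: "v \<in> Vals F" and "u \<noteq> v"
  shows "\<exists>a\<in>F. a \<noteq> 0 \<and> u a > 0 \<and> v a < 0"
proof -
  obtain a where a: "a \<in> F" "a \<noteq> 0" "0 \<le> u a" "v a < 0"
    using Vals_eqI[OF u v] assms(3) by (meson not_le)
  obtain b where b: "b \<in> F" "b \<noteq> 0" "0 \<le> v b" "u b < 0"
    using Vals_eqI[OF v u] assms(3) by (metis not_le)
  have "u (a / b) > 0" "v (a / b) < 0"
    using a b by (auto simp: val_divide[OF ValsD(1)[OF u]] val_divide[OF ValsD(1)[OF v]])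
  with a b show ?thesis by (intro bexI[of _ "a / b"]) auto
qed

text \<open>Induction on \<open>T\<close>: if the element \<open>y\<close> found so far has no pole
  at the new \<open>u\<close>, a high power of an element \<open>z\<close> with a zero at
  \<open>v\<close> and a pole at \<open>u\<close> is added to it.\<close>

lemma separate:
  assumes v: "v \<in> Vals F" and "finite T" "T \<subseteq> Vals F - {v}"
  shows "\<exists>a\<in>F. a \<noteq> 0 \<and> v a > 0 \<and> (\<forall>u\<in>T. u a < 0)"
  using assms(2,3)
proof (induction T rule: finite_induct)
  case empty
  obtain t where "t \<in> F" "t \<noteq> 0" "v t = 1" using ValsD(3)[OF v] by blast
  then show ?case by auto
next
  case (insert u T)
  note V = ValsD(1)[OF v]
  have u: "u \<in> Vals F" "u \<noteq> v" using insert.prems by auto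
  note U = ValsD(1)[OF u(1)]
  obtain y where y: "y \<in> F" "y \<noteq> 0" "v y > 0" "\<And>w. w \<in> T \<Longrightarrow> w y < 0" using insert by auto
  show ?case
  proof (cases "u y < 0")
    case True
    with y show ?thesis by auto
  next
    case False
    obtain z where z: "z \<in> F" "z \<noteq> 0" "v z > 0" "u z < 0" using separate_two[OF v u(1)] u(2) by blast
    \<comment> \<open>\<open>r\<close> is positive and exceeds every \<open>- w y\<close>. Where
      \<open>z\<close> has a pole in \<open>T\<close>, the pole of \<open>z ^ r\<close> is thus
      strictly deeper than that of \<open>y\<close>, and no cancellation can remove it.\<close>
    define r where "r = Suc (\<Sum>w\<in>T. nat (- w y))"
    have zr: "z ^ r \<in> F" "z ^ r \<noteq> 0" using z by auto
    have r0: "0 < r" unfolding r_def by (rule zero_less_Suc)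
    have "u (z ^ r) < 0" using z r0 val_power[OF U, of z r] by (simp add: mult_pos_neg)
    with False have "vge u y (u (z ^ r) + 1)" by (simp add: vge_def)
    from val_add_eq[OF U zr(1) y(1) zr(2) this]
    have 1: "z ^ r + y \<noteq> 0" "u (z ^ r + y) < 0" using \<open>u (z ^ r) < 0\<close> by auto
    have "v (z ^ r) > 0" using z r0 val_power[OF V, of z r] by simp
    with val_add[OF V zr(1) y(1) zr(2) y(2) 1(1)] y have 2: "v (z ^ r + y) > 0" by linarith
    have 3: "w (z ^ r + y) < 0" if w: "w \<in> T" for w
    proof -
      have W: "valuation_on F w" using w insert.prems ValsD(1) by blast
      have wy: "w y < 0" using y(4)[OF w] .
      have vr: "w (z ^ r) = int r * w z" using z by (simp add: val_power[OF W])
      show ?thesis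
      proof (cases "w z < 0")
        case True
        have "nat (- w y) \<le> (\<Sum>w\<in>T. nat (- w y))" using w insert.hyps by (intro member_le_sum) auto
        then have "nat (- w y) < r" unfolding r_def by linarith
        then have "- w y < int r" by linarith
        moreover have "int r * w z \<le> int r * (-1)" using True by (intro mult_left_mono) auto
        ultimately have lt: "w (z ^ r) < w y" unfolding vr by linarith
        then have "vge w y (w (z ^ r) + 1)" by (simp add: vge_def)
        from val_add_eq[OF W zr(1) y(1) zr(2) this] lt wy show ?thesis by simp
      next
        case False
        then have "0 \<le> w (z ^ r)" unfolding vr by simp
        with wy have "vge w (z ^ r) (w y + 1)" by (simp add: vge_def)
        from val_add_eq[OF W y(1) zr(1) y(2) this] wy show ?thesis by (simp add: add.commute)
      qed
    qed
    show ?thesis using 1 2 3 zr y by (intro bexI[of _ "z ^ r + y"]) auto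
  qed
qed

text \<open>With a zero of \<open>a\<close> at \<open>v\<close> and poles elsewhere in
  \<open>S\<close>, \<open>1 / (a ^ k + 1)\<close> is a unit at \<open>v\<close> and vanishes to
  high order at the others; the factor \<open>t ^ j\<close> then sets the value at
  \<open>v\<close>.\<close>

lemma approximation:
  assumes "finite S" "S \<subseteq> Vals F" "v \<in> S"
  shows "\<exists>y\<in>F. y \<noteq> 0 \<and> v y = int j \<and> (\<forall>u\<in>S. u \<noteq> v \<longrightarrow> int (e u) \<le> u y)"
proof -
  have v: "v \<in> Vals F" using assms by auto
  note V = ValsD(1)[OF v]
  obtain a where a: "a \<in> F" "a \<noteq> 0" "v a > 0" "\<And>u. u \<in> S \<Longrightarrow> u \<noteq> v \<Longrightarrow> u a < 0"
    using separate[OF v, of "S - {v}"] assms by auto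
  obtain t where t: "t \<in> F" "t \<noteq> 0" "v t = 1" using ValsD(3)[OF v] by blast
  \<comment> \<open>Large enough to beat both the prescribed order \<open>e u\<close> and a possible
    pole of \<open>t ^ j\<close> at \<open>u\<close>.\<close>
  define k where "k = Suc (\<Sum>u\<in>S. e u + j * nat \<bar>u t\<bar>)"
  define w where "w = a ^ k + 1"
  have ak: "a ^ k \<in> F" "a ^ k \<noteq> 0" using a by auto
  have k0: "0 < k" unfolding k_def by (rule zero_less_Suc)
  then have vak: "v (a ^ k) > 0" using a val_power[OF V, of a k] by simp
  then have "vge v (a ^ k) (v 1 + 1)" by (simp add: vge_def val_1[OF V])
  from val_add_eq[OF V one_mem ak(1) _ this]
  have w: "w \<noteq> 0" "v w = 0" by (auto simp: w_def add.commute val_1[OF V])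
  have wF: "w \<in> F" using ak by (auto simp: w_def)
  have tj: "t ^ j \<in> F" "t ^ j \<noteq> 0" using t by auto
  have y: "v (t ^ j / w) = int j"
    using t w wF tj by (simp add: val_divide[OF V] val_power[OF V])
  have "int (e u) \<le> u (t ^ j / w)" if u: "u \<in> S" "u \<noteq> v" for u
  proof -
    have U: "valuation_on F u" using u assms ValsD(1) by blast
    have uak: "u (a ^ k) = int k * u a" using a by (simp add: val_power[OF U])
    have neg: "int k * u a \<le> int k * (-1)" using a(4)[OF u] by (intro mult_left_mono) auto
    then have "u (a ^ k) < 0" unfolding uak using k0 by linarith
    then have "vge u 1 (u (a ^ k) + 1)" by (simp add: vge_def val_1[OF U])
    from val_add_eq[OF U ak(1) one_mem ak(2) this] have uw: "u w = int k * u a" by (simp add: w_def uak)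
    have "e u + j * nat \<bar>u t\<bar> \<le> (\<Sum>u\<in>S. e u + j * nat \<bar>u t\<bar>)"
      using u assms by (intro member_le_sum) auto
    then have "int (e u + j * nat \<bar>u t\<bar>) \<le> int k" unfolding k_def by linarith
    then have "int (e u) + int j * \<bar>u t\<bar> \<le> int k" by simp
    moreover have "int j * (- \<bar>u t\<bar>) \<le> int j * u t" by (intro mult_left_mono) auto
    ultimately have "int (e u) \<le> int j * u t - int k * u a" using neg by (simp add: algebra_simps)
    then show ?thesis using t w wF tj by (simp add: val_divide[OF U] val_power[OF U] uw)
  qed
  with y w wF tj show ?thesis by (intro bexI[of _ "t ^ j / w"]) auto
qed

text \<open>Among the terms whose coefficient has minimal \<open>d\<close>, one with minimal \<open>j\<close> dominates the sum at
  its own valuation.\<close>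

lemma ramification_family:
  assumes S: "finite S" "S \<subseteq> Vals F"
  shows "\<exists>y. (\<forall>v\<in>S. \<forall>j. y (v, j) \<in> F) \<and>
    (\<forall>c d. (\<forall>i\<in>Sigma S (\<lambda>v. {..<e v}). c i \<in> F) \<longrightarrow>
       (\<forall>i\<in>Sigma S (\<lambda>v. {..<e v}). c i \<noteq> 0 \<longrightarrow> (\<forall>v\<in>S. v (c i) = int (e v) * d i)) \<longrightarrow>
       (\<Sum>i\<in>Sigma S (\<lambda>v. {..<e v}). c i * y i) = 0 \<longrightarrow>
       (\<forall>i\<in>Sigma S (\<lambda>v. {..<e v}). c i = 0))"
proof -
  have "\<forall>i. \<exists>y. fst i \<in> S \<longrightarrow> y \<in> F \<and> y \<noteq> 0 \<and> fst i y = int (snd i) \<and>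
      (\<forall>u\<in>S. u \<noteq> fst i \<longrightarrow> int (e u) \<le> u y)"
    using approximation[OF S] by blast
  then obtain y where y: "\<And>i. fst i \<in> S \<Longrightarrow> y i \<in> F \<and> y i \<noteq> 0 \<and> fst i (y i) = int (snd i) \<and>
      (\<forall>u\<in>S. u \<noteq> fst i \<longrightarrow> int (e u) \<le> u (y i))" by metis
  let ?I = "Sigma S (\<lambda>v. {..<e v})"
  show ?thesis
  proof (intro exI[of _ y] conjI allI impI)
    \<comment> \<open>The coefficients enter only through \<open>d\<close>. In the applications it
      is minus the degree for coefficients in C[x], and the value under \<open>v'\<close> for
      coefficients in \<open>F'\<close>.\<close>
    fix c d
    assume c': "\<forall>i\<in>?I. c i \<in> F"
      and d': "\<forall>i\<in>?I. c i \<noteq> 0 \<longrightarrow> (\<forall>v\<in>S. v (c i) = int (e v) * d i)"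
      and sum0: "(\<Sum>i\<in>?I. c i * y i) = 0"
    have c: "c i \<in> F" if "i \<in> ?I" for i using c' that by blast
    have d: "v (c i) = int (e v) * d i" if "i \<in> ?I" "c i \<noteq> 0" "v \<in> S" for i v
      using d' that by blast
    show "\<forall>i\<in>?I. c i = 0"
    proof (rule ccontr)
      assume neg: "\<not> (\<forall>i\<in>?I. c i = 0)"
      define J where "J = {i\<in>?I. c i \<noteq> 0}"
      have J: "finite J" "J \<noteq> {}" using neg S by (auto simp: J_def)
      define m where "m = Min (d ` J)"
      define J' where "J' = {i\<in>J. d i = m}"
      have "m \<in> d ` J" unfolding m_def using J by (intro Min_in) auto
      then have J': "finite J'" "J' \<noteq> {}" using J by (auto simp: J'_def)
      define j where "j = Min (snd ` J')"
      have "j \<in> snd ` J'" unfolding j_def using J' by (intro Min_in) auto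
      then obtain v where vj: "(v, j) \<in> J'" by auto
      then have vS: "v \<in> S" "j < e v" "c (v, j) \<noteq> 0" "d (v, j) = m" "(v, j) \<in> ?I"
        by (auto simp: J'_def J_def)
      have V: "valuation_on F v" using vS S ValsD(1) by blast
      have val: "v (c i * y i) = int (e v) * d i + v (y i)" "c i * y i \<noteq> 0" if "i \<in> J" for i
        using that d[of i v] y[of i] c[of i] vS by (auto simp: J_def val_mult[OF V])
      have v0: "v (c (v, j) * y (v, j)) = int (e v) * m + int j"
        using val[of "(v, j)"] vj vS y[of "(v, j)"] by (auto simp: J'_def)
      have "(\<Sum>i\<in>?I. c i * y i) \<noteq> 0"
      proof (rule val_sum_dominant[OF V])
        fix i assume i: "i \<in> ?I" "i \<noteq> (v, j)"
        show "vge v (c i * y i) (v (c (v, j) * y (v, j)) + 1)"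
        proof (cases "c i = 0")
          case False
          then have iJ: "i \<in> J" using i by (simp add: J_def)
          have dm: "m \<le> d i" unfolding m_def using J iJ by auto
          \<comment> \<open>At the same valuation, a larger \<open>d\<close> costs a full step
            \<open>e v\<close>, which exceeds \<open>j\<close>, and an equal \<open>d\<close> leaves
            a larger exponent. A \<open>y i\<close> that belongs to another valuation has value at
            least \<open>e v\<close> at \<open>v\<close>.\<close>
          have "int (e v) * m + int j + 1 \<le> int (e v) * d i + v (y i)"
          proof (cases "fst i = v")
            case True
            then have vy: "v (y i) = int (snd i)" using y[of i] vS by auto
            show ?thesis
            proof (cases "d i = m")
              case eq: True
              then have "i \<in> J'" using iJ by (simp add: J'_def)
              then have "j \<le> snd i" unfolding j_def using J' by auto
              moreover have "snd i \<noteq> j" using i True by (metis prod.collapse)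
              ultimately show ?thesis using vy eq by simp
            next
              case False
              then have "int (e v) * (m + 1) \<le> int (e v) * d i" using dm by (intro mult_left_mono) auto
              then show ?thesis using vS vy by (simp add: algebra_simps)
            qed
          next
            case False
            then have "int (e v) \<le> v (y i)" using y[of i] i vS by (metis SigmaE fst_conv)
            moreover have "int (e v) * m \<le> int (e v) * d i" using dm by (intro mult_left_mono) auto
            ultimately show ?thesis using vS by linarith
          qed
          then show ?thesis using val[OF iJ] v0 by (simp add: vge_def)
        qed auto
      next
        show "finite ?I" using S by auto
        show "c i * y i \<in> F" if "i \<in> ?I" for i
          using c[OF that] y[of i] that by auto
        show "c (v, j) * y (v, j) \<noteq> 0" using val(2)[of "(v, j)"] vj by (auto simp: J'_def)
      qed (fact vS)
      with sum0 show False by simp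
    qed
  next
    show "\<forall>v\<in>S. \<forall>j. y (v, j) \<in> F" using y by simp
  qed
qed

text \<open>Here \<open>- v x\<close> plays the part of a ramification index, that of
  \<open>v\<close> over the place at infinity of C(x). The family has as many members as the degree
  of the part of the polar divisor supported on \<open>S\<close>.\<close>

lemma pole_family:
  assumes x: "x \<in> F" and S: "finite S" "S \<subseteq> {v \<in> Vals F. x \<noteq> 0 \<and> v x < 0}"
  shows "\<exists>y. (\<forall>i\<in>Sigma S (\<lambda>v. {..<nat (- v x)}). y i \<in> F) \<and>
    (\<forall>p. (\<Sum>i\<in>Sigma S (\<lambda>v. {..<nat (- v x)}). ev (p i) x * y i) = 0 \<longrightarrow>
       (\<forall>i\<in>Sigma S (\<lambda>v. {..<nat (- v x)}). p i = 0))"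
proof -
  let ?I = "Sigma S (\<lambda>v. {..<nat (- v x)})"
  have S': "S \<subseteq> Vals F" using S by auto
  obtain y where y: "\<forall>v\<in>S. \<forall>j. y (v, j) \<in> F"
    and ind: "\<forall>c d. (\<forall>i\<in>?I. c i \<in> F) \<longrightarrow>
       (\<forall>i\<in>?I. c i \<noteq> 0 \<longrightarrow> (\<forall>v\<in>S. v (c i) = int (nat (- v x)) * d i)) \<longrightarrow>
       (\<Sum>i\<in>?I. c i * y i) = 0 \<longrightarrow> (\<forall>i\<in>?I. c i = 0)"
    using ramification_family[OF S(1) S', of "\<lambda>v. nat (- v x)"] by (elim exE conjE) (rule that)
  show ?thesis
  proof (intro exI[of _ y] conjI allI impI)
    fix p assume sum0: "(\<Sum>i\<in>?I. ev (p i) x * y i) = 0"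
    have "\<forall>i\<in>?I. ev (p i) x = 0"
    proof -
      have "v (ev (p i) x) = int (nat (- v x)) * - int (Polynomial.degree (p i))"
        if "ev (p i) x \<noteq> 0" "v \<in> S" for i v
        using that val_ev_pole[OF ValsD(1), of v x "p i"] S x by (cases "p i = 0") auto
      then have 1: "\<forall>i\<in>?I. ev (p i) x \<noteq> 0 \<longrightarrow>
          (\<forall>v\<in>S. v (ev (p i) x) = int (nat (- v x)) * - int (Polynomial.degree (p i)))" by blast
      have 2: "\<forall>i\<in>?I. ev (p i) x \<in> F" using x by auto
      show ?thesis
        by (rule ind[THEN spec, THEN spec, THEN mp, THEN mp, THEN mp, OF 2 1 sum0])
    qed
    moreover have "x \<notin> range \<iota>" if "i \<in> ?I" for i
    proof -
      have "fst i \<in> S" using that by auto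
      then show ?thesis using S valuation_not_iota[OF ValsD(1), of "fst i" x] by auto
    qed
    ultimately show "\<forall>i\<in>?I. p i = 0" using ev_nonzero by blast
  qed (use y in auto)
qed

text \<open>Every pole contributes at least one member to a family independent over C[x], and the
  rank over C[x] is bounded.\<close>

lemma finite_poles:
  assumes "x \<in> F" "x \<notin> range \<iota>"
  shows "finite {v \<in> Vals F. v x < 0}"
proof (rule ccontr)
  have x0: "x \<noteq> 0" using assms by (metis iota_0 rangeI)
  obtain N where N: "\<forall>(I::(('k \<Rightarrow> int) \<times> nat) set) w. finite I \<longrightarrow> N \<le> card I \<longrightarrow> w ` I \<subseteq> F \<longrightarrow>
    (\<exists>p. (\<exists>i\<in>I. p i \<noteq> 0) \<and> (\<Sum>i\<in>I. ev (p i) x * w i) = 0)"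
    using dependent_family[OF assms] by (elim exE) (rule that)
  assume inf: "infinite {v \<in> Vals F. v x < 0}"
  obtain S where S: "S \<subseteq> {v \<in> Vals F. v x < 0}" "finite S" "card S = N"
    using infinite_arbitrarily_large[OF inf, of N] by (elim exE conjE) (rule that)
  let ?I = "Sigma S (\<lambda>v. {..<nat (- v x)})"
  have S': "S \<subseteq> {v \<in> Vals F. x \<noteq> 0 \<and> v x < 0}" using S(1) x0 by auto
  obtain y where y: "\<forall>i\<in>?I. y i \<in> F"
    "\<forall>p. (\<Sum>i\<in>?I. ev (p i) x * y i) = 0 \<longrightarrow> (\<forall>i\<in>?I. p i = 0)"
    using pole_family[OF assms(1) S(2) S'] by (elim exE conjE) (rule that)
  have "card S = (\<Sum>v\<in>S. 1)" by simp
  also have "\<dots> \<le> (\<Sum>v\<in>S. nat (- v x))" using S by (intro sum_mono) auto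
  also have "\<dots> = card ?I" using S by simp
  finally have "N \<le> card ?I" using S by simp
  moreover have "finite ?I" "y ` ?I \<subseteq> F" using S y by auto
  ultimately have "\<exists>p. (\<exists>i\<in>?I. p i \<noteq> 0) \<and> (\<Sum>i\<in>?I. ev (p i) x * y i) = 0"
    using N[THEN spec, of ?I, THEN spec, of y] by simp
  then obtain p where "\<exists>i\<in>?I. p i \<noteq> 0" "(\<Sum>i\<in>?I. ev (p i) x * y i) = 0" by (elim exE conjE)
  with y(2) show False by blast
qed

end

section \<open>Existence of places\<close>

context curve_field
begin

definition intermediate_ring :: "'k set \<Rightarrow> bool" where
  "intermediate_ring R \<longleftrightarrow> R \<subseteq> F \<and> range \<iota> \<subseteq> R \<and>
     (\<forall>a\<in>R. \<forall>b\<in>R. a + b \<in> R) \<and> (\<forall>a\<in>R. \<forall>b\<in>R. a * b \<in> R)"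

context
  fixes R assumes R: "intermediate_ring R"
begin

lemma ring_sub: "a \<in> R \<Longrightarrow> a \<in> F"
  and ring_iota: "\<iota> c \<in> R"
  and ring_add: "a \<in> R \<Longrightarrow> b \<in> R \<Longrightarrow> a + b \<in> R"
  and ring_mult: "a \<in> R \<Longrightarrow> b \<in> R \<Longrightarrow> a * b \<in> R"
  using R by (auto simp: intermediate_ring_def)

lemma ring_0: "0 \<in> R" and ring_1: "1 \<in> R"
  using ring_iota[of 0] ring_iota[of 1] by auto

lemma ring_uminus: "a \<in> R \<Longrightarrow> - a \<in> R"
  using ring_mult[OF ring_iota[of "-1"], of a] by (simp add: iota_minus)

lemma ring_diff: "a \<in> R \<Longrightarrow> b \<in> R \<Longrightarrow> a - b \<in> R"
  using ring_add[of a "-b"] ring_uminus by simp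

lemma ring_power: "a \<in> R \<Longrightarrow> a ^ n \<in> R"
  by (induction n) (auto intro: ring_1 ring_mult)

lemma ring_sum: "(\<And>i. i \<in> I \<Longrightarrow> f i \<in> R) \<Longrightarrow> sum f I \<in> R"
  by (induction I rule: infinite_finite_induct) (auto intro: ring_0 ring_add)

lemma ring_ev: "x \<in> R \<Longrightarrow> ev p x \<in> R"
  by (induction p) (auto intro: ring_0 ring_add ring_mult ring_iota)

lemma ring_adjoin:
  assumes "a \<in> F"
  shows "intermediate_ring {poly q a |q. \<forall>i. Polynomial.coeff q i \<in> R}"
    and "R \<subseteq> {poly q a |q. \<forall>i. Polynomial.coeff q i \<in> R}"
    and "a \<in> {poly q a |q. \<forall>i. Polynomial.coeff q i \<in> R}"
proof -
  let ?A = "{poly q a |q. \<forall>i. Polynomial.coeff q i \<in> R}"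
  show incl: "R \<subseteq> ?A"
  proof
    fix r assume "r \<in> R"
    then have "r = poly [:r:] a \<and> (\<forall>i. Polynomial.coeff [:r:] i \<in> R)"
      by (auto simp: coeff_pCons ring_0 split: nat.split)
    then show "r \<in> ?A" by blast
  qed
  have "a = poly [:0, 1:] a \<and> (\<forall>i. Polynomial.coeff [:0, 1:] i \<in> R)"
    by (auto simp: coeff_pCons ring_0 ring_1 split: nat.split)
  then show "a \<in> ?A" by blast
  have sub: "?A \<subseteq> F" using assms ring_sub by (auto simp: poly_altdef)
  have add: "x + y \<in> ?A" if xy: "x \<in> ?A" "y \<in> ?A" for x y
  proof -
    obtain p q where "x = poly p a" "\<forall>i. Polynomial.coeff p i \<in> R"
      "y = poly q a" "\<forall>i. Polynomial.coeff q i \<in> R" using xy by blast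
    then have "x + y = poly (p + q) a \<and> (\<forall>i. Polynomial.coeff (p + q) i \<in> R)"
      by (auto intro: ring_add)
    then show ?thesis by blast
  qed
  have mult: "x * y \<in> ?A" if xy: "x \<in> ?A" "y \<in> ?A" for x y
  proof -
    obtain p q where "x = poly p a" "\<forall>i. Polynomial.coeff p i \<in> R"
      "y = poly q a" "\<forall>i. Polynomial.coeff q i \<in> R" using xy by blast
    then have "x * y = poly (p * q) a \<and> (\<forall>i. Polynomial.coeff (p * q) i \<in> R)"
      by (auto simp: coeff_mult intro: ring_sum ring_mult)
    then show ?thesis by blast
  qed
  have "range \<iota> \<subseteq> ?A" using incl ring_iota by blast
  with sub add mult show "intermediate_ring ?A" unfolding intermediate_ring_def by blast
qed

end

text \<open>One step of the classical proof that a maximal ring is a valuation ring: eliminate the leading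
  term of a relation for \<open>a\<close> by means of a relation of smaller degree for \<open>1 / a\<close>.\<close>

lemma reduce_degree:
  assumes R: "intermediate_ring R" and z: "z \<in> R" "z * y = 1"
    and inv: "\<forall>s\<in>R. inverse (1 - z * s) \<in> R \<and> 1 - z * s \<noteq> 0"
    and a: "a \<noteq> 0"
    and q: "y = poly q a" "\<forall>i. Polynomial.coeff q i \<in> R"
    and s: "y = poly s (inverse a)" "\<forall>i. Polynomial.coeff s i \<in> R"
    and deg: "0 < Polynomial.degree s" "Polynomial.degree s \<le> Polynomial.degree q"
  shows "\<exists>q'. Polynomial.degree q' < Polynomial.degree q \<and> y = poly q' a \<and>
    (\<forall>i. Polynomial.coeff q' i \<in> R)"
proof -
  let ?n = "Polynomial.degree q" and ?m = "Polynomial.degree s"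
  define s0 where "s0 = Polynomial.coeff s 0"
  \<comment> \<open>With n the degree of \<open>q\<close>, multiplying the relation for
    \<open>inverse a\<close> by \<open>z * a ^ n\<close> and using \<open>z * y = 1\<close> gives
    \<open>a ^ n * (1 - z * s0) = z * poly t a\<close>. As \<open>1 - z * s0\<close> is a unit of
    \<open>R\<close>, the top power of \<open>a\<close> becomes a combination of lower ones.\<close>
  define u where "u = inverse (1 - z * s0)"
  have u: "u \<in> R" "u * (1 - z * s0) = 1" using inv s(2) by (auto simp: u_def s0_def)
  define t where "t = (\<Sum>j<?m. Polynomial.monom (Polynomial.coeff s (Suc j)) (?n - Suc j))"
  define q0 where "q0 = (\<Sum>i<?n. Polynomial.monom (Polynomial.coeff q i) i)"
  define q' where "q' = q0 + Polynomial.smult (Polynomial.coeff q ?n * u * z) t"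
  have t_deg: "Polynomial.degree t \<le> ?n - 1" unfolding t_def
    by (rule degree_sum_le) (auto intro!: order.trans[OF degree_monom_le])
  have q0_deg: "Polynomial.degree q0 \<le> ?n - 1" unfolding q0_def
    by (rule degree_sum_le) (auto intro!: order.trans[OF degree_monom_le])
  have "Polynomial.degree q' \<le> ?n - 1" unfolding q'_def using t_deg q0_deg
    by (intro degree_add_le) (auto intro: order.trans[OF degree_smult_le])
  then have 1: "Polynomial.degree q' < ?n" using deg by linarith
  have tc: "Polynomial.coeff t i \<in> R" for i unfolding t_def coeff_sum
    by (rule ring_sum[OF R]) (auto simp: s ring_0[OF R])
  have q0c: "Polynomial.coeff q0 i \<in> R" for i unfolding q0_def coeff_sum
    by (rule ring_sum[OF R]) (auto simp: q ring_0[OF R])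
  have 2: "\<forall>i. Polynomial.coeff q' i \<in> R"
    unfolding q'_def coeff_add coeff_smult using tc q0c u z q(2)
    by (auto intro!: ring_add[OF R] ring_mult[OF R])
  have "y = s0 + (\<Sum>j<?m. Polynomial.coeff s (Suc j) * inverse a ^ Suc j)"
    unfolding s(1) poly_altdef s0_def by (simp add: sum.atMost_shift)
  then have "a ^ ?n * (y - s0) = (\<Sum>j<?m. a ^ ?n * (Polynomial.coeff s (Suc j) * inverse a ^ Suc j))"
    by (simp add: sum_distrib_left)
  also have "\<dots> = (\<Sum>j<?m. Polynomial.coeff s (Suc j) * a ^ (?n - Suc j))"
  proof (rule sum.cong)
    fix j assume "j \<in> {..<?m}"
    then have "?n = (?n - Suc j) + Suc j" using deg by simp
    then have "a ^ ?n = a ^ (?n - Suc j) * a ^ Suc j" by (metis power_add)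
    moreover have "a ^ Suc j * inverse a ^ Suc j = 1"
      using a by (simp del: power_Suc flip: power_mult_distrib)
    ultimately show "a ^ ?n * (Polynomial.coeff s (Suc j) * inverse a ^ Suc j)
        = Polynomial.coeff s (Suc j) * a ^ (?n - Suc j)"
      by (simp only: mult.assoc mult.left_commute mult_1_right)
  qed simp
  also have "\<dots> = poly t a" by (simp add: t_def poly_sum poly_monom)
  finally have "z * poly t a = a ^ ?n * (1 - z * s0)"
    using z(2) by (metis mult.left_commute right_diff_distrib)
  then have "u * z * poly t a = a ^ ?n * (u * (1 - z * s0))" by (simp add: ac_simps)
  then have "u * z * poly t a = a ^ ?n" using u by simp
  then have "poly q' a = (\<Sum>i<?n. Polynomial.coeff q i * a ^ i) + Polynomial.coeff q ?n * a ^ ?n"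
    by (simp add: q'_def q0_def poly_sum poly_monom mult.assoc)
  also have "\<dots> = y" unfolding q(1) by (simp add: poly_altdef lessThan_Suc_atMost[symmetric])
  finally show ?thesis using 1 2 by blast
qed

text \<open>Infinite descent on the sum of the degrees: the relation of larger degree can be reduced
  by the other, and neither reaches degree 0 because \<open>y\<close> is not in \<open>R\<close>.
  Inverting \<open>a\<close> exchanges the two roles.\<close>

lemma no_two_relations:
  assumes R: "intermediate_ring R" and z: "z \<in> R" "z * y = 1" and y: "y \<notin> R"
    and inv: "\<forall>s\<in>R. inverse (1 - z * s) \<in> R \<and> 1 - z * s \<noteq> 0"
    and a: "a \<noteq> 0"
    and q: "y = poly q a" "\<forall>i. Polynomial.coeff q i \<in> R"
    and s: "y = poly s (inverse a)" "\<forall>i. Polynomial.coeff s i \<in> R"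
  shows False
  using q s
proof (induction "Polynomial.degree q + Polynomial.degree s" arbitrary: q s rule: less_induct)
  case less
  have pos: "0 < Polynomial.degree p" if "y = poly p b" "\<forall>i. Polynomial.coeff p i \<in> R" for p b
  proof (rule ccontr)
    assume "\<not> ?thesis"
    then obtain c where "p = [:c:]" by (metis degree_eq_zeroE gr0I)
    with that y show False by (metis coeff_pCons_0 poly_pCons poly_0 mult_zero_right add.right_neutral)
  qed
  show False
  proof (cases "Polynomial.degree s \<le> Polynomial.degree q")
    case True
    obtain q' where "Polynomial.degree q' < Polynomial.degree q" "y = poly q' a"
      "\<forall>i. Polynomial.coeff q' i \<in> R"
      using reduce_degree[OF R z inv a less.prems pos True] less.prems by blast
    with less show False by (meson add_less_mono1)
  next
    case False
    have a': "inverse a \<noteq> 0" using a by simp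
    have q': "y = poly q (inverse (inverse a))" using less.prems by simp
    have le: "Polynomial.degree q \<le> Polynomial.degree s" using False by simp
    obtain s' where "Polynomial.degree s' < Polynomial.degree s" "y = poly s' (inverse a)"
      "\<forall>i. Polynomial.coeff s' i \<in> R"
      using reduce_degree[OF R z inv a' less.prems(3,4) q' less.prems(2) pos le] less.prems by blast
    with less.hyps[of q s'] less.prems show False by simp
  qed
qed

text \<open>Chevalley's argument with a ring maximal among those that contain
  \<open>z = 1 / y\<close> and omit \<open>y\<close>. If neither \<open>a\<close> nor
  \<open>1 / a\<close> belonged to it, both adjunctions would produce \<open>y\<close>, which
  \<open>no_two_relations\<close> forbids.\<close>

lemma valuation_ring_exists:
  assumes y: "y \<in> F" "y \<notin> range \<iota>"
  shows "\<exists>R. intermediate_ring R \<and> y \<notin> R \<and> inverse y \<in> R \<and>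
    (\<forall>a\<in>F. a \<noteq> 0 \<longrightarrow> a \<in> R \<or> inverse a \<in> R)"
proof -
  define z where "z = inverse y"
  have y0: "y \<noteq> 0" using y by (metis iota_0 rangeI)
  then have zy: "z * y = 1" by (simp add: z_def)
  have z: "z \<in> F" using y by (auto simp: z_def)
  have znr: "z \<notin> range \<iota>"
  proof
    assume "z \<in> range \<iota>"
    then obtain c where "z = \<iota> c" by blast
    then have "y = \<iota> (inverse c)" using iota_inverse[of c] by (simp add: z_def) (metis inverse_inverse_eq)
    with y show False by blast
  qed
  define A where "A = {R. intermediate_ring R \<and> z \<in> R \<and> y \<notin> R}"
  have "range (\<lambda>p. ev p z) \<in> A"
  proof -
    have "intermediate_ring (range (\<lambda>p. ev p z))"
      unfolding intermediate_ring_def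
    proof (intro conjI ballI)
      show "range (\<lambda>p. ev p z) \<subseteq> F" using z by auto
      show "range \<iota> \<subseteq> range (\<lambda>p. ev p z)"
      proof
        fix x assume "x \<in> range \<iota>"
        then obtain c where "x = ev [:c:] z" by auto
        then show "x \<in> range (\<lambda>p. ev p z)" by blast
      qed
      fix a b assume "a \<in> range (\<lambda>p. ev p z)" "b \<in> range (\<lambda>p. ev p z)"
      then obtain p q where pq: "a = ev p z" "b = ev q z" by blast
      then have "a + b = ev (p + q) z" "a * b = ev (p * q) z" by (auto simp: ev_add ev_mult)
      then show "a + b \<in> range (\<lambda>p. ev p z)" "a * b \<in> range (\<lambda>p. ev p z)" by blast+
    qed
    moreover have "z = ev [:0, 1:] z" by simp
    then have "z \<in> range (\<lambda>p. ev p z)" by blast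
    moreover have "y \<noteq> ev p z" for p
    proof
      assume "y = ev p z"
      then have "ev (pCons (-1) p) z = 0" using zy by (simp add: iota_minus)
      moreover have "pCons (-1) p \<noteq> 0" by simp
      ultimately show False using ev_nonzero[OF znr] by blast
    qed
    then have "y \<notin> range (\<lambda>p. ev p z)" by blast
    ultimately show ?thesis by (simp add: A_def)
  qed
  then have "A \<noteq> {}" by blast
  have "\<exists>M\<in>A. \<forall>Y\<in>A. M \<subseteq> Y \<longrightarrow> Y = M"
  proof (rule subset_Zorn_nonempty[OF \<open>A \<noteq> {}\<close>])
    fix Ch assume ne: " Ch \<noteq> {}" and ch: "subset.chain A  Ch"
    have CA: "Y \<in> A" if "Y \<in>  Ch" for Y using ch that by (auto simp: subset_chain_def)
    have two: "\<exists>Y\<in> Ch. a \<in> Y \<and> b \<in> Y" if "a \<in> \<Union> Ch" "b \<in> \<Union> Ch" for a b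
      using that ch unfolding subset_chain_def by (metis UnionE subsetD)
    have "intermediate_ring (\<Union> Ch)"
      unfolding intermediate_ring_def
    proof (intro conjI ballI)
      show "\<Union> Ch \<subseteq> F" "range \<iota> \<subseteq> \<Union> Ch"
        using CA ne unfolding A_def intermediate_ring_def by blast+
      fix a b assume "a \<in> \<Union> Ch" "b \<in> \<Union> Ch"
      then obtain Y where "Y \<in>  Ch" "a \<in> Y" "b \<in> Y" using two by blast
      then show "a + b \<in> \<Union> Ch" "a * b \<in> \<Union> Ch"
        using CA[of Y] unfolding A_def intermediate_ring_def by blast+
    qed
    then show "\<Union> Ch \<in> A" using CA ne by (auto simp: A_def)
  qed
  then obtain M where M: "M \<in> A" and max: "\<And>Y. Y \<in> A \<Longrightarrow> M \<subseteq> Y \<Longrightarrow> Y = M" by blast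
  have MR: "intermediate_ring M" and zM: "z \<in> M" and yM: "y \<notin> M" using M by (auto simp: A_def)
  have nz: "1 - z * s \<noteq> 0" if "s \<in> M" for s
  proof
    assume "1 - z * s = 0"
    then have "z * y = z * s" using zy by simp
    then have "y = s" using zy by (metis mult_cancel_left mult_zero_left zero_neq_one)
    with that yM show False by simp
  qed
  \<comment> \<open>The localization of \<open>M\<close> at the elements \<open>1 - z * s\<close>.
    It still omits \<open>y\<close>, because \<open>y * (1 - z * s) = y - s\<close>; by maximality
    these elements are already units of \<open>M\<close>.\<close>
  define L where "L = {r / (1 - z * s) |r s. r \<in> M \<and> s \<in> M}"
  have "M \<subseteq> L"
  proof
    fix r assume "r \<in> M"
    moreover have "r = r / (1 - z * 0)" by simp
    ultimately show "r \<in> L" unfolding L_def using ring_0[OF MR] by blast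
  qed
  have "intermediate_ring L"
    unfolding intermediate_ring_def
  proof (intro conjI ballI)
    show "L \<subseteq> F" using ring_sub[OF MR] z by (auto simp: L_def)
    show "range \<iota> \<subseteq> L" using \<open>M \<subseteq> L\<close> ring_iota[OF MR] by blast
    fix a b assume "a \<in> L" "b \<in> L"
    then obtain r s r' s' where ab: "a = r / (1 - z * s)" "b = r' / (1 - z * s')"
      and m: "r \<in> M" "s \<in> M" "r' \<in> M" "s' \<in> M" by (auto simp: L_def)
    define s'' where "s'' = s + s' - z * s * s'"
    have s'': "s'' \<in> M" unfolding s''_def using m zM
      by (intro ring_diff[OF MR] ring_add[OF MR] ring_mult[OF MR])
    have prod: "(1 - z * s) * (1 - z * s') = 1 - z * s''" by (simp add: s''_def algebra_simps)
    have "a + b = (r * (1 - z * s') + r' * (1 - z * s)) / (1 - z * s'')"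
      using nz m unfolding ab prod[symmetric] by (simp add: add_frac_eq)
    moreover have "r * (1 - z * s') + r' * (1 - z * s) \<in> M" using m zM ring_1[OF MR]
      by (intro ring_diff[OF MR] ring_add[OF MR] ring_mult[OF MR])
    ultimately show "a + b \<in> L" using s'' unfolding L_def by blast
    have "a * b = r * r' / (1 - z * s'')" unfolding ab prod[symmetric] by simp
    moreover have "r * r' \<in> M" using m by (intro ring_mult[OF MR])
    ultimately show "a * b \<in> L" using s'' unfolding L_def by blast
  qed
  moreover have "y \<notin> L"
  proof
    assume "y \<in> L"
    then obtain r s where rs: "y = r / (1 - z * s)" "r \<in> M" "s \<in> M" by (auto simp: L_def)
    then have "y * (1 - z * s) = r" using nz by (simp add: field_simps)
    then have "y = r + (z * y) * s" by (simp add: algebra_simps)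
    then have "y = r + s" by (simp only: zy mult_1_left)
    moreover have "r + s \<in> M" using rs(2,3) by (rule ring_add[OF MR])
    ultimately show False using yM by metis
  qed
  moreover have "z \<in> L" using \<open>M \<subseteq> L\<close> zM by blast
  ultimately have "L \<in> A" unfolding A_def by blast
  then have "L = M" using max \<open>M \<subseteq> L\<close> by blast
  have inv: "\<forall>s\<in>M. inverse (1 - z * s) \<in> M \<and> 1 - z * s \<noteq> 0"
  proof
    fix s assume that: "s \<in> M"
    have "inverse (1 - z * s) = 1 / (1 - z * s)" by (simp add: divide_inverse)
    then have "inverse (1 - z * s) \<in> L" using that ring_1[OF MR] unfolding L_def by blast
    with \<open>L = M\<close> nz[OF that] show "inverse (1 - z * s) \<in> M \<and> 1 - z * s \<noteq> 0" by simp
  qed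
  have "a \<in> M \<or> inverse a \<in> M" if a: "a \<in> F" "a \<noteq> 0" for a
  proof (rule ccontr)
    assume neg: "\<not> ?thesis"
    have adj: "\<exists>q. y = poly q b \<and> (\<forall>i. Polynomial.coeff q i \<in> M)" if b: "b \<in> F" "b \<notin> M" for b
    proof -
      let ?A = "{poly q b |q. \<forall>i. Polynomial.coeff q i \<in> M}"
      \<comment> \<open>Adjoining \<open>b\<close> gives a strictly larger ring that contains
        \<open>z\<close>; it can violate the defining conditions of the family only by containing
        \<open>y\<close>.\<close>
      have "?A \<notin> A" using ring_adjoin[OF MR b(1)] b(2) max by blast
      then have "y \<in> ?A" using ring_adjoin[OF MR b(1)] zM by (auto simp: A_def)
      then show ?thesis by blast
    qed
    obtain q where q: "y = poly q a" "\<forall>i. Polynomial.coeff q i \<in> M" using adj[OF a(1)] neg by blast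
    obtain s where s: "y = poly s (inverse a)" "\<forall>i. Polynomial.coeff s i \<in> M"
      using adj[of "inverse a"] a neg by blast
    show False using no_two_relations[OF MR zM zy yM inv a(2) q s] by blast
  qed
  then show ?thesis using MR yM zM by (intro exI[of _ M]) (auto simp: z_def)
qed

text \<open>Elements whose values are pairwise different and smaller than that of \<open>a\<close> are independent over
  \<open>\<complex>[a]\<close>; this bound on their number makes the value group discrete.\<close>

lemma bounded_chain:
  assumes R: "intermediate_ring R" and val: "\<And>a. a \<in> F \<Longrightarrow> a \<noteq> 0 \<Longrightarrow> a \<in> R \<or> inverse a \<in> R"
    and a: "a \<in> R" "a \<noteq> 0" "inverse a \<notin> R"
  shows "\<exists>N. \<forall>f::nat \<Rightarrow> 'k. \<not> ((\<forall>i<N. f i \<in> R \<and> f i \<noteq> 0) \<and>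
    (\<forall>i j. i < j \<longrightarrow> j < N \<longrightarrow> f j / f i \<in> R \<and> f i / f j \<notin> R) \<and>
    (\<forall>i<N. a / f i \<in> R \<and> f i / a \<notin> R))"
proof -
  \<comment> \<open>The maximal ideal of \<open>R\<close>. It is closed under addition because one
    of the two quotients of the summands lies in \<open>R\<close>.\<close>
  define m where "m = {b \<in> R. b = 0 \<or> inverse b \<notin> R}"
  have m0: "0 \<in> m" using ring_0[OF R] by (simp add: m_def)
  have m_add: "b + c \<in> m" if bc: "b \<in> m" "c \<in> m" for b c
  proof -
    have key: "b + c \<in> m" if bc: "b \<in> m" "c \<in> m" and d: "b \<noteq> 0" "c / b \<in> R" for b c
    proof (rule ccontr)
      assume neg: "b + c \<notin> m"
      have "b + c \<in> R" using bc ring_add[OF R] by (auto simp: m_def)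
      with neg have *: "b + c \<noteq> 0" "inverse (b + c) \<in> R" by (auto simp: m_def)
      then have "inverse (b + c) * (1 + c / b) \<in> R"
        using d ring_1[OF R] by (intro ring_mult[OF R] ring_add[OF R])
      moreover have "inverse (b + c) * (1 + c / b) = inverse b" using * d by (simp add: field_simps)
      ultimately show False using bc d by (auto simp: m_def)
    qed
    show ?thesis
    proof (cases "b = 0 \<or> c = 0")
      case False
      then have "c / b \<in> F" "c / b \<noteq> 0" using bc ring_sub[OF R] by (auto simp: m_def)
      from val[OF this] have "c / b \<in> R \<or> b / c \<in> R" by simp
      then show ?thesis using key[OF bc] key[OF bc(2,1)] False by (auto simp: add.commute)
    qed (use bc in auto)
  qed
  have m_mult: "b * c \<in> m" if "b \<in> m" "c \<in> R" for b c
  proof (rule ccontr)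
    assume neg: "b * c \<notin> m"
    then have *: "b * c \<noteq> 0" "inverse (b * c) \<in> R" "b \<noteq> 0"
      using that ring_mult[OF R] by (auto simp: m_def)
    then have "inverse (b * c) * c \<in> R" using that ring_mult[OF R] by blast
    moreover have "inverse (b * c) * c = inverse b" using * by (simp add: field_simps)
    ultimately have "inverse b \<in> R" by metis
    then show False using that * by (auto simp: m_def)
  qed
  have m_sum: "sum g I \<in> m" if "\<And>i. i \<in> I \<Longrightarrow> g i \<in> m" for g and I :: "nat set"
    using that by (induction I rule: infinite_finite_induct) (auto intro: m0 m_add)
  have am: "a \<in> m" using a by (simp add: m_def)
  have "\<iota> c \<notin> m" if "c \<noteq> 0" for c
    using that ring_iota[OF R, of "inverse c"] by (auto simp: m_def iota_inverse)
  then have unit: "\<iota> c + b \<notin> m" if "c \<noteq> 0" "b \<in> m" for b c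
    using that m_add[of "\<iota> c + b" "- b"] m_mult[of b "\<iota> (-1)"] ring_iota[OF R, of "-1"]
    by (auto simp: iota_minus)
  have nr: "a \<notin> range \<iota>"
  proof
    assume "a \<in> range \<iota>"
    then obtain c where "a = \<iota> c" by blast
    with a ring_iota[OF R, of "inverse c"] show False by (simp add: iota_inverse)
  qed
  obtain N where N: "\<forall>w::nat \<Rightarrow> 'k. (\<forall>i<N. w i \<in> F) \<longrightarrow>
      (\<exists>p. (\<exists>i<N. p i \<noteq> 0) \<and> (\<Sum>i<N. ev (p i) a * w i) = 0)"
    using bounded_rank[OF ring_sub[OF R a(1)] nr] by (elim exE) (rule that)
  show ?thesis
  proof (intro exI[of _ N] allI notI, elim conjE)
    fix f :: "nat \<Rightarrow> 'k"
    assume f: "\<forall>i<N. f i \<in> R \<and> f i \<noteq> 0"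
      and chain: "\<forall>i j. i < j \<longrightarrow> j < N \<longrightarrow> f j / f i \<in> R \<and> f i / f j \<notin> R"
      and top: "\<forall>i<N. a / f i \<in> R \<and> f i / a \<notin> R"
    have indep: "\<forall>i<N. p i = 0" if "(\<Sum>i<N. ev (p i) a * f i) = 0" for p
      using that
    \<comment> \<open>If all constant terms vanish, the relation is divided by \<open>a\<close> and
      the degrees drop. Otherwise it is divided by \<open>f k\<close> for the first nonzero constant
      term: this leaves a nonzero constant plus elements of the maximal ideal, since the terms
      before \<open>k\<close> contain the factor \<open>a / f k\<close> and those after it
      \<open>f i / f k\<close>.\<close>
    proof (induction "\<Sum>i<N. Polynomial.degree (p i)" arbitrary: p rule: less_induct)
      case less
      show ?case
      proof (rule ccontr)
        assume neg: "\<not> (\<forall>i<N. p i = 0)"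
        show False
        proof (cases "\<forall>i<N. Polynomial.coeff (p i) 0 = 0")
          case True
          define q where "q i = (if i < N then poly_shift 1 (p i) else 0)" for i
          have pq: "p i = pCons 0 (q i)" if "i < N" for i
            using that True by (intro poly_eqI)
              (auto simp: q_def coeff_poly_shift coeff_pCons split: nat.split)
          have "(\<Sum>i<N. ev (p i) a * f i) = a * (\<Sum>i<N. ev (q i) a * f i)"
            unfolding sum_distrib_left by (intro sum.cong) (auto simp: pq mult.assoc)
          then have sq: "(\<Sum>i<N. ev (q i) a * f i) = 0" using less.prems a by simp
          have le: "Polynomial.degree (q i) \<le> Polynomial.degree (p i)" if "i < N" for i
            using pq[OF that] by (cases "q i = 0") auto
          obtain k where k: "k < N" "p k \<noteq> 0" using neg by blast
          then have "q k \<noteq> 0" using pq[of k] by auto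
          then have "Polynomial.degree (q k) < Polynomial.degree (p k)" using pq[OF k(1)] by simp
          then have "(\<Sum>i<N. Polynomial.degree (q i)) < (\<Sum>i<N. Polynomial.degree (p i))"
            using le k by (intro sum_strict_mono_ex1) auto
          from less.hyps[OF this sq] \<open>q k \<noteq> 0\<close> k show False by blast
        next
          case False
          define k where "k = (LEAST i. i < N \<and> Polynomial.coeff (p i) 0 \<noteq> 0)"
          have k: "k < N" "Polynomial.coeff (p k) 0 \<noteq> 0"
            using LeastI_ex[of "\<lambda>i. i < N \<and> Polynomial.coeff (p i) 0 \<noteq> 0"] False
            unfolding k_def by auto
          have least: "Polynomial.coeff (p i) 0 = 0" if "i < k" for i
            using not_less_Least[of i "\<lambda>i. i < N \<and> Polynomial.coeff (p i) 0 \<noteq> 0"] that k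
            unfolding k_def by auto
          have split: "\<exists>r\<in>R. ev (p i) a = \<iota> (Polynomial.coeff (p i) 0) + a * r" for i
          proof -
            obtain c r where cr: "p i = pCons c r" by (cases "p i")
            show ?thesis using ring_ev[OF R a(1), of r] by (intro bexI[of _ "ev r a"]) (auto simp: cr)
          qed
          have fk: "f k \<noteq> 0" "f k \<in> R" using f k by auto
          have "ev (p i) a * f i / f k \<in> m" if i: "i < N" "i \<noteq> k" for i
          proof (cases "i < k")
            case True
            obtain r where r: "r \<in> R" "ev (p i) a = a * r" using split[of i] least[OF True] by auto
            have "a / f k \<in> m" using top k fk by (auto simp: m_def)
            then have "a / f k * (r * f i) \<in> m" using r f i by (intro m_mult ring_mult[OF R]) auto
            then show ?thesis using r by (simp add: ac_simps)
          next
            case False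
            then have "f i / f k \<in> m" using chain i k f by (auto simp: m_def)
            then have "f i / f k * ev (p i) a \<in> m" using ring_ev[OF R a(1)] by (intro m_mult) auto
            then show ?thesis by (simp add: ac_simps)
          qed
          then have S: "(\<Sum>i\<in>{..<N} - {k}. ev (p i) a * f i / f k) \<in> m" by (intro m_sum) auto
          obtain r where r: "r \<in> R" "ev (p k) a = \<iota> (Polynomial.coeff (p k) 0) + a * r"
            using split[of k] by auto
          have "0 = (\<Sum>i<N. ev (p i) a * f i) / f k" using less.prems by simp
          also have "\<dots> = (\<Sum>i<N. ev (p i) a * f i / f k)" by (simp add: sum_divide_distrib)
          also have "\<dots> = ev (p k) a + (\<Sum>i\<in>{..<N} - {k}. ev (p i) a * f i / f k)"
            using k fk by (subst sum.remove[of _ k]) auto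
          also have "\<dots> = \<iota> (Polynomial.coeff (p k) 0) +
              (a * r + (\<Sum>i\<in>{..<N} - {k}. ev (p i) a * f i / f k))" using r by simp
          also have "\<dots> \<notin> m" using k S r by (intro unit m_add m_mult am) auto
          finally show False using m0 by simp
        qed
      qed
    qed
    have "\<forall>i<N. f i \<in> F" using f ring_sub[OF R] by auto
    then obtain p where "\<exists>i<N. p i \<noteq> 0" "(\<Sum>i<N. ev (p i) a * f i) = 0" using N by blast
    with indep show False by blast
  qed
qed

end

section \<open>Discreteness: from valuation rings to integer-valued valuations\<close>

context curve_field
begin

text \<open>Without an element of least positive value, the values would descend strictly from that
  of \<open>z\<close> forever; a long enough piece contradicts \<open>bounded_chain\<close>.\<close>

lemma uniformizer_exists:
  assumes R: "intermediate_ring R" and val: "\<And>a. a \<in> F \<Longrightarrow> a \<noteq> 0 \<Longrightarrow> a \<in> R \<or> inverse a \<in> R"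
    and z: "z \<in> R" "z \<noteq> 0" "inverse z \<notin> R"
  shows "\<exists>t\<in>R. t \<noteq> 0 \<and> inverse t \<notin> R \<and> (\<forall>b\<in>R. b \<noteq> 0 \<longrightarrow> inverse b \<notin> R \<longrightarrow> b / t \<in> R)"
proof (rule ccontr)
  assume neg: "\<not> ?thesis"
  let ?P = "\<lambda>b. b \<in> R \<and> b \<noteq> 0 \<and> inverse b \<notin> R"
  have "\<exists>g. \<forall>i::nat. (?P (g i) \<and> (i = 0 \<longrightarrow> g i = z)) \<and> g (Suc i) / g i \<notin> R"
  proof (rule dependent_nat_choice[of "\<lambda>n b. ?P b \<and> (n = 0 \<longrightarrow> b = z)" "\<lambda>n x y. y / x \<notin> R"])
    show "\<exists>x. ?P x \<and> (0 = (0::nat) \<longrightarrow> x = z)" using z by auto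
    fix x and n :: nat assume "?P x \<and> (n = 0 \<longrightarrow> x = z)"
    then show "\<exists>y. (?P y \<and> (Suc n = 0 \<longrightarrow> y = z)) \<and> y / x \<notin> R" using neg by blast
  qed
  then obtain g where g: "\<And>i::nat. ?P (g i)" "g 0 = z" "\<And>i. g (Suc i) / g i \<notin> R" by blast
  have lt: "g i / g j \<in> R \<and> g j / g i \<notin> R" if "i < j" for i j
    using that
  proof (induction j)
    case (Suc j)
    have "g (Suc j) / g j \<in> F" "g (Suc j) / g j \<noteq> 0" using g(1) ring_sub[OF R] by (auto intro: divide_mem)
    from val[OF this] g(3)[of j] have s: "g j / g (Suc j) \<in> R" by simp
    show ?case
    proof (cases "i = j")
      case True
      with s g(3) show ?thesis by simp
    next
      case False
      with Suc have ij: "g i / g j \<in> R" "g j / g i \<notin> R" by auto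
      have "(g i / g j) * (g j / g (Suc j)) \<in> R" using ij s ring_mult[OF R] by blast
      then have 1: "g i / g (Suc j) \<in> R" using g(1) by simp
      have "g (Suc j) / g i \<notin> R"
      proof
        assume "g (Suc j) / g i \<in> R"
        then have "(g j / g (Suc j)) * (g (Suc j) / g i) \<in> R" using s ring_mult[OF R] by blast
        then show False using ij g(1) by simp
      qed
      with 1 show ?thesis by blast
    qed
  qed simp
  obtain N where N: "\<forall>f::nat \<Rightarrow> 'k. \<not> ((\<forall>i<N. f i \<in> R \<and> f i \<noteq> 0) \<and>
    (\<forall>i j. i < j \<longrightarrow> j < N \<longrightarrow> f j / f i \<in> R \<and> f i / f j \<notin> R) \<and>
    (\<forall>i<N. z / f i \<in> R \<and> f i / z \<notin> R))"
    using bounded_chain[OF R val z] by blast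
  show False
  \<comment> \<open>Reversal turns the descending sequence into an ascending one. The indices run
    from \<open>N\<close> down to 1, so that \<open>z = g 0\<close> stays strictly on top.\<close>
  proof (rule N[THEN spec, of "\<lambda>i. g (N - i)", THEN notE], intro conjI allI impI)
    fix i assume "i < N"
    then show "z / g (N - i) \<in> R" "g (N - i) / z \<notin> R" using lt[of 0 "N - i"] g(2) by auto
  next
    fix i j assume "i < j" "j < N"
    then show "g (N - j) / g (N - i) \<in> R" "g (N - i) / g (N - j) \<notin> R"
      using lt[of "N - j" "N - i"] by auto
  qed (use g(1) in auto)
qed

text \<open>Every nonzero element is a unit times a power of the uniformizer \<open>t\<close>, and
  the exponent is its value. The content is that dividing by \<open>t\<close> leaves the ring after
  finitely many steps.\<close>

lemma discrete_valuation:
  assumes R: "intermediate_ring R" and val: "\<And>a. a \<in> F \<Longrightarrow> a \<noteq> 0 \<Longrightarrow> a \<in> R \<or> inverse a \<in> R"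
    and z: "z \<in> R" "z \<noteq> 0" "inverse z \<notin> R"
  shows "\<exists>v\<in>Vals F. \<forall>a\<in>F. a \<noteq> 0 \<longrightarrow> (0 \<le> v a \<longleftrightarrow> a \<in> R)"
proof -
  obtain t where t: "t \<in> R" "t \<noteq> 0" "inverse t \<notin> R"
    and min: "\<And>b. b \<in> R \<Longrightarrow> b \<noteq> 0 \<Longrightarrow> inverse b \<notin> R \<Longrightarrow> b / t \<in> R"
    using uniformizer_exists[OF R val z] by blast
  have tF: "t \<in> F" using t ring_sub[OF R] by blast
  have tinv: "inverse (t ^ n) \<notin> R" if n: "0 < n" for n
  proof
    assume "inverse (t ^ n) \<in> R"
    then have "inverse (t ^ n) * t ^ (n - 1) \<in> R" using t ring_mult[OF R] ring_power[OF R] by blast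
    moreover have "inverse (t ^ n) * t ^ (n - 1) = inverse t"
      using n t by (cases n) (auto simp: field_simps)
    ultimately show False using t by simp
  qed
  define U where "U u \<longleftrightarrow> u \<in> R \<and> u \<noteq> 0 \<and> inverse u \<in> R" for u
  have U_mult: "U (a * b)" if "U a" "U b" for a b
    using that ring_mult[OF R] by (auto simp: U_def)
  have U_inv: "U (inverse a)" if "U a" for a using that by (auto simp: U_def)
  have pow: "\<exists>k::nat. U (a / t ^ k)" if a: "a \<in> R" "a \<noteq> 0" for a
  proof (cases "inverse a \<in> R")
    case True
    then have "U (a / t ^ 0)" using a by (simp add: U_def)
    then show ?thesis by blast
  next
    case False
    obtain N where N: "\<forall>f::nat \<Rightarrow> 'k. \<not> ((\<forall>i<N. f i \<in> R \<and> f i \<noteq> 0) \<and>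
      (\<forall>i j. i < j \<longrightarrow> j < N \<longrightarrow> f j / f i \<in> R \<and> f i / f j \<notin> R) \<and>
      (\<forall>i<N. a / f i \<in> R \<and> f i / a \<notin> R))"
      using bounded_chain[OF R val a False] by blast
    \<comment> \<open>Otherwise the powers of \<open>t\<close> with exponents below \<open>N\<close>
      would form a chain below \<open>a\<close> of the length that \<open>bounded_chain\<close>
      excludes.\<close>
    have "\<exists>k\<le>N. a / t ^ k \<notin> R"
    proof (rule ccontr)
      assume "\<not> ?thesis"
      then have all: "a / t ^ k \<in> R" if "k \<le> N" for k using that by blast
      have "t ^ j / t ^ i \<in> R \<and> t ^ i / t ^ j \<notin> R" if ij: "i < j" for i j
      proof -
        have "t ^ j = t ^ i * t ^ (j - i)" using ij by (simp flip: power_add)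
        then have "t ^ j / t ^ i = t ^ (j - i)" "t ^ i / t ^ j = inverse (t ^ (j - i))"
          using t by (auto simp: field_simps)
        then show ?thesis using tinv[of "j - i"] ij t ring_power[OF R] by auto
      qed
      moreover have "t ^ i / a \<notin> R" if i: "i < N" for i
      proof
        assume "t ^ i / a \<in> R"
        then have "(t ^ i / a) * (a / t ^ N) \<in> R" using all ring_mult[OF R] by blast
        moreover have "t ^ N = t ^ i * t ^ (N - i)" using i by (simp flip: power_add)
        then have "(t ^ i / a) * (a / t ^ N) = inverse (t ^ (N - i))"
          using t a by (simp add: field_simps)
        ultimately show False using tinv[of "N - i"] i by simp
      qed
      ultimately show False
        using N[THEN spec, of "\<lambda>i. t ^ i"] all t ring_power[OF R] by auto
    qed
    then obtain k where k: "a / t ^ k \<notin> R" "\<And>i. i < k \<Longrightarrow> a / t ^ i \<in> R"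
      using exists_least_iff[of "\<lambda>k. a / t ^ k \<notin> R"] by blast
    then obtain l where l: "k = Suc l" using a by (cases k) auto
    then have R1: "a / t ^ l \<in> R" using k by simp
    have "inverse (a / t ^ l) \<in> R"
    proof (rule ccontr)
      assume "inverse (a / t ^ l) \<notin> R"
      with R1 have "a / t ^ l / t \<in> R" using a t by (intro min) auto
      with k(1) l show False by (simp add: mult.commute)
    qed
    with R1 have "U (a / t ^ l)" using a t by (simp add: U_def)
    then show ?thesis by blast
  qed
  have ex: "\<exists>k. U (a / t powi k)" if a: "a \<in> F" "a \<noteq> 0" for a
    using val[OF a]
  proof
    assume "a \<in> R"
    with pow[of a] a obtain k :: nat where "U (a / t ^ k)" by blast
    then have "U (a / t powi (int k))" by simp
    then show ?thesis by blast
  next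
    assume "inverse a \<in> R"
    with pow[of "inverse a"] a obtain k :: nat where "U (inverse a / t ^ k)" by auto
    from U_inv[OF this] have "U (a / t powi (- int k))"
      by (simp add: power_int_minus field_simps)
    then show ?thesis by blast
  qed
  have powR: "t powi k \<in> R \<longleftrightarrow> 0 \<le> k" for k
  proof (cases "0 \<le> k")
    case True
    then show ?thesis using t ring_power[OF R] by (simp add: power_int_def)
  next
    case False
    then have "t powi k = inverse (t ^ nat (- k))" by (simp add: power_int_def power_inverse)
    then show ?thesis using tinv[of "nat (- k)"] False by simp
  qed
  define v where "v = restrict (\<lambda>a. THE k. U (a / t powi k)) (F - {0})"
  have v_eq: "v a = k" if a: "a \<in> F" "a \<noteq> 0" and k: "U (a / t powi k)" for a k
  proof -
    have "l = k" if l: "U (a / t powi l)" for l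
    proof -
      have "U ((a / t powi l) * inverse (a / t powi k))" using U_mult[OF l U_inv[OF k]] .
      moreover have "(a / t powi l) * inverse (a / t powi k) = t powi (k - l)"
        using a t by (simp add: power_int_diff field_simps)
      ultimately have "t powi (k - l) \<in> R" "inverse (t powi (k - l)) \<in> R" by (auto simp: U_def)
      then have "t powi (k - l) \<in> R" "t powi (l - k) \<in> R" by (auto simp flip: power_int_minus)
      then show ?thesis by (auto simp: powR)
    qed
    with k have "(THE k. U (a / t powi k)) = k" by (rule the_equality)
    then show ?thesis using a by (simp add: v_def)
  qed
  have vU: "U (a / t powi (v a))" if "a \<in> F" "a \<noteq> 0" for a
    using ex[OF that] v_eq[OF that] by metis
  have nonneg: "0 \<le> v a \<longleftrightarrow> a \<in> R" if a: "a \<in> F" "a \<noteq> 0" for a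
  proof
    assume "0 \<le> v a"
    then have "(a / t powi (v a)) * t powi (v a) \<in> R" using vU[OF a] powR
      by (intro ring_mult[OF R]) (auto simp: U_def)
    then show "a \<in> R" using t(2) by simp
  next
    assume "a \<in> R"
    then have "inverse (a / t powi (v a)) * a \<in> R" using vU[OF a] by (intro ring_mult[OF R]) (auto simp: U_def)
    then have "t powi (v a) \<in> R" using a by simp
    then show "0 \<le> v a" using powR by simp
  qed
  have vmult: "v (a * b) = v a + v b" if ab: "a \<in> F" "a \<noteq> 0" "b \<in> F" "b \<noteq> 0" for a b
  proof (rule v_eq)
    have "U ((a / t powi (v a)) * (b / t powi (v b)))" using U_mult vU ab by blast
    then show "U (a * b / t powi (v a + v b))" using t by (simp add: power_int_add)
  qed (use ab in auto)
  have vinv: "v (inverse a) = - v a" if a: "a \<in> F" "a \<noteq> 0" for a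
  proof (rule v_eq)
    show "U (inverse a / t powi (- v a))" using U_inv[OF vU[OF a]] by (simp add: power_int_minus field_simps)
  qed (use a in auto)
  have vadd: "min (v a) (v b) \<le> v (a + b)"
    if ab: "a \<in> F" "a \<noteq> 0" "b \<in> F" "b \<noteq> 0" "a + b \<noteq> 0" for a b
  proof -
    have key: "v a \<le> v (a + b)"
      if ab: "a \<in> F" "a \<noteq> 0" "b \<in> F" "b \<noteq> 0" "a + b \<noteq> 0" "v a \<le> v b" for a b
    proof -
      have "0 \<le> v (b * inverse a)" using ab by (simp add: vmult vinv inverse_mem)
      then have "b * inverse a \<in> R" using ab by (subst (asm) nonneg) auto
      then have "1 + b * inverse a \<in> R" using ring_add[OF R] ring_1[OF R] by blast
      moreover have "1 + b * inverse a = (a + b) * inverse a" using ab by (simp add: field_simps)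
      ultimately have "0 \<le> v ((a + b) * inverse a)" using ab nonneg[of "(a + b) * inverse a"] by auto
      then show ?thesis using ab by (simp add: vmult vinv inverse_mem add_mem)
    qed
    show ?thesis using key[of a b] key[of b a] ab by (cases "v a \<le> v b") (auto simp: add.commute)
  qed
  have viota: "v (\<iota> c) = 0" if "c \<noteq> 0" for c
  proof (rule v_eq)
    show "U (\<iota> c / t powi 0)"
      using that ring_iota[OF R, of c] ring_iota[OF R, of "inverse c"] by (simp add: U_def iota_inverse)
  qed (use that in auto)
  have vt: "v (t powi k) = k" for k
  proof (rule v_eq)
    show "t powi k \<in> F" using tF by (auto simp: power_int_def)
    show "U (t powi k / t powi k)" using t ring_1[OF R] by (simp add: U_def)
  qed (use t in auto)
  have "valuation_on F v" unfolding valuation_on_def using vmult vadd viota by auto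
  moreover have "v \<in> (F - {0}) \<rightarrow>\<^sub>E UNIV" by (auto simp: v_def)
  moreover have "v ` (F - {0}) = UNIV"
  proof -
    have "t powi k \<in> F - {0}" for k using tF t by (auto simp: power_int_def)
    then have "k \<in> v ` (F - {0})" for k using vt[of k] by (metis imageI)
    then show ?thesis by blast
  qed
  ultimately have "v \<in> Vals F" by (simp add: Vals_def)
  with nonneg show ?thesis by blast
qed

text \<open>The valuation of a ring that omits \<open>y\<close> is negative at \<open>y\<close>.
  Read contrapositively, a function without poles is constant, which starts the dimension
  count.\<close>

theorem pole_exists:
  assumes "y \<in> F" "y \<notin> range \<iota>"
  shows "\<exists>v\<in>Vals F. v y < 0"
proof -
  obtain R where R: "intermediate_ring R" "y \<notin> R" "inverse y \<in> R"
    and val: "\<forall>a\<in>F. a \<noteq> 0 \<longrightarrow> a \<in> R \<or> inverse a \<in> R"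
    using valuation_ring_exists[OF assms] by blast
  have y0: "y \<noteq> 0" using assms by (metis iota_0 rangeI)
  obtain v where "v \<in> Vals F" "\<forall>a\<in>F. a \<noteq> 0 \<longrightarrow> (0 \<le> v a \<longleftrightarrow> a \<in> R)"
    using discrete_valuation[OF R(1) _ R(3)] val R(2) y0 by auto
  with R y0 assms show ?thesis by (intro bexI[of _ v]) (auto simp: not_le[symmetric])
qed

text \<open>Passing from one valuation bound to the next smaller one costs at most one dimension.\<close>

lemma bounded_poles_dependent:
  assumes P: "finite P" "P \<subseteq> Vals F"
    and I: "finite I" "1 + (\<Sum>v\<in>P. D v) < card I"
    and w: "\<And>i. i \<in> I \<Longrightarrow> w i \<in> F"
    and bound: "\<And>i v. i \<in> I \<Longrightarrow> v \<in> P \<Longrightarrow> vge v (w i) (- int (D v))"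
    and out: "\<And>i v. i \<in> I \<Longrightarrow> v \<in> Vals F - P \<Longrightarrow> vge v (w i) 0"
  shows "\<exists>c. (\<exists>i\<in>I. c i \<noteq> 0) \<and> (\<Sum>i\<in>I. \<iota> (c i) * w i) = 0"
  using I w bound out
proof (induction "\<Sum>v\<in>P. D v" arbitrary: D I w)
  case 0
  have D0: "D v = 0" if "v \<in> P" for v using 0(1) P that by simp
  \<comment> \<open>All pole orders are 0, so the functions are constants, and any two constants are
    dependent: this accounts for the summand 1 in the bound.\<close>
  have "w i \<in> range \<iota>" if i: "i \<in> I" for i
  proof (rule ccontr)
    assume nr: "w i \<notin> range \<iota>"
    obtain v where v: "v \<in> Vals F" "v (w i) < 0" using pole_exists[OF 0(4)[OF i] nr] by blast
    then have "vge v (w i) 0" using 0(5)[OF i, of v] 0(6)[OF i, of v] D0[of v] by (cases "v \<in> P") auto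
    moreover have "w i \<noteq> 0" using nr by (metis iota_0 rangeI)
    ultimately show False using v by (simp add: vge_def)
  qed
  then have "\<forall>i\<in>I. \<exists>c. w i = \<iota> c" by blast
  from bchoice[OF this] obtain d where d: "\<And>i. i \<in> I \<Longrightarrow> w i = \<iota> (d i)" by blast
  have "\<not> card I \<le> Suc 0" using 0(3) by simp
  then obtain i j where ij: "i \<in> I" "j \<in> I" "i \<noteq> j"
    using card_le_Suc0_iff_eq[OF 0(2)] by blast
  show ?case
  proof (cases "d i = 0")
    case True
    then have "(\<Sum>k\<in>I. \<iota> (if k = i then 1 else 0) * w k) = 0"
      by (intro sum.neutral) (auto simp: d)
    then show ?thesis using ij by (intro exI[of _ "\<lambda>k. if k = i then 1 else 0"]) auto
  next
    case False
    define c where "c k = (if k = i then - d j else if k = j then d i else 0)" for k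
    have "(\<Sum>k\<in>I. \<iota> (c k) * w k) = (\<Sum>k\<in>{i, j}. \<iota> (c k) * w k)"
      using ij 0(2) by (intro sum.mono_neutral_right) (auto simp: c_def)
    also have "\<dots> = 0" using ij by (simp add: c_def d iota_minus)
    finally show ?thesis using False ij by (intro exI[of _ c]) (auto simp: c_def)
  qed
next
  case (Suc n)
  have "\<not> (\<forall>v\<in>P. D v = 0)" using Suc.hyps(2) by (metis sum.neutral Zero_not_Suc)
  then obtain u where u: "u \<in> P" "D u > 0" by auto
  have uV: "u \<in> Vals F" using u P by auto
  note U = ValsD(1)[OF uV]
  define D' where "D' = D(u := D u - 1)"
  have sumD: "(\<Sum>v\<in>P. D v) = Suc (\<Sum>v\<in>P. D' v)"
  proof -
    have "(\<Sum>v\<in>P. D' v) = (D u - 1) + (\<Sum>v\<in>P - {u}. D v)"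
      using u P by (subst sum.remove[of _ u]) (auto simp: D'_def)
    moreover have "(\<Sum>v\<in>P. D v) = D u + (\<Sum>v\<in>P - {u}. D v)"
      using u P by (subst sum.remove[of _ u]) auto
    ultimately show ?thesis using u by simp
  qed
  have D'n: "n = (\<Sum>v\<in>P. D' v)" using Suc(2) sumD by simp
  show ?case
  proof (cases "\<forall>i\<in>I. vge u (w i) (- int (D' u))")
    case True
    have "1 + (\<Sum>v\<in>P. D' v) < card I" using Suc.prems(2) sumD by simp
    moreover have "vge v (w i) (- int (D' v))" if "i \<in> I" "v \<in> P" for i v
      using True that Suc.prems(4)[of i v] by (cases "v = u") (auto simp: D'_def)
    ultimately show ?thesis by (intro Suc.hyps(1)[OF D'n Suc.prems(1)]) (use Suc.prems in auto)
  next
    case False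
    then obtain k where k: "k \<in> I" "\<not> vge u (w k) (- int (D' u))" by blast
    have wk: "w k \<in> F" "w k \<noteq> 0" using k Suc.prems(3) by (auto simp: vge_def)
    have uk: "u (w k) = - int (D u)" using k u Suc.prems(4)[OF k(1) u(1)] by (auto simp: vge_def D'_def)
    \<comment> \<open>\<open>w k\<close> has a pole of the full order \<open>D u\<close> at
      \<open>u\<close>, so \<open>w i / w k\<close> has a residue \<open>c\<close> there.
      Subtracting \<open>c\<close> times \<open>w k\<close> from \<open>w i\<close> lowers the bound
      on its pole order by one.\<close>
    have "\<exists>c. vge u (w i - \<iota> c * w k) (- int (D' u))" if i: "i \<in> I" for i
    proof -
      have wi: "w i \<in> F" using i Suc.prems(3) by blast
      have inv: "u (inverse (w k)) = int (D u)" using uk wk by (simp add: val_inverse[OF U])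
      have "vge u (w i * inverse (w k)) (- int (D u) + int (D u))"
        using wi wk inv Suc.prems(4)[OF i u(1)] by (intro vge_mult[OF U]) (auto simp: vge_def)
      then have "vge u (w i * inverse (w k)) 0" by simp
      from residue[OF uV _ this] obtain c where c: "vge u (w i * inverse (w k) - \<iota> c) 1"
        using wi wk by auto
      have "vge u ((w i * inverse (w k) - \<iota> c) * w k) (1 + - int (D u))"
        using c wi wk uk by (intro vge_mult[OF U]) (auto simp: vge_def)
      moreover have "(w i * inverse (w k) - \<iota> c) * w k = w i - \<iota> c * w k"
        using wk by (simp add: left_diff_distrib)
      ultimately show ?thesis using u by (auto simp: D'_def intro!: exI[of _ c] elim!: vge_mono)
    qed
    then have "\<forall>i\<in>I. \<exists>c. vge u (w i - \<iota> c * w k) (- int (D' u))" by blast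
    from bchoice[OF this] obtain c
      where c: "\<And>i. i \<in> I \<Longrightarrow> vge u (w i - \<iota> (c i) * w k) (- int (D' u))" by blast
    define w' where "w' i = w i - \<iota> (c i) * w k" for i
    let ?J = "I - {k}"
    have cJ: "1 + (\<Sum>v\<in>P. D' v) < card ?J" using Suc.prems(1,2) sumD k by simp
    have fJ: "finite ?J" using Suc.prems(1) by simp
    have comb: "vge v (w' i) m" if "vge v (w i) m" "vge v (w k) m" "v \<in> Vals F" "i \<in> I" for v i m
    proof -
      note V = ValsD(1)[OF that(3)]
      have "vge v (\<iota> (c i) * w k) (0 + m)" using that wk vge_iota[OF V] by (intro vge_mult[OF V]) auto
      then show ?thesis unfolding w'_def using that wk Suc.prems(3) by (intro vge_diff[OF V]) auto
    qed
    have "\<exists>d. (\<exists>i\<in>?J. d i \<noteq> 0) \<and> (\<Sum>i\<in>?J. \<iota> (d i) * w' i) = 0"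
    proof (rule Suc.hyps(1)[OF D'n fJ cJ])
      show "w' i \<in> F" if "i \<in> ?J" for i using that Suc.prems(3) wk by (auto simp: w'_def)
      show "vge v (w' i) (- int (D' v))" if "i \<in> ?J" "v \<in> P" for i v
        using that c[of i] comb[of v i] Suc.prems(4)[of i v] Suc.prems(4)[OF k(1), of v] P
        by (cases "v = u") (auto simp: D'_def w'_def)
      show "vge v (w' i) 0" if "i \<in> ?J" "v \<in> Vals F - P" for i v
        using that comb[of v i 0] Suc.prems(5)[of i v] Suc.prems(5)[OF k(1), of v] by auto
    qed
    then obtain d where d: "\<exists>i\<in>?J. d i \<noteq> 0" "(\<Sum>i\<in>?J. \<iota> (d i) * w' i) = 0" by blast
    \<comment> \<open>Undoes the substitution: the coefficient of \<open>w k\<close> cancels the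
      corrections made to all other members.\<close>
    define e where "e i = (if i = k then - (\<Sum>i\<in>?J. d i * c i) else d i)" for i
    have iota_sum: "\<iota> (sum f A) = (\<Sum>i\<in>A. \<iota> (f i))" for f and A :: "'a set"
      by (induction A rule: infinite_finite_induct) (auto simp: iota_add)
    have "(\<Sum>i\<in>I. \<iota> (e i) * w i) = \<iota> (e k) * w k + (\<Sum>i\<in>?J. \<iota> (e i) * w i)"
      using Suc.prems(1) k by (simp add: sum.remove)
    also have "(\<Sum>i\<in>?J. \<iota> (e i) * w i) = (\<Sum>i\<in>?J. \<iota> (d i) * w' i + \<iota> (d i * c i) * w k)"
      by (intro sum.cong) (auto simp: e_def w'_def iota_mult algebra_simps)
    also have "\<dots> = \<iota> (\<Sum>i\<in>?J. d i * c i) * w k"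
      using d(2) by (simp add: sum.distrib iota_sum sum_distrib_right)
    also have "\<iota> (e k) * w k + \<dots> = 0" by (simp add: e_def iota_minus)
    finally have "(\<Sum>i\<in>I. \<iota> (e i) * w i) = 0" .
    moreover have "\<exists>i\<in>I. e i \<noteq> 0" using d(1) by (auto simp: e_def)
    ultimately show ?thesis by blast
  qed
qed

end

section \<open>The fundamental identity for extensions\<close>

context curve_field
begin

text \<open>Multiplying the family by the powers \<open>x ^ l\<close> with \<open>l \<le> L\<close> and comparing dimensions as \<open>L\<close>
  grows bounds its size by the degree of the divisor of poles of \<open>x\<close>.\<close>

lemma pole_degree_bound:
  fixes u :: "'a \<Rightarrow> 'k"
  assumes x: "x \<in> F" "x \<notin> range \<iota>" and I: "finite I" and u: "\<And>i. i \<in> I \<Longrightarrow> u i \<in> F"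
    and indep: "\<And>p. (\<Sum>i\<in>I. ev (p i) x * u i) = 0 \<Longrightarrow> \<forall>i\<in>I. p i = 0"
    and integral: "\<And>i v. i \<in> I \<Longrightarrow> v \<in> Vals F \<Longrightarrow> vge v x 0 \<Longrightarrow> vge v (u i) 0"
  shows "card I \<le> (\<Sum>v\<in>{v \<in> Vals F. v x < 0}. nat (- v x))"
proof (rule ccontr)
  let ?P = "{v \<in> Vals F. v x < 0}"
  define deg where "deg = (\<Sum>v\<in>?P. nat (- v x))"
  assume "\<not> ?thesis"
  then have gt: "deg < card I" by (simp add: deg_def)
  have P: "finite ?P" by (rule finite_poles[OF x])
  have x0: "x \<noteq> 0" using x by (metis iota_0 rangeI)
  define c where "c = (\<Sum>i\<in>I. \<Sum>v\<in>?P. nat \<bar>v (u i)\<bar>)"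
  have c: "vge v (u i) (- int c)" if "i \<in> I" "v \<in> ?P" for i v
  proof -
    have "nat \<bar>v (u i)\<bar> \<le> (\<Sum>v\<in>?P. nat \<bar>v (u i)\<bar>)" using P that by (intro member_le_sum) auto
    also have "\<dots> \<le> c" unfolding c_def using I that by (intro member_le_sum) auto
    finally show ?thesis by (auto simp: vge_def)
  qed
  \<comment> \<open>In \<open>L\<close>, the sum of the pole bounds grows with slope
    \<open>deg\<close>, the number of products with slope \<open>card I > deg\<close>. This
    \<open>L\<close> exceeds the constant part \<open>c * card ?P\<close>, so there are more
    products than the dimension bound allows.\<close>
  define L where "L = Suc (c * card ?P)"
  define D where "D v = c + L * nat (- v x)" for v
  let ?J = "I \<times> {..L}"
  define w where "w = (\<lambda>(i, l). x ^ l * u i)"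
  have "(\<Sum>v\<in>?P. D v) = c * card ?P + L * deg"
    by (simp add: D_def deg_def sum.distrib sum_distrib_left mult.commute)
  moreover have "1 + (c * card ?P + L * deg) < Suc deg * Suc L" by (simp add: L_def)
  moreover have "Suc deg * Suc L \<le> card I * Suc L" using gt by (intro mult_right_mono) auto
  moreover have "card ?J = card I * Suc L" by (simp add: card_cartesian_product)
  ultimately have "1 + (\<Sum>v\<in>?P. D v) < card ?J" by linarith
  moreover have "finite ?J" using I by simp
  moreover have "w j \<in> F" if "j \<in> ?J" for j using that u x by (auto simp: w_def)
  moreover have "vge v (w j) (- int (D v))" if "j \<in> ?J" "v \<in> ?P" for j v
  proof -
    obtain i l where j: "j = (i, l)" "i \<in> I" "l \<le> L" using \<open>j \<in> ?J\<close> by auto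
    have V: "valuation_on F v" and neg: "v x < 0" using that ValsD(1) by auto
    have "vge v (x ^ l * u i) (int l * v x + - int c)"
      using x0 x u j c[OF j(2) that(2)] by (intro vge_mult[OF V] vge_power[OF V]) (auto simp: vge_def)
    moreover have "int L * v x \<le> int l * v x" using j neg by (intro mult_right_mono_neg) auto
    then have "- int (D v) \<le> int l * v x + - int c" using neg by (simp add: D_def)
    ultimately show ?thesis unfolding j w_def by (auto intro: vge_mono)
  qed
  moreover have "vge v (w j) 0" if "j \<in> ?J" "v \<in> Vals F - ?P" for j v
  proof -
    obtain i l where j: "j = (i, l)" "i \<in> I" using \<open>j \<in> ?J\<close> by auto
    have V: "valuation_on F v" and pos: "vge v x 0" using that ValsD(1) by (auto simp: vge_def)
    have "vge v (x ^ l) (int l * 0)" using x pos by (intro vge_power[OF V])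
    then have "vge v (x ^ l * u i) (0 + 0)"
      using x u j integral[OF j(2) _ pos] that by (intro vge_mult[OF V]) auto
    then show ?thesis unfolding j w_def by simp
  qed
  ultimately have "\<exists>d. (\<exists>j\<in>?J. d j \<noteq> 0) \<and> (\<Sum>j\<in>?J. \<iota> (d j) * w j) = 0"
    using bounded_poles_dependent[OF P, of ?J D w] by blast
  then obtain d where d: "\<exists>j\<in>?J. d j \<noteq> 0" "(\<Sum>j\<in>?J. \<iota> (d j) * w j) = 0" by blast
  define p where "p i = (\<Sum>l\<le>L. Polynomial.monom (d (i, l)) l)" for i
  have "(\<Sum>i\<in>I. ev (p i) x * u i) = (\<Sum>j\<in>?J. \<iota> (d j) * w j)"
    unfolding p_def w_def ev_sum sum_distrib_right
    by (subst sum.cartesian_product) (auto simp: ev_monom mult.assoc intro!: sum.cong)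
  with d indep have p0: "\<forall>i\<in>I. p i = 0" by simp
  have "d (i, l) = 0" if "i \<in> I" "l \<le> L" for i l
  proof -
    have "Polynomial.coeff (p i) l = d (i, l)"
      using that by (simp add: p_def coeff_sum)
    with p0 that show ?thesis by simp
  qed
  with d(1) show False by auto
qed

end

text \<open>\<open>n\<close> is the degree of \<open>F\<close> over \<open>F'\<close>. Independence
  of \<open>b\<close> feeds the lower bound for the sum of the ramification indices,
  \<open>rank_le\<close> the upper bound.\<close>

locale curve_field_extension = curve_field \<iota> F + sub: extension_field \<iota> F'
  for \<iota> :: "complex \<Rightarrow> 'k::field" and F F' :: "'k set" +
  fixes n :: nat and b :: "nat \<Rightarrow> 'k"
  assumes sub_F: "F' \<subseteq> F"
    and b_mem: "i < n \<Longrightarrow> b i \<in> F"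
    and b_indep: "(\<And>i. i < n \<Longrightarrow> c i \<in> F') \<Longrightarrow> (\<Sum>i<n. c i * b i) = 0 \<Longrightarrow> \<forall>i<n. c i = 0"
    and rank_le: "\<forall>i<Suc n. w i \<in> F \<Longrightarrow>
      \<exists>c. (\<forall>i<Suc n. c i \<in> F') \<and> (\<exists>i<Suc n. c i \<noteq> 0) \<and> (\<Sum>i<Suc n. c i * w i) = 0"
begin

lemma sub_mem: "a \<in> F' \<Longrightarrow> a \<in> F"
  using sub_F by blast

sublocale sub: curve_field \<iota> F'
proof
  fix x assume "x \<in> F'" "x \<notin> range \<iota>"
  then have "\<exists>N. \<forall>w::nat \<Rightarrow> 'k. (\<forall>i<N. w i \<in> F) \<longrightarrow>
      (\<exists>p. (\<exists>i<N. p i \<noteq> 0) \<and> (\<Sum>i<N. ev (p i) x * w i) = 0)"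
    using sub_mem by (intro bounded_rank)
  then obtain N where N: "\<forall>w::nat \<Rightarrow> 'k. (\<forall>i<N. w i \<in> F) \<longrightarrow>
      (\<exists>p. (\<exists>i<N. p i \<noteq> 0) \<and> (\<Sum>i<N. ev (p i) x * w i) = 0)" by (elim exE) (rule that)
  show "\<exists>N. \<forall>w::nat \<Rightarrow> 'k. (\<forall>i<N. w i \<in> F') \<longrightarrow>
      (\<exists>p. (\<exists>i<N. p i \<noteq> 0) \<and> (\<Sum>i<N. ev (p i) x * w i) = 0)"
  proof (intro exI[of _ N] allI impI)
    fix w :: "nat \<Rightarrow> 'k" assume "\<forall>i<N. w i \<in> F'"
    with sub_mem have "\<forall>i<N. w i \<in> F" by blast
    with N show "\<exists>p. (\<exists>i<N. p i \<noteq> 0) \<and> (\<Sum>i<N. ev (p i) x * w i) = 0" by simp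
  qed
qed

text \<open>The ramification index: the positive generator of the value group of \<open>v\<close> on
  \<open>F'\<close>, meaningful for \<open>nontrivial\<close> valuations.\<close>

definition ram :: "('k \<Rightarrow> int) \<Rightarrow> nat" where
  "ram v = (LEAST e. 0 < e \<and> (\<exists>a\<in>F'. a \<noteq> 0 \<and> v a = int e))"

definition rest :: "('k \<Rightarrow> int) \<Rightarrow> 'k \<Rightarrow> int" where
  "rest v = restrict (\<lambda>a. v a div int (ram v)) (F' - {0})"

text \<open>Normalizing by \<open>ram\<close> requires a nonzero value on \<open>F'\<close>. A
  valuation without one gives all edges of G' the value 0, hence gap 0, and is treated
  separately.\<close>

definition nontrivial :: "('k \<Rightarrow> int) \<Rightarrow> bool" where
  "nontrivial v \<longleftrightarrow> (\<exists>a\<in>F'. a \<noteq> 0 \<and> v a \<noteq> 0)"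

definition fiber :: "('k \<Rightarrow> int) \<Rightarrow> ('k \<Rightarrow> int) set" where
  "fiber v' = {v \<in> Vals F. nontrivial v \<and> rest v = v'}"

text \<open>The values of \<open>v\<close> on \<open>F'\<close> form a subgroup of the integers,
  hence the multiples of the least positive one; dividing by it makes the restriction
  surjective.\<close>

lemma rest:
  assumes v: "v \<in> Vals F" and nt: "nontrivial v"
  shows "0 < ram v" "rest v \<in> Vals F'"
    and "\<And>a. a \<in> F' \<Longrightarrow> a \<noteq> 0 \<Longrightarrow> v a = int (ram v) * rest v a"
proof -
  note V = ValsD(1)[OF v]
  obtain a where a: "a \<in> F'" "a \<noteq> 0" "v a \<noteq> 0" using nt by (auto simp: nontrivial_def)
  have "\<exists>e. 0 < e \<and> (\<exists>a\<in>F'. a \<noteq> 0 \<and> v a = int e)"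
  proof (cases "0 < v a")
    case True
    with a show ?thesis by (intro exI[of _ "nat (v a)"]) auto
  next
    case False
    with a have "inverse a \<in> F'" "inverse a \<noteq> 0" "v (inverse a) = int (nat (- v a))" "0 < nat (- v a)"
      using sub_mem by (auto simp: val_inverse[OF V])
    then show ?thesis by blast
  qed
  then have ex: "0 < ram v \<and> (\<exists>a\<in>F'. a \<noteq> 0 \<and> v a = int (ram v))"
    unfolding ram_def by (rule LeastI_ex)
  then show pos: "0 < ram v" by blast
  obtain t where t: "t \<in> F'" "t \<noteq> 0" "v t = int (ram v)" using ex by blast
  have div: "v a = int (ram v) * (v a div int (ram v))" if a: "a \<in> F'" "a \<noteq> 0" for a
  proof (rule ccontr)
    assume neq: "v a \<noteq> int (ram v) * (v a div int (ram v))"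
    define k where "k = v a div int (ram v)"
    define r where "r = v a mod int (ram v)"
    have vr: "v a = int (ram v) * k + r" by (simp add: k_def r_def)
    have "0 \<le> r" "r < int (ram v)" using pos by (simp_all add: r_def)
    moreover have "r \<noteq> 0" using neq vr unfolding k_def[symmetric] by linarith
    ultimately have r: "0 < r" "r < int (ram v)" by linarith+
    obtain s where s: "s \<in> F'" "s \<noteq> 0" "v s = - (int (ram v) * k)"
    proof (cases "0 \<le> k")
      case True
      have "v (inverse (t ^ nat k)) = - (int (ram v) * k)"
        using t True sub_mem by (simp add: val_inverse[OF V] val_power[OF V] power_mem mult.commute)
      then show thesis using that[of "inverse (t ^ nat k)"] t by auto
    next
      case False
      have "v (t ^ nat (- k)) = - (int (ram v) * k)"
        using t False sub_mem by (simp add: val_power[OF V] mult.commute)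
      then show thesis using that[of "t ^ nat (- k)"] t by auto
    qed
    have "v (a * s) = r" using a s sub_mem vr by (simp add: val_mult[OF V])
    then have "0 < nat r \<and> (\<exists>a\<in>F'. a \<noteq> 0 \<and> v a = int (nat r))"
      using a s r by (intro conjI bexI[of _ "a * s"]) auto
    then have "ram v \<le> nat r" unfolding ram_def by (rule Least_le)
    with r show False by simp
  qed
  have rest_eq: "v a = int (ram v) * rest v a" if "a \<in> F'" "a \<noteq> 0" for a
    using div[OF that] that by (simp add: rest_def)
  then show "\<And>a. a \<in> F' \<Longrightarrow> a \<noteq> 0 \<Longrightarrow> v a = int (ram v) * rest v a" .
  have "valuation_on F' (rest v)"
    unfolding valuation_on_def
  proof (intro conjI ballI allI impI)
    fix a b assume ab: "a \<in> F' - {0}" "b \<in> F' - {0}"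
    then have "int (ram v) * rest v (a * b) = int (ram v) * (rest v a + rest v b)"
      using rest_eq[of a] rest_eq[of b] rest_eq[of "a * b"] val_mult[OF V, of a b] sub_mem sub.mult_mem[of a b]
      by (auto simp: distrib_left)
    then show "rest v (a * b) = rest v a + rest v b" using pos by simp
    assume "a + b \<noteq> 0"
    then have "min (int (ram v) * rest v a) (int (ram v) * rest v b) \<le> int (ram v) * rest v (a + b)"
      using ab rest_eq[of a] rest_eq[of b] rest_eq[of "a + b"] val_add[OF V, of a b] sub_mem sub.add_mem[of a b]
      by auto
    then show "min (rest v a) (rest v b) \<le> rest v (a + b)"
      using pos by (auto simp: min_def mult_le_cancel_left split: if_splits)
  next
    fix c :: complex assume "c \<noteq> 0"
    then show "rest v (\<iota> c) = 0" using rest_eq[of "\<iota> c"] val_iota[OF V, of c] pos by auto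
  qed
  moreover have "rest v \<in> (F' - {0}) \<rightarrow>\<^sub>E UNIV" by (auto simp: rest_def)
  moreover have "rest v ` (F' - {0}) = UNIV"
  proof -
    have t1: "rest v t = 1" using rest_eq[of t] t pos by simp
    have R: "valuation_on F' (rest v)" by fact
    have "k \<in> rest v ` (F' - {0})" for k
    proof (cases "0 \<le> k")
      case True
      then have "rest v (t ^ nat k) = k" using t t1 by (simp add: sub.val_power[OF R])
      then show ?thesis using t by (intro image_eqI[of _ _ "t ^ nat k"]) auto
    next
      case False
      then have "rest v (inverse (t ^ nat (- k))) = k"
        using t t1 by (simp add: sub.val_power[OF R] sub.val_inverse[OF R] sub.power_mem)
      then show ?thesis using t by (intro image_eqI[of _ _ "inverse (t ^ nat (- k))"]) auto
    qed
    then show ?thesis by blast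
  qed
  ultimately show "rest v \<in> Vals F'" by (simp add: Vals_def)
qed

text \<open>After normalization, \<open>v c = ram v * v' c\<close> for every nonzero
  \<open>c\<close> in \<open>F'\<close> and every \<open>v\<close> in the fiber, which is the
  hypothesis of \<open>ramification_family\<close> with \<open>e = ram\<close>. Its members are as
  many as the sum of the indices.\<close>

lemma ramification_le:
  assumes S: "finite S" "S \<subseteq> fiber v'"
  shows "(\<Sum>v\<in>S. ram v) \<le> n"
proof (rule ccontr)
  assume gt: "\<not> ?thesis"
  let ?I = "Sigma S (\<lambda>v. {..<ram v})"
  have SV: "S \<subseteq> Vals F" using S by (auto simp: fiber_def)
  obtain y where y: "\<forall>v\<in>S. \<forall>j. y (v, j) \<in> F"
    and ind: "\<forall>c d. (\<forall>i\<in>?I. c i \<in> F) \<longrightarrow>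
       (\<forall>i\<in>?I. c i \<noteq> 0 \<longrightarrow> (\<forall>v\<in>S. v (c i) = int (ram v) * d i)) \<longrightarrow>
       (\<Sum>i\<in>?I. c i * y i) = 0 \<longrightarrow> (\<forall>i\<in>?I. c i = 0)"
    using ramification_family[OF S(1) SV, of ram] by (elim exE conjE) (rule that)
  have card: "Suc n \<le> card ?I" using gt S by simp
  have "finite ?I" "y ` ?I \<subseteq> F" using S y by auto
  from dependent_reindex[where A = F' and act = "(*)" and F = F and N = "Suc n", OF rank_le _ _ this(1) card this(2)]
  have "\<exists>c. (\<forall>i\<in>?I. c i \<in> F') \<and> (\<exists>i\<in>?I. c i \<noteq> 0) \<and> (\<Sum>i\<in>?I. c i * y i) = 0" by simp
  then obtain c where c: "\<forall>i\<in>?I. c i \<in> F'" "\<exists>i\<in>?I. c i \<noteq> 0" "(\<Sum>i\<in>?I. c i * y i) = 0" by blast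
  have 1: "\<forall>i\<in>?I. c i \<in> F" using c(1) sub_mem by blast
  have 2: "\<forall>i\<in>?I. c i \<noteq> 0 \<longrightarrow> (\<forall>v\<in>S. v (c i) = int (ram v) * v' (c i))"
  proof (intro ballI impI)
    fix i v assume "i \<in> ?I" "c i \<noteq> 0" "v \<in> S"
    then show "v (c i) = int (ram v) * v' (c i)"
      using rest(3)[of v "c i"] c(1) S by (auto simp: fiber_def)
  qed
  have "\<forall>i\<in>?I. c i = 0"
    by (rule ind[THEN spec, of c, THEN spec, of "\<lambda>i. v' (c i)", THEN mp, THEN mp, THEN mp, OF 1 2 c(3)])
  with c(2) show False by blast
qed

text \<open>Tower argument: the family for the poles of \<open>x\<close> in \<open>F'\<close> is
  independent over C[x] and \<open>b\<close> over \<open>F'\<close>, so the products are independent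
  over C[x]. Their number is the left-hand side, and \<open>pole_degree_bound\<close> applies to
  them in \<open>F\<close>.\<close>

lemma degree_multiplicative:
  assumes x: "x \<in> F'" "x \<notin> range \<iota>"
  shows "(\<Sum>v\<in>{v \<in> Vals F'. v x < 0}. nat (- v x)) * n \<le> (\<Sum>v\<in>{v \<in> Vals F. v x < 0}. nat (- v x))"
proof -
  let ?P' = "{v \<in> Vals F'. v x < 0}"
  let ?I = "Sigma ?P' (\<lambda>v. {..<nat (- v x)})"
  have xF: "x \<in> F" using x sub_mem by blast
  have x0: "x \<noteq> 0" using x by (metis iota_0 rangeI)
  have P': "finite ?P'" by (rule sub.finite_poles[OF x])
  have P'2: "?P' \<subseteq> {v \<in> Vals F'. x \<noteq> 0 \<and> v x < 0}" using x0 by auto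
  obtain y where y: "\<forall>i\<in>?I. y i \<in> F'"
    and y_ind: "\<forall>p. (\<Sum>i\<in>?I. ev (p i) x * y i) = 0 \<longrightarrow> (\<forall>i\<in>?I. p i = 0)"
    using sub.pole_family[OF x(1) P' P'2] by (elim exE conjE) (rule that)
  have yb: "y (fst k) * b (snd k) \<in> F" if "k \<in> ?I \<times> {..<n}" for k
    using that y sub_mem b_mem by (auto intro!: mult_mem)
  \<comment> \<open>The products may have poles away from those of \<open>x\<close>. A nonzero
    polynomial factor removes them and, C[x] being a domain, keeps the independence.\<close>
  have "\<forall>k\<in>?I \<times> {..<n}. \<exists>q. q \<noteq> 0 \<and>
      (\<forall>v. valuation_on F v \<longrightarrow> vge v x 0 \<longrightarrow> vge v (ev q x * (y (fst k) * b (snd k))) 0)"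
    using integral_multiple[OF xF x(2) yb] by blast
  from bchoice[OF this] obtain q where q: "\<forall>k\<in>?I \<times> {..<n}. q k \<noteq> 0 \<and>
      (\<forall>v. valuation_on F v \<longrightarrow> vge v x 0 \<longrightarrow> vge v (ev (q k) x * (y (fst k) * b (snd k))) 0)"
    by blast
  define u where "u k = ev (q k) x * (y (fst k) * b (snd k))" for k
  have fin: "finite ?I" using P' by auto
  have "card (?I \<times> {..<n}) \<le> (\<Sum>v\<in>{v \<in> Vals F. v x < 0}. nat (- v x))"
  proof (rule pole_degree_bound[OF xF x(2), where u = u])
    show "finite (?I \<times> {..<n})" using fin by simp
    show "u k \<in> F" if "k \<in> ?I \<times> {..<n}" for k using yb[OF that] xF by (auto simp: u_def)
    show "vge v (u k) 0" if "k \<in> ?I \<times> {..<n}" "v \<in> Vals F" "vge v x 0" for k v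
      using q that ValsD(1) unfolding u_def by blast
    fix p assume sum0: "(\<Sum>k\<in>?I \<times> {..<n}. ev (p k) x * u k) = 0"
    define c where "c j = (\<Sum>i\<in>?I. ev (p (i, j) * q (i, j)) x * y i)" for j
    have "(\<Sum>k\<in>?I \<times> {..<n}. ev (p k) x * u k) =
        (\<Sum>i\<in>?I. \<Sum>j<n. ev (p (i, j) * q (i, j)) x * y i * b j)"
      by (subst sum.cartesian_product) (auto simp: u_def ev_mult mult.assoc intro!: sum.cong)
    also have "\<dots> = (\<Sum>j<n. c j * b j)"
      by (subst sum.swap) (simp add: c_def sum_distrib_right)
    finally have "(\<Sum>j<n. c j * b j) = 0" using sum0 by simp
    moreover have "c j \<in> F'" for j using y x unfolding c_def by (auto intro!: sub.sum_mem sub.mult_mem sub.ev_mem)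
    ultimately have c0: "\<forall>j<n. c j = 0" using b_indep by blast
    show "\<forall>k\<in>?I \<times> {..<n}. p k = 0"
    proof
      fix k assume k: "k \<in> ?I \<times> {..<n}"
      obtain i j where ij: "k = (i, j)" "i \<in> ?I" "j < n" using k by blast
      have "(\<Sum>i\<in>?I. ev (p (i, j) * q (i, j)) x * y i) = 0" using c0 ij(3) by (simp add: c_def)
      from y_ind[THEN spec, THEN mp, OF this] ij have "p k * q k = 0" by blast
      with q k show "p k = 0" by auto
    qed
  qed
  then show ?thesis using P' by (simp add: card_cartesian_product)
qed

text \<open>The sum is at most \<open>n\<close> for every \<open>v'\<close>, and the average over the poles of a function \<open>x\<close>
  in \<open>F'\<close> is at least \<open>n\<close>.\<close>

theorem fundamental_identity:
  assumes v': "v' \<in> Vals F'"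
  shows "finite (fiber v')" "(\<Sum>v\<in>fiber v'. ram v) = n"
proof -
  \<comment> \<open>The value -1 makes \<open>v'\<close> itself one of the poles of
    \<open>x\<close>, so that a defect at \<open>v'\<close> shows up in the count over all
    poles.\<close>
  obtain x where x: "x \<in> F'" "x \<noteq> 0" "v' x = -1" using sub.ValsD(3)[OF v'] by blast
  have nr: "x \<notin> range \<iota>" using sub.valuation_not_iota[OF sub.ValsD(1)[OF v']] x by auto
  have xF: "x \<in> F" using x sub_mem by blast
  let ?P = "{v \<in> Vals F. v x < 0}" and ?P' = "{v \<in> Vals F'. v x < 0}"
  have P: "finite ?P" by (rule finite_poles[OF xF nr])
  have P': "finite ?P'" by (rule sub.finite_poles[OF x(1) nr])
  \<comment> \<open>\<open>v x\<close> and \<open>rest v x\<close> have the same sign, so the fibers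
    over the poles of \<open>x\<close> in \<open>F'\<close> partition the poles of \<open>x\<close>
    in \<open>F\<close>.\<close>
  have fib: "fiber w = {v \<in> ?P. rest v = w}" if w: "w \<in> ?P'" for w
  proof -
    have "v \<in> ?P" if v: "v \<in> fiber w" for v
      using rest[of v] v w x by (auto simp: fiber_def mult_pos_neg)
    moreover have "nontrivial v" if "v \<in> ?P" for v
      using that x by (auto simp: nontrivial_def)
    ultimately show ?thesis by (auto simp: fiber_def)
  qed
  have fin: "finite (fiber w)" if "w \<in> ?P'" for w 
    using P by (rule rev_finite_subset) (auto simp: fib[OF that])
  have restP: "rest v \<in> ?P'" if v: "v \<in> ?P" for v
  proof -
    have nt: "nontrivial v" using v x by (auto simp: nontrivial_def)
    have "int (ram v) * rest v x < 0" using rest(3)[OF _ nt x(1,2)] v by auto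
    then have "rest v x < 0" using rest(1)[OF _ nt] v by (auto simp: mult_less_0_iff)
    then show ?thesis using rest(2)[OF _ nt] v by auto
  qed
  have "(\<Sum>v\<in>?P. nat (- v x)) = (\<Sum>w\<in>?P'. \<Sum>v\<in>{v \<in> ?P. rest v = w}. nat (- v x))"
    using restP by (intro sum.group[symmetric] P P') auto
  also have "\<dots> = (\<Sum>w\<in>?P'. nat (- w x) * (\<Sum>v\<in>fiber w. ram v))"
  proof (rule sum.cong)
    fix w assume w: "w \<in> ?P'"
    have "nat (- v x) = nat (- w x) * ram v" if "v \<in> fiber w" for v
    proof -
      have "v x = int (ram v) * w x" using rest(3)[of v x] that x by (auto simp: fiber_def)
      then have "- v x = int (ram v) * - w x" by simp
      then have "nat (- v x) = nat (int (ram v)) * nat (- w x)" by (metis nat_mult_distrib of_nat_0_le_iff)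
      then show ?thesis by simp
    qed
    then show "(\<Sum>v\<in>{v \<in> ?P. rest v = w}. nat (- v x)) = nat (- w x) * (\<Sum>v\<in>fiber w. ram v)"
      unfolding fib[OF w, symmetric] sum_distrib_left by (intro sum.cong) auto
  qed simp
  finally have eq: "(\<Sum>v\<in>?P. nat (- v x)) = (\<Sum>w\<in>?P'. nat (- w x) * (\<Sum>v\<in>fiber w. ram v))" .
  have v'P: "v' \<in> ?P'" using v' x by simp
  show "finite (fiber v')" by (rule fin[OF v'P])
  have le: "(\<Sum>v\<in>fiber w. ram v) \<le> n" if "w \<in> ?P'" for w
    by (rule ramification_le[OF fin[OF that] order.refl])
  show "(\<Sum>v\<in>fiber v'. ram v) = n"
  proof (rule ccontr)
    assume "(\<Sum>v\<in>fiber v'. ram v) \<noteq> n"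
    with le[OF v'P] have lt: "(\<Sum>v\<in>fiber v'. ram v) < n" by simp
    have "(\<Sum>w\<in>?P'. nat (- w x) * (\<Sum>v\<in>fiber w. ram v)) < (\<Sum>w\<in>?P'. nat (- w x) * n)"
    proof (rule sum_strict_mono_ex1[OF P'])
      show "\<forall>w\<in>?P'. nat (- w x) * (\<Sum>v\<in>fiber w. ram v) \<le> nat (- w x) * n"
        using le by (auto intro!: mult_left_mono)
      show "\<exists>w\<in>?P'. nat (- w x) * (\<Sum>v\<in>fiber w. ram v) < nat (- w x) * n"
        using v'P lt x by (intro bexI[of _ v']) auto
    qed
    then have "(\<Sum>v\<in>?P. nat (- v x)) < (\<Sum>w\<in>?P'. nat (- w x)) * n"
      unfolding eq by (simp add: sum_distrib_right)
    with degree_multiplicative[OF x(1) nr] show False by simp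
  qed
qed

text \<open>Grouped by fibers, each \<open>v'\<close> contributes \<open>H' v'\<close> times the sum
  of the ramification indices above it. In the application \<open>H\<close> and \<open>H'\<close>
  are gaps, which scale with the ramification index.\<close>

corollary weighted_sum:
  fixes H H' :: "('k \<Rightarrow> int) \<Rightarrow> int"
  assumes fin: "finite {v' \<in> Vals F'. H' v' \<noteq> 0}"
    and H: "\<And>v. v \<in> Vals F \<Longrightarrow> nontrivial v \<Longrightarrow> H v = int (ram v) * H' (rest v)"
    and H0: "\<And>v. v \<in> Vals F \<Longrightarrow> \<not> nontrivial v \<Longrightarrow> H v = 0"
  shows "finite {v \<in> Vals F. H v \<noteq> 0}"
    and "(\<Sum>v\<in>{v \<in> Vals F. H v \<noteq> 0}. H v) = (\<Sum>v'\<in>{v' \<in> Vals F'. H' v' \<noteq> 0}. H' v') * int n"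
proof -
  let ?T = "{v \<in> Vals F. H v \<noteq> 0}" and ?T' = "{v' \<in> Vals F'. H' v' \<noteq> 0}"
  have T: "?T = (\<Union>w\<in>?T'. fiber w)"
  proof
    show "?T \<subseteq> (\<Union>w\<in>?T'. fiber w)"
    proof
      fix v assume v: "v \<in> ?T"
      then have nt: "nontrivial v" using H0 by blast
      then have "rest v \<in> ?T'" using v H[OF _ nt] rest(2)[OF _ nt] by auto
      moreover have "v \<in> fiber (rest v)" using v nt by (simp add: fiber_def)
      ultimately show "v \<in> (\<Union>w\<in>?T'. fiber w)" by blast
    qed
    show "(\<Union>w\<in>?T'. fiber w) \<subseteq> ?T" using H rest(1) by (fastforce simp: fiber_def)
  qed
  show "finite ?T" unfolding T using fin fundamental_identity(1) by blast
  have "(\<Sum>v\<in>?T. H v) = (\<Sum>w\<in>?T'. \<Sum>v\<in>fiber w. H v)"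
    unfolding T using fin fundamental_identity(1)
    by (intro sum.UNION_disjoint) (auto simp: fiber_def)
  also have "\<dots> = (\<Sum>w\<in>?T'. H' w * int n)"
  proof (rule sum.cong)
    fix w assume w: "w \<in> ?T'"
    have "(\<Sum>v\<in>fiber w. H v) = (\<Sum>v\<in>fiber w. H' w * int (ram v))"
      using H by (intro sum.cong) (auto simp: fiber_def)
    also have "\<dots> = H' w * int (\<Sum>v\<in>fiber w. ram v)" by (simp add: sum_distrib_left)
    finally show "(\<Sum>v\<in>fiber w. H v) = H' w * int n"
      using fundamental_identity(2)[of w] w by (simp del: of_nat_sum)
  qed simp
  finally show "(\<Sum>v\<in>?T. H v) = (\<Sum>w\<in>?T'. H' w) * int n" by (simp add: sum_distrib_right)
qed

end

section \<open>Gaps and thresholds\<close>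

text \<open>\<open>gap\<close> with the edge values abstracted to a function \<open>h\<close>: the
  statements about colorings then involve no field.\<close>

definition spread :: "'e set \<Rightarrow> ('e \<Rightarrow> color) \<Rightarrow> ('e \<Rightarrow> int) \<Rightarrow> int" where
  "spread E \<delta> h = max 0 (Min (h ` {e\<in>E. \<delta> e = Red}) - Max (h ` {e\<in>E. \<delta> e = Blue}))"

definition threshold :: "('e \<Rightarrow> int) \<Rightarrow> int \<Rightarrow> 'e \<Rightarrow> color" where
  "threshold h n e = (if n \<le> h e then Red else Blue)"

lemma color_image_UNIV:
  "\<delta> ` E = (UNIV :: color set) \<longleftrightarrow> {e\<in>E. \<delta> e = Red} \<noteq> {} \<and> {e\<in>E. \<delta> e = Blue} \<noteq> {}"
proof -
  have "c \<in> \<delta> ` E" if "Red \<in> \<delta> ` E" "Blue \<in> \<delta> ` E" for c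
    using that by (cases c) simp_all
  then have "\<delta> ` E = UNIV \<longleftrightarrow> Red \<in> \<delta> ` E \<and> Blue \<in> \<delta> ` E" by blast
  moreover have "c \<in> \<delta> ` E \<longleftrightarrow> {e\<in>E. \<delta> e = c} \<noteq> {}" for c by blast
  ultimately show ?thesis by simp
qed

text \<open>All blue values must lie below \<open>n\<close> and no red value may. The interval is
  open at the blue end and closed at the red end, so it contains exactly as many integers as the
  difference in \<open>spread\<close>, and none if that difference is negative.\<close>

lemma threshold_set:
  fixes \<delta> :: "'e \<Rightarrow> color"
  assumes E: "finite E" and \<delta>: "\<delta> ` E = UNIV"
  shows "{n. \<forall>e\<in>E. \<delta> e = threshold h n e} =
    greaterThanAtMost (Max (h ` {e\<in>E. \<delta> e = Blue})) (Min (h ` {e\<in>E. \<delta> e = Red}))"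
proof -
  define R B where "R = {e\<in>E. \<delta> e = Red}" and "B = {e\<in>E. \<delta> e = Blue}"
  have ne: "R \<noteq> {}" "B \<noteq> {}" using \<delta> unfolding color_image_UNIV R_def B_def by simp_all
  have fin: "finite R" "finite B" using E by (simp_all add: R_def B_def)
  have "(\<forall>e\<in>E. \<delta> e = threshold h n e) \<longleftrightarrow> (\<forall>e\<in>B. h e < n) \<and> (\<forall>e\<in>R. n \<le> h e)" for n
  proof -
    have "\<delta> e = threshold h n e \<longleftrightarrow> (\<delta> e = Blue \<longrightarrow> h e < n) \<and> (\<delta> e = Red \<longrightarrow> n \<le> h e)" for e
      by (cases "\<delta> e") (auto simp: threshold_def)
    then show ?thesis by (auto simp: R_def B_def)
  qed
  moreover have "Max (h ` B) < n \<longleftrightarrow> (\<forall>e\<in>B. h e < n)" "n \<le> Min (h ` R) \<longleftrightarrow> (\<forall>e\<in>R. n \<le> h e)" for n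
    using ne fin by simp_all
  ultimately show ?thesis unfolding R_def[symmetric] B_def[symmetric] greaterThanAtMost_iff set_eq_iff
    by simp
qed

lemma spread_eq_card:
  assumes "finite E" "\<delta> ` E = UNIV"
  shows "spread E \<delta> h = int (card {n. \<forall>e\<in>E. \<delta> e = threshold h n e})"
  unfolding threshold_set[OF assms] by (simp add: spread_def)

lemma spread_scale:
  assumes "finite E" "\<delta> ` E = UNIV" "0 < k" and g: "\<And>e. e \<in> E \<Longrightarrow> g e = int k * h e"
  shows "spread E \<delta> g = int k * spread E \<delta> h"
proof -
  let ?R = "{e\<in>E. \<delta> e = Red}" and ?B = "{e\<in>E. \<delta> e = Blue}"
  have ne: "?R \<noteq> {}" "?B \<noteq> {}" using assms(2) unfolding color_image_UNIV by simp_all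
  have m: "mono ((*) (int k))" by (auto intro!: monoI mult_left_mono)
  have img: "g ` S = (*) (int k) ` h ` S" if "S \<subseteq> E" for S
    using g that by (force simp: image_image)
  have "Min (g ` ?R) = int k * Min (h ` ?R)" "Max (g ` ?B) = int k * Max (h ` ?B)"
    using assms(1) ne by (auto simp: img mono_Min_commute[OF m] mono_Max_commute[OF m])
  then show ?thesis using assms(3)
    by (simp add: spread_def max_mult_distrib_left right_diff_distrib)
qed

lemma finite_NAC: "finite E \<Longrightarrow> finite (NAC E)"
proof -
  assume "finite E"
  have "(UNIV :: color set) = {Red, Blue}" using color.exhaust by blast
  then have "finite (UNIV :: color set)" by (metis finite.emptyI finite.insertI)
  then have "finite (E \<rightarrow>\<^sub>E (UNIV :: color set))" using \<open>finite E\<close> by (intro finite_PiE) auto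
  then show "finite (NAC E)" by (rule rev_finite_subset) (auto simp: NAC_def)
qed

text \<open>The gap of a coloring counts the thresholds that induce it. Hence the gaps of the extensions of
  \<open>\<delta>'\<close> add up to the number of thresholds inducing \<open>\<delta>'\<close>.\<close>

lemma sum_spread_extensions:
  assumes E: "finite E" "E' \<subseteq> E" and \<delta>': "\<delta>' \<in> NAC E'"
    and thr: "\<And>n. restrict (threshold h n) E ` E = UNIV \<Longrightarrow> restrict (threshold h n) E \<in> NAC E"
  shows "(\<Sum>\<delta>\<in>{\<delta> \<in> NAC E. restrict \<delta> E' = \<delta>'}. spread E \<delta> h) = spread E' \<delta>' h"
proof -
  let ?D = "{\<delta> \<in> NAC E. restrict \<delta> E' = \<delta>'}"
  let ?T = "\<lambda>E \<delta>. {n. \<forall>e\<in>E. \<delta> e = threshold h n e}"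
  have E': "finite E'" using E finite_subset by blast
  \<comment> \<open>A threshold determines the coloring it induces, so different extensions have
    disjoint sets of thresholds.\<close>
  have ext: "\<delta> = restrict (threshold h n) E" if "\<delta> \<in> NAC E" "n \<in> ?T E \<delta>" for \<delta> n
  proof -
    have "\<delta> \<in> E \<rightarrow>\<^sub>E UNIV" using that by (simp add: NAC_def)
    then show ?thesis using that by (intro ext) (auto simp: restrict_def PiE_def extensional_def)
  qed
  have D: "finite ?D" using finite_NAC[OF E(1)] by simp
  have fin: "finite (?T E \<delta>)" if "\<delta> \<in> NAC E" for \<delta>
    using threshold_set[OF E(1), of \<delta> h] that by (simp add: NAC_def)
  have "(\<Sum>\<delta>\<in>?D. spread E \<delta> h) = int (\<Sum>\<delta>\<in>?D. card (?T E \<delta>))"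
    using spread_eq_card[OF E(1)] by (auto simp: NAC_def)
  also have "(\<Sum>\<delta>\<in>?D. card (?T E \<delta>)) = card (\<Union>\<delta>\<in>?D. ?T E \<delta>)"
  proof (rule card_UN_disjoint[symmetric])
    show "\<forall>\<delta>\<in>?D. \<forall>\<epsilon>\<in>?D. \<delta> \<noteq> \<epsilon> \<longrightarrow> ?T E \<delta> \<inter> ?T E \<epsilon> = {}"
    proof (intro ballI impI)
      fix \<delta> \<epsilon> assume "\<delta> \<in> ?D" "\<epsilon> \<in> ?D" "\<delta> \<noteq> \<epsilon>"
      then show "?T E \<delta> \<inter> ?T E \<epsilon> = {}" using ext[of \<delta>] ext[of \<epsilon>] by blast
    qed
  qed (use D fin in auto)
  also have "(\<Union>\<delta>\<in>?D. ?T E \<delta>) = ?T E' \<delta>'"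
  proof
    show "(\<Union>\<delta>\<in>?D. ?T E \<delta>) \<subseteq> ?T E' \<delta>'"
    proof
      fix n assume "n \<in> (\<Union>\<delta>\<in>?D. ?T E \<delta>)"
      then obtain \<delta> where "\<delta> \<in> ?D" "n \<in> ?T E \<delta>" by blast
      then show "n \<in> ?T E' \<delta>'" using E(2) by (auto simp: restrict_def)
    qed
    show "?T E' \<delta>' \<subseteq> (\<Union>\<delta>\<in>?D. ?T E \<delta>)"
    proof
      fix n assume n: "n \<in> ?T E' \<delta>'"
      let ?\<delta> = "restrict (threshold h n) E"
      have r: "restrict ?\<delta> E' = \<delta>'"
        using n E(2) \<delta>' by (intro HOL.ext) (auto simp: restrict_def NAC_def PiE_def extensional_def)
      \<comment> \<open>Both colors already occur on \<open>E'\<close>, so the coloring of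
        \<open>E\<close> given by \<open>n\<close> is surjective and \<open>thr\<close>
        applies.\<close>
      have "\<delta>' ` E' = ?\<delta> ` E'" using n E(2) by (intro image_cong) auto
      moreover have "\<delta>' ` E' = UNIV" using \<delta>' by (simp add: NAC_def)
      moreover have "?\<delta> ` E' \<subseteq> ?\<delta> ` E" using E(2) by (rule image_mono)
      ultimately have "?\<delta> ` E = UNIV" by (metis top.extremum_uniqueI)
      from thr[OF this] r have "?\<delta> \<in> ?D" by simp
      moreover have "n \<in> ?T E ?\<delta>" by simp
      ultimately show "n \<in> (\<Union>\<delta>\<in>?D. ?T E \<delta>)" by blast
    qed
  qed
  also have "int (card (?T E' \<delta>')) = spread E' \<delta>' h"
    using spread_eq_card[OF E', of \<delta>'] \<delta>' by (simp add: NAC_def)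
  finally show ?thesis .
qed

text \<open>With two vertices both positions would carry the same edge; from three on this cannot
  happen. It lets the only edge of a color be identified with a single position on the
  cycle.\<close>

lemma cycle_edges_inj:
  assumes "distinct vs" "3 \<le> length vs"
  shows "inj_on (\<lambda>i. {vs ! i, vs ! (Suc i mod length vs)}) {..<length vs}"
proof (rule inj_onI)
  let ?l = "length vs"
  fix i j assume ij: "i \<in> {..<?l}" "j \<in> {..<?l}"
    and eq: "{vs ! i, vs ! (Suc i mod ?l)} = {vs ! j, vs ! (Suc j mod ?l)}"
  have nth: "vs ! a = vs ! b \<longleftrightarrow> a = b" if "a < ?l" "b < ?l" for a b
    using that assms(1) by (simp add: nth_eq_iff_index_eq)
  have lt: "Suc i mod ?l < ?l" "Suc j mod ?l < ?l" using assms(2) by (intro mod_less_divisor; linarith)+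
  from eq have "vs ! i = vs ! j \<or> (vs ! i = vs ! (Suc j mod ?l) \<and> vs ! (Suc i mod ?l) = vs ! j)"
    by (auto simp: doubleton_eq_iff)
  then show "i = j"
  proof
    assume "vs ! i = vs ! (Suc j mod ?l) \<and> vs ! (Suc i mod ?l) = vs ! j"
    then have *: "i = Suc j mod ?l" "j = Suc i mod ?l" using nth lt ij by auto
    show ?thesis
    proof (cases "Suc j = ?l")
      case True
      with *(1) have i: "i = 0" by simp
      then have "Suc i < ?l" using assms(2) by simp
      with *(2) have "j = Suc i" by simp
      with i True assms(2) show ?thesis by simp
    next
      case False
      then have "Suc j < ?l" using ij by simp
      with *(1) have i: "i = Suc j" by simp
      show ?thesis
      proof (cases "Suc i = ?l")
        case True
        with *(2) have "j = 0" by simp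
        with i True assms(2) show ?thesis by simp
      next
        case False
        then have "Suc i < ?l" using ij by simp
        with *(2) have "j = Suc i" by simp
        with i show ?thesis by simp
      qed
    qed
  qed (use nth ij in auto)
qed

lemma sum_cyclic_differences:
  fixes a :: "'v \<Rightarrow> 'k::ab_group_add"
  shows "(\<Sum>i<length vs. a (vs ! (Suc i mod length vs)) - a (vs ! i)) = 0"
proof (cases "length vs")
  case (Suc m)
  have "(\<Sum>i<Suc m. a (vs ! (Suc i mod Suc m))) = (\<Sum>i<m. a (vs ! Suc i)) + a (vs ! 0)"
    by simp
  also have "\<dots> = (\<Sum>i<Suc m. a (vs ! i))" by (simp only: sum.lessThan_Suc_shift add.commute)
  finally show ?thesis by (simp add: Suc sum_subtractf del: sum.lessThan_Suc)
qed simp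

section \<open>NAC-colorings induced by a valuation\<close>

context extension_field
begin

text \<open>Differences of \<open>a\<close> around a closed walk add up to 0, whereas a sum with a
  single term of least value is nonzero.\<close>

lemma no_dominant_edge:
  assumes v: "valuation_on F v" and k: "k < length vs"
    and d: "\<And>i. i < length vs \<Longrightarrow> a (vs ! (Suc i mod length vs)) - a (vs ! i) \<in> F - {0}"
    and less: "\<And>i. i < length vs \<Longrightarrow> i \<noteq> k \<Longrightarrow>
      v (a (vs ! (Suc k mod length vs)) - a (vs ! k)) < v (a (vs ! (Suc i mod length vs)) - a (vs ! i))"
  shows False
proof -
  have "(\<Sum>i<length vs. a (vs ! (Suc i mod length vs)) - a (vs ! i)) \<noteq> 0"
    by (rule val_sum_dominant[OF v, of _ k]) (use k d less in \<open>force simp: vge_def\<close>)+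
  then show False by (simp add: sum_cyclic_differences)
qed

text \<open>A single blue edge on a cycle would be the unique minimum for \<open>a\<close>, a single
  red edge the unique minimum for \<open>b\<close>, whose edge values are the negatives. There are
  two potentials because the ultrametric inequality detects minima only.\<close>

lemma threshold_NAC:
  assumes v: "valuation_on F v"
    and a: "\<And>u w. {u, w} \<in> E \<Longrightarrow> a w - a u \<in> F - {0} \<and> v (a w - a u) = h {u, w}"
    and b: "\<And>u w. {u, w} \<in> E \<Longrightarrow> b w - b u \<in> F - {0} \<and> v (b w - b u) = - h {u, w}"
    and sur: "restrict (threshold h n) E ` E = UNIV"
  shows "restrict (threshold h n) E \<in> NAC E"
proof -
  let ?\<delta> = "restrict (threshold h n) E"
  have "(\<exists>c. \<forall>e\<in>C. ?\<delta> e = c) \<or> (\<forall>c. 2 \<le> card {e\<in>C. ?\<delta> e = c})" if cyc: "C \<in> cycles E" for C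
  proof (rule disjCI, rule ccontr)
    assume neg: "\<not> (\<forall>c. 2 \<le> card {e\<in>C. ?\<delta> e = c})" and nonmono: "\<not> (\<exists>c. \<forall>e\<in>C. ?\<delta> e = c)" 
    obtain vs where vs: "C = cycle_edges vs" "distinct vs" "3 \<le> length vs" "C \<subseteq> E"
      using cyc unfolding cycles_def by blast
    let ?l = "length vs"
    let ?e = "\<lambda>i. {vs ! i, vs ! (Suc i mod ?l)}"
    have C: "C = ?e ` {..<?l}" by (auto simp: vs(1) cycle_edges_def)
    have eE: "?e i \<in> E" if "i < ?l" for i using that C vs(4) by blast
    obtain c where c: "\<not> 2 \<le> card {e\<in>C. ?\<delta> e = c}" using neg by blast
    have "finite C" by (simp add: C)
    have "{e\<in>C. ?\<delta> e = c} \<noteq> {}"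
    proof
      assume "{e\<in>C. ?\<delta> e = c} = {}"
      then have ne: "?\<delta> e \<noteq> c" if "e \<in> C" for e using that by blast
      have "x = (if c = Red then Blue else Red)" if "x \<noteq> c" for x
        using that by (cases x; cases c) simp_all
      from this[OF ne] have "\<forall>e\<in>C. ?\<delta> e = (if c = Red then Blue else Red)" by blast
      with nonmono show False by blast
    qed
    then have "card {e\<in>C. ?\<delta> e = c} \<noteq> 0" using \<open>finite C\<close> by simp
    with c have "card {e\<in>C. ?\<delta> e = c} = 1" by linarith
    then obtain e0 where e0: "{e\<in>C. ?\<delta> e = c} = {e0}" by (meson card_1_singletonE)
    then have "e0 \<in> C" "?\<delta> e0 = c" by auto
    then obtain k where k: "k < ?l" "e0 = ?e k" using C by blast
    have others: "?\<delta> (?e i) \<noteq> c" if "i < ?l" "i \<noteq> k" for i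
    proof
      assume "?\<delta> (?e i) = c"
      moreover have "?e i \<in> C" unfolding C using that(1) by blast
      ultimately have "?e i \<in> {e0}" unfolding e0[symmetric] by (intro CollectI conjI)
      then have "?e i = ?e k" unfolding k(2) by (rule singletonD)
      from inj_onD[OF cycle_edges_inj[OF vs(2,3)] this] that k show False by simp
    qed
    have col: "?\<delta> (?e i) = (if n \<le> h (?e i) then Red else Blue)" if "i < ?l" for i
      using eE[OF that] by (simp add: threshold_def)
    show False
    proof (cases c)
      case Blue
      show False
      proof (rule no_dominant_edge[OF v k(1)])
        fix i assume i: "i < ?l"
        show "a (vs ! (Suc i mod ?l)) - a (vs ! i) \<in> F - {0}" using a[OF eE[OF i]] by blast
        assume "i \<noteq> k"
        then show "v (a (vs ! (Suc k mod ?l)) - a (vs ! k)) < v (a (vs ! (Suc i mod ?l)) - a (vs ! i))"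
          using a[OF eE[OF i]] a[OF eE[OF k(1)]] others[OF i] col[OF i] col[OF k(1)]
            \<open>?\<delta> e0 = c\<close> k Blue by (auto split: if_splits)
      qed
    next
      case Red
      show False
      proof (rule no_dominant_edge[OF v k(1)])
        fix i assume i: "i < ?l"
        show "b (vs ! (Suc i mod ?l)) - b (vs ! i) \<in> F - {0}" using b[OF eE[OF i]] by blast
        assume "i \<noteq> k"
        then show "v (b (vs ! (Suc k mod ?l)) - b (vs ! k)) < v (b (vs ! (Suc i mod ?l)) - b (vs ! i))"
          using b[OF eE[OF i]] b[OF eE[OF k(1)]] others[OF i] col[OF i] col[OF k(1)]
            \<open>?\<delta> e0 = c\<close> k Red by (auto split: if_splits)
      qed
    qed
  qed
  with sur show ?thesis by (auto simp: NAC_def)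
qed

end

definition edge_order :: "('v \<Rightarrow> 'k::field) \<Rightarrow> ('k \<Rightarrow> int) \<Rightarrow> 'v set \<Rightarrow> int" where
  "edge_order a v e = (THE n. \<exists>u w. e = {u, w} \<and> n = v (a w - a u))"

lemma (in extension_field) edge_order:
  assumes v: "valuation_on F v" and a: "a w - a u \<in> F" "a w - a u \<noteq> 0"
  shows "edge_order a v {u, w} = v (a w - a u)"
  unfolding edge_order_def
proof (rule the_equality)
  fix n assume "\<exists>u' w'. {u, w} = {u', w'} \<and> n = v (a w' - a u')"
  then have "n = v (a w - a u) \<or> n = v (- (a w - a u))" by (auto simp: doubleton_eq_iff)
  then show "n = v (a w - a u)" using val_uminus[OF v a] by auto
qed blast

section \<open>Sums of gaps over the extensions of a coloring\<close>

context curve_field_extension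
begin

text \<open>At each valuation the combinatorial identity turns the gaps of all extensions into the
  gap of \<open>\<delta>'\<close>, and \<open>weighted_sum\<close> passes to the valuations of
  \<open>F'\<close>. The edge functions are differences of the vertex potentials \<open>a\<close>
  and \<open>c\<close>, so they cancel around cycles.\<close>

theorem sum_gap_extensions:
  fixes a c :: "'v \<Rightarrow> 'k" and E E' :: "'v set set"
  defines "h \<equiv> edge_order a"
  assumes E: "finite E" "E' \<subseteq> E" "\<forall>e\<in>E. card e = 2" and \<delta>': "\<delta>' \<in> NAC E'"
    and mem: "\<And>u w. {u, w} \<in> E \<Longrightarrow> a w - a u \<in> F \<and> c w - c u \<in> F"
    and mem': "\<And>u w. {u, w} \<in> E' \<Longrightarrow> a w - a u \<in> F'"
    and prod: "\<And>u w. {u, w} \<in> E \<Longrightarrow> \<exists>z. z \<noteq> 0 \<and> (a w - a u) * (c w - c u) = \<iota> z"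
  shows "(\<Sum>\<delta>\<in>{\<delta> \<in> NAC E. restrict \<delta> E' = \<delta>'}.
            \<Sum>v\<in>{v \<in> Vals F. spread E \<delta> (h v) \<noteq> 0}. spread E \<delta> (h v))
       = (\<Sum>v\<in>{v \<in> Vals F'. spread E' \<delta>' (h v) \<noteq> 0}. spread E' \<delta>' (h v)) * int n"
proof -
  have nz: "a w - a u \<noteq> 0" "c w - c u \<noteq> 0" if "{u, w} \<in> E" for u w
    using prod[OF that] by auto
  have pair: "\<exists>u w. e = {u, w}" if "e \<in> E" for e using E(3) that by (meson card_2_iff)
  have E': "finite E'" using E finite_subset by blast
  have sur: "\<delta>' ` E' = UNIV" using \<delta>' by (simp add: NAC_def)
  have h: "h v {u, w} = v (a w - a u)" if "{u, w} \<in> E" "v \<in> Vals F" for u w v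
    unfolding h_def using that mem nz ValsD(1) by (intro edge_order) auto
  have h': "h v {u, w} = v (a w - a u)" if "{u, w} \<in> E'" "v \<in> Vals F'" for u w v
    unfolding h_def using that mem' nz sub.ValsD(1) E(2) by (intro sub.edge_order) auto
  let ?D = "{\<delta> \<in> NAC E. restrict \<delta> E' = \<delta>'}"
  have ext: "(\<Sum>\<delta>\<in>?D. spread E \<delta> (h v)) = spread E' \<delta>' (h v)" if v: "v \<in> Vals F" for v
  proof (rule sum_spread_extensions[OF E(1,2) \<delta>'])
    note V = ValsD(1)[OF v]
    fix n assume s: "restrict (threshold (h v) n) E ` E = UNIV"
    show "restrict (threshold (h v) n) E \<in> NAC E"
    proof (rule threshold_NAC[OF V _ _ s, where a = a and b = c])
      fix u w assume e: "{u, w} \<in> E"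
      show "a w - a u \<in> F - {0} \<and> v (a w - a u) = h v {u, w}"
        using mem[OF e] nz[OF e] h[OF e v] by simp
      obtain z where z: "z \<noteq> 0" "(a w - a u) * (c w - c u) = \<iota> z" using prod[OF e] by blast
      have "v (a w - a u) + v (c w - c u) = 0"
        using val_mult[OF V, of "a w - a u" "c w - c u"] mem[OF e] nz[OF e] z val_iota[OF V, of z] by simp
      then show "c w - c u \<in> F - {0} \<and> v (c w - c u) = - h v {u, w}"
        using mem[OF e] nz[OF e] h[OF e v] by simp
    qed
  qed
  have spread_nonneg: "0 \<le> spread E \<delta> g" for E :: "'v set set" and \<delta> g by (simp add: spread_def)
  let ?T = "{v \<in> Vals F. spread E' \<delta>' (h v) \<noteq> 0}"
  have fin': "finite {v \<in> Vals F'. spread E' \<delta>' (h v) \<noteq> 0}"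
  proof -
    \<comment> \<open>A nonzero gap puts a blue edge strictly below a red one, so the quotient of
      their edge functions has a pole. There are finitely many such quotients, and each nonconstant
      one has finitely many poles.\<close>
    define Q where "Q = {(a w - a u) / (a y - a x) |u w x y. {u, w} \<in> E' \<and> {x, y} \<in> E'} - range \<iota>"
    have finV: "finite (\<Union>E')" using E' E(2,3) by (intro finite_Union) (auto intro!: card_ge_0_finite)
    have "Q \<subseteq> (\<lambda>(u, w, x, y). (a w - a u) / (a y - a x)) ` (\<Union>E' \<times> \<Union>E' \<times> \<Union>E' \<times> \<Union>E')"
      unfolding Q_def by (auto simp: image_iff Bex_def) blast
    then have "finite Q" using finV by (meson finite_SigmaI finite_imageI finite_subset)
    moreover have "finite {v \<in> Vals F'. v q < 0}" if q: "q \<in> Q" for q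
    proof (rule sub.finite_poles)
      show "q \<notin> range \<iota>" using q by (simp add: Q_def)
      show "q \<in> F'" using q mem' unfolding Q_def by (auto intro!: sub.divide_mem)
    qed
    ultimately have "finite (\<Union>q\<in>Q. {v \<in> Vals F'. v q < 0})" by blast
    moreover have "{v \<in> Vals F'. spread E' \<delta>' (h v) \<noteq> 0} \<subseteq> (\<Union>q\<in>Q. {v \<in> Vals F'. v q < 0})"
    proof
      fix v assume v: "v \<in> {v \<in> Vals F'. spread E' \<delta>' (h v) \<noteq> 0}"
      have V: "valuation_on F' v" using v sub.ValsD(1) by blast
      have "{n. \<forall>e\<in>E'. \<delta>' e = threshold (h v) n e} \<noteq> {}"
      proof
        assume "{n. \<forall>e\<in>E'. \<delta>' e = threshold (h v) n e} = {}"
        then have "spread E' \<delta>' (h v) = 0" unfolding spread_eq_card[OF E' sur] by (simp only: card.empty of_nat_0)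
        with v show False by simp
      qed
      then obtain n where n: "\<And>e. e \<in> E' \<Longrightarrow> \<delta>' e = threshold (h v) n e" by blast
      obtain e f where ef: "e \<in> E'" "\<delta>' e = Red" "f \<in> E'" "\<delta>' f = Blue"
        using sur unfolding color_image_UNIV by blast
      then have lt: "h v f < h v e" using n[of e] n[of f] by (auto simp: threshold_def split: if_splits)
      obtain x y where e: "e = {x, y}" using pair ef E(2) by blast
      obtain u w where f: "f = {u, w}" using pair ef E(2) by blast
      let ?q = "(a w - a u) / (a y - a x)"
      have nzq: "a w - a u \<noteq> 0" "a y - a x \<noteq> 0" using nz e f ef E(2) by blast+
      have "v ?q = h v f - h v e"
        using h'[of x y v] h'[of u w v] e f ef v mem' nzq
        by (subst sub.val_divide[OF V]) auto
      then have neg: "v ?q < 0" using lt by simp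
      then have "?q \<notin> range \<iota>" using sub.valuation_not_iota[OF V, of ?q] nzq by auto
      then have "?q \<in> Q" using e f ef unfolding Q_def by blast
      with neg v show "v \<in> (\<Union>q\<in>Q. {v \<in> Vals F'. v q < 0})" by blast
    qed
    ultimately show ?thesis by (rule rev_finite_subset)
  qed
  have ws: "finite ?T" "(\<Sum>v\<in>?T. spread E' \<delta>' (h v)) =
      (\<Sum>v\<in>{v \<in> Vals F'. spread E' \<delta>' (h v) \<noteq> 0}. spread E' \<delta>' (h v)) * int n"
  proof (rule weighted_sum[OF fin'], rule_tac[3] weighted_sum[OF fin'])
    show nt: "spread E' \<delta>' (h v) = int (ram v) * spread E' \<delta>' (h (rest v))"
      if v: "v \<in> Vals F" "nontrivial v" for v
    proof (rule spread_scale[OF E' sur rest(1)[OF v]])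
      fix e assume e: "e \<in> E'"
      then obtain u w where uw: "e = {u, w}" using pair E(2) by blast
      then have "h v e = v (a w - a u)" "h (rest v) e = rest v (a w - a u)"
        using e h[of u w v] h'[of u w "rest v"] v rest(2)[OF v] E(2) by auto
      then show "h v e = int (ram v) * h (rest v) e"
        using rest(3)[OF v, of "a w - a u"] mem'[of u w] nz[of u w] e uw E(2) by auto
    qed
    then show "spread E' \<delta>' (h v) = int (ram v) * spread E' \<delta>' (h (rest v))"
      if "v \<in> Vals F" "nontrivial v" for v using that .
    show triv: "spread E' \<delta>' (h v) = 0" if v: "v \<in> Vals F" "\<not> nontrivial v" for v
    proof -
      have h0: "h v e = 0" if e: "e \<in> E'" for e
      proof -
        obtain u w where uw: "e = {u, w}" using pair E(2) e by blast
        then have uwE: "{u, w} \<in> E'" "{u, w} \<in> E" using e E(2) by auto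
        have "v (a w - a u) = 0"
          using v(2) mem'[OF uwE(1)] nz(1)[OF uwE(2)] unfolding nontrivial_def by blast
        then show ?thesis using h[OF uwE(2) v(1)] uw by simp
      qed
      have "{e\<in>E'. \<delta>' e = Red} \<noteq> {}" "{e\<in>E'. \<delta>' e = Blue} \<noteq> {}"
        using sur unfolding color_image_UNIV by simp_all
      then have "h v ` {e\<in>E'. \<delta>' e = Red} = {0}" "h v ` {e\<in>E'. \<delta>' e = Blue} = {0}"
        using h0 by force+
      then show ?thesis by (simp add: spread_def)
    qed
    then show "spread E' \<delta>' (h v) = 0" if "v \<in> Vals F" "\<not> nontrivial v" for v using that .
  qed
  \<comment> \<open>Gaps are nonnegative, so the gap of one extension is at most the gap of
    \<open>\<delta>'\<close>. All supports therefore lie in the finite set \<open>?T\<close>, and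
    the two sums can be interchanged.\<close>
  have "(\<Sum>v\<in>{v \<in> Vals F. spread E \<delta> (h v) \<noteq> 0}. spread E \<delta> (h v)) = (\<Sum>v\<in>?T. spread E \<delta> (h v))"
    if \<delta>: "\<delta> \<in> ?D" for \<delta>
  proof (rule sum.mono_neutral_left[OF ws(1)])
    show "{v \<in> Vals F. spread E \<delta> (h v) \<noteq> 0} \<subseteq> ?T"
    proof
      fix v assume v: "v \<in> {v \<in> Vals F. spread E \<delta> (h v) \<noteq> 0}"
      have "spread E \<delta> (h v) \<le> (\<Sum>\<delta>\<in>?D. spread E \<delta> (h v))"
        using \<delta> finite_NAC[OF E(1)] by (intro member_le_sum) (auto simp: spread_nonneg)
      with v ext[of v] spread_nonneg[of E \<delta> "h v"] show "v \<in> ?T" by auto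
    qed
  qed auto
  then have "(\<Sum>\<delta>\<in>?D. \<Sum>v\<in>{v \<in> Vals F. spread E \<delta> (h v) \<noteq> 0}. spread E \<delta> (h v)) =
      (\<Sum>\<delta>\<in>?D. \<Sum>v\<in>?T. spread E \<delta> (h v))" by (rule sum.cong[OF refl])
  also have "\<dots> = (\<Sum>v\<in>?T. \<Sum>\<delta>\<in>?D. spread E \<delta> (h v))" by (rule sum.swap)
  also have "\<dots> = (\<Sum>v\<in>?T. spread E' \<delta>' (h v))" using ext by (intro sum.cong) auto
  finally show ?thesis using ws(2) by simp
qed

end

section \<open>An ultrapower of the complex numbers\<close>

text \<open>A maximal family with the finite intersection property. A set outside it misses some
  finite intersection of members, which cannot happen to both \<open>S\<close> and
  \<open>- S\<close>. Closure under intersections and supersets follows from the properties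
  listed.\<close>

lemma ultrafilter_exists:
  fixes B :: "'i set set"
  assumes B: "\<And>Y. finite Y \<Longrightarrow> Y \<subseteq> B \<Longrightarrow> \<Inter>Y \<noteq> {}"
  shows "\<exists>U. B \<subseteq> U \<and> (\<forall>Y. finite Y \<longrightarrow> Y \<subseteq> U \<longrightarrow> \<Inter>Y \<noteq> {}) \<and> (\<forall>S. S \<in> U \<or> - S \<in> U)"
proof -
  define fip where "fip M \<longleftrightarrow> (\<forall>Y. finite Y \<longrightarrow> Y \<subseteq> M \<longrightarrow> \<Inter>Y \<noteq> {})" for M :: "'i set set"
  define A where "A = {M. B \<subseteq> M \<and> fip M}"
  have "B \<in> A" using B by (auto simp: A_def fip_def)
  then have "A \<noteq> {}" by blast
  have "\<exists>M\<in>A. \<forall>Y\<in>A. M \<subseteq> Y \<longrightarrow> Y = M"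
  proof (rule subset_Zorn_nonempty[OF \<open>A \<noteq> {}\<close>])
    fix Ch assume ne: "Ch \<noteq> {}" and ch: "subset.chain A Ch"
    have CA: "Y \<in> A" if "Y \<in> Ch" for Y using ch that by (auto simp: subset_chain_def)
    have "fip (\<Union>Ch)"
      unfolding fip_def
    proof (intro allI impI)
      fix Y assume Y: "finite Y" "Y \<subseteq> \<Union>Ch"
      obtain M where "M \<in> Ch" "Y \<subseteq> M"
        using finite_subset_Union_chain[OF Y ne ch] by blast
      with CA[of M] Y show "\<Inter>Y \<noteq> {}" by (auto simp: A_def fip_def)
    qed
    moreover have "B \<subseteq> \<Union>Ch" using CA ne by (auto simp: A_def)
    ultimately show "\<Union>Ch \<in> A" by (simp add: A_def)
  qed
  then obtain M where M: "M \<in> A" and max: "\<And>Y. Y \<in> A \<Longrightarrow> M \<subseteq> Y \<Longrightarrow> Y = M" by blast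
  have fM: "fip M" and BM: "B \<subseteq> M" using M by (auto simp: A_def)
  have witness: "\<exists>Y. finite Y \<and> Y \<subseteq> M \<and> \<Inter>Y \<inter> S = {}" if S: "S \<notin> M" for S
  proof -
    have "insert S M \<notin> A" using max[of "insert S M"] S by blast
    then have "\<not> fip (insert S M)" using BM by (auto simp: A_def)
    then obtain Y where Y: "finite Y" "Y \<subseteq> insert S M" "\<Inter>Y = {}" unfolding fip_def by blast
    have "\<Inter>(Y - {S}) \<inter> S = {}" using Y(3) by blast
    moreover have "finite (Y - {S})" "Y - {S} \<subseteq> M" using Y by auto
    ultimately show ?thesis by blast
  qed
  have "S \<in> M \<or> - S \<in> M" for S
  proof (rule ccontr)
    assume "\<not> ?thesis"
    then obtain Y Z where "finite Y" "Y \<subseteq> M" "\<Inter>Y \<inter> S = {}" "finite Z" "Z \<subseteq> M" "\<Inter>Z \<inter> - S = {}"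
      using witness[of S] witness[of "- S"] by blast
    then have "finite (Y \<union> Z)" "Y \<union> Z \<subseteq> M" "\<Inter>(Y \<union> Z) = {}" by (simp, simp, blast)
    with fM show False unfolding fip_def by blast
  qed
  with fM BM show ?thesis unfolding fip_def by blast
qed

text \<open>The prescribed members say that almost every index \<open>j\<close> is finite and
  contains any given \<open>p\<close>: the indices act as ever larger finite lists of
  requirements.\<close>

definition large_sets :: "'b set set set" where
  "large_sets = (SOME U. range (\<lambda>p. {j. finite j \<and> p \<in> j}) \<subseteq> U \<and>
     (\<forall>Y. finite Y \<longrightarrow> Y \<subseteq> U \<longrightarrow> \<Inter>Y \<noteq> {}) \<and> (\<forall>S. S \<in> U \<or> - S \<in> U))"

lemma large_sets:
  fixes p :: 'b and Y :: "'b set set set" and S :: "'b set set"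
  shows large_member: "{j. finite j \<and> p \<in> j} \<in> large_sets"
    and large_fip: "finite Y \<Longrightarrow> Y \<subseteq> large_sets \<Longrightarrow> \<Inter>Y \<noteq> {}"
    and large_ultra: "S \<in> large_sets \<or> - S \<in> large_sets"
proof -
  let ?B = "range (\<lambda>p::'b. {j. finite j \<and> p \<in> j})" and ?U = "large_sets :: 'b set set set"
  have "\<Inter>Y \<noteq> {}" if Y: "finite Y" "Y \<subseteq> ?B" for Y
  proof -
    obtain P where P: "finite P" "Y = (\<lambda>p. {j. finite j \<and> p \<in> j}) ` P"
      using finite_subset_image[OF Y] by blast
    then have "P \<in> \<Inter>Y" by auto
    then show ?thesis by blast
  qed
  then have "\<exists>U. ?B \<subseteq> U \<and> (\<forall>Y. finite Y \<longrightarrow> Y \<subseteq> U \<longrightarrow> \<Inter>Y \<noteq> {}) \<and> (\<forall>S. S \<in> U \<or> - S \<in> U)"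
    by (intro ultrafilter_exists)
  from someI_ex[OF this]
  have *: "?B \<subseteq> ?U \<and> (\<forall>Y. finite Y \<longrightarrow> Y \<subseteq> ?U \<longrightarrow> \<Inter>Y \<noteq> {}) \<and> (\<forall>S. S \<in> ?U \<or> - S \<in> ?U)"
    unfolding large_sets_def .
  show "{j. finite j \<and> p \<in> j} \<in> ?U" by (rule subsetD[OF conjunct1[OF *]]) (rule rangeI)
  show "finite Y \<Longrightarrow> Y \<subseteq> ?U \<Longrightarrow> \<Inter>Y \<noteq> {}"
    by (rule conjunct2[OF *, THEN conjunct1, rule_format])
  show "S \<in> ?U \<or> - S \<in> ?U" by (rule conjunct2[OF *, THEN conjunct2, rule_format])
qed

lemma large_Int:
  assumes "S \<in> large_sets" "T \<in> large_sets"
  shows "S \<inter> T \<in> large_sets"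
proof (rule ccontr)
  assume "S \<inter> T \<notin> large_sets"
  then have "{S, T, - (S \<inter> T)} \<subseteq> large_sets" using assms large_ultra by blast
  from large_fip[OF _ this] show False by auto
qed

lemma large_mono:
  assumes "S \<in> large_sets" "S \<subseteq> T"
  shows "T \<in> large_sets"
proof (rule ccontr)
  assume "T \<notin> large_sets"
  then have "{S, - T} \<subseteq> large_sets" using assms large_ultra by blast
  from large_fip[OF _ this] show False using assms(2) by auto
qed

lemma large_empty: "{} \<notin> large_sets"
  using large_fip[of "{{}}"] by auto

lemma large_UNIV: "UNIV \<in> large_sets"
  using large_ultra[of UNIV] large_empty by auto

definition almost_eq :: "('b set \<Rightarrow> complex) \<Rightarrow> ('b set \<Rightarrow> complex) \<Rightarrow> bool" where
  "almost_eq f g \<longleftrightarrow> {j. f j = g j} \<in> large_sets"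

lemma almost_eq_lift1:
  assumes "almost_eq f g" "\<And>j. f j = g j \<Longrightarrow> f' j = g' j"
  shows "almost_eq f' g'"
  using assms large_mono[of "{j. f j = g j}" "{j. f' j = g' j}"] unfolding almost_eq_def by blast

lemma almost_eq_lift2:
  assumes "almost_eq f g" "almost_eq f' g'" "\<And>j. f j = g j \<Longrightarrow> f' j = g' j \<Longrightarrow> h j = k j"
  shows "almost_eq h k"
proof -
  have "{j. f j = g j} \<inter> {j. f' j = g' j} \<in> large_sets"
    using assms large_Int unfolding almost_eq_def by blast
  then show ?thesis unfolding almost_eq_def by (rule large_mono) (use assms(3) in auto)
qed

lemma almost_eq_equivp: "equivp almost_eq"
proof (rule equivpI)
  show "reflp almost_eq" by (rule reflpI) (simp add: almost_eq_def large_UNIV)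
  show "symp almost_eq" by (rule sympI) (simp add: almost_eq_def eq_commute)
  show "transp almost_eq" by (rule transpI) (erule almost_eq_lift2, assumption, simp)
qed

text \<open>The index type is such that every irreducible variety has a family of points at which any given
  nonzero regular function almost never vanishes; this makes every function field a subfield of the
  ultrapower.\<close>

quotient_type 'b ultracomplex = "'b set \<Rightarrow> complex" / almost_eq
  by (rule almost_eq_equivp)

instantiation ultracomplex :: (type) field
begin

lift_definition zero_ultracomplex :: "'a ultracomplex" is "\<lambda>j. 0" .
lift_definition one_ultracomplex :: "'a ultracomplex" is "\<lambda>j. 1" .
lift_definition plus_ultracomplex :: "'a ultracomplex \<Rightarrow> 'a ultracomplex \<Rightarrow> 'a ultracomplex"
  is "\<lambda>f g j. f j + g j" by (erule almost_eq_lift2, assumption) simp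
lift_definition times_ultracomplex :: "'a ultracomplex \<Rightarrow> 'a ultracomplex \<Rightarrow> 'a ultracomplex"
  is "\<lambda>f g j. f j * g j" by (erule almost_eq_lift2, assumption) simp
lift_definition minus_ultracomplex :: "'a ultracomplex \<Rightarrow> 'a ultracomplex \<Rightarrow> 'a ultracomplex"
  is "\<lambda>f g j. f j - g j" by (erule almost_eq_lift2, assumption) simp
lift_definition divide_ultracomplex :: "'a ultracomplex \<Rightarrow> 'a ultracomplex \<Rightarrow> 'a ultracomplex"
  is "\<lambda>f g j. f j / g j" by (erule almost_eq_lift2, assumption) simp
lift_definition uminus_ultracomplex :: "'a ultracomplex \<Rightarrow> 'a ultracomplex"
  is "\<lambda>f j. - f j" by (erule almost_eq_lift1) simp
lift_definition inverse_ultracomplex :: "'a ultracomplex \<Rightarrow> 'a ultracomplex"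
  is "\<lambda>f j. inverse (f j)" by (erule almost_eq_lift1) simp

instance
proof
  fix a b c :: "'a ultracomplex"
  show "a + b + c = a + (b + c)" by transfer (simp add: almost_eq_def large_UNIV add.assoc)
  show "a + b = b + a" by transfer (simp add: almost_eq_def large_UNIV add.commute)
  show "0 + a = a" by transfer (simp add: almost_eq_def large_UNIV)
  show "- a + a = 0" by transfer (simp add: almost_eq_def large_UNIV)
  show "a - b = a + - b" by transfer (simp add: almost_eq_def large_UNIV)
  show "a * b * c = a * (b * c)" by transfer (simp add: almost_eq_def large_UNIV mult.assoc)
  show "a * b = b * a" by transfer (simp add: almost_eq_def large_UNIV mult.commute)
  show "1 * a = a" by transfer (simp add: almost_eq_def large_UNIV)
  show "(a + b) * c = a * c + b * c" by transfer (simp add: almost_eq_def large_UNIV distrib_right)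
  show "0 \<noteq> (1 :: 'a ultracomplex)" by transfer (simp add: almost_eq_def large_empty)
  show "a div b = a * inverse b" by transfer (simp add: almost_eq_def large_UNIV divide_inverse)
  show "inverse (0 :: 'a ultracomplex) = 0" by transfer (simp add: almost_eq_def large_UNIV)
  show "inverse a * a = 1" if "a \<noteq> 0"
    using that
  proof transfer
    fix f :: "'a set \<Rightarrow> complex" assume "\<not> almost_eq f (\<lambda>j. 0)"
    then have "- {j. f j = 0} \<in> large_sets" using large_ultra unfolding almost_eq_def by blast
    then show "almost_eq (\<lambda>j. inverse (f j) * f j) (\<lambda>j. 1)"
      unfolding almost_eq_def by (rule large_mono) auto
  qed
qed

end

lift_definition ultra_const :: "complex \<Rightarrow> 'b ultracomplex" is "\<lambda>c j. c" .

lemma ultra_const: "complex_subfield ultra_const"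
proof
  show "ultra_const 1 = 1" by transfer (simp add: almost_eq_def large_UNIV)
  show "ultra_const (a + b) = ultra_const a + ultra_const b" for a b
    by transfer (simp add: almost_eq_def large_UNIV)
  show "ultra_const (a * b) = ultra_const a * ultra_const b" for a b
    by transfer (simp add: almost_eq_def large_UNIV)
qed

section \<open>Finite extensions inside a field type\<close>

text \<open>The record form of a field type. Algebraicity, finite extensions and dimensions are
  stated for records, as are the function fields of the definitions.\<close>

definition type_field :: "'k::field ring" where
  "type_field = \<lparr>carrier = UNIV, monoid.mult = (*), one = 1, ring.zero = 0, add = (+)\<rparr>"

lemma type_field_simps [simp]:
  "carrier type_field = UNIV" "a \<otimes>\<^bsub>type_field\<^esub> b = a * b" "a \<oplus>\<^bsub>type_field\<^esub> b = a + b"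
  "\<one>\<^bsub>type_field\<^esub> = 1" "\<zero>\<^bsub>type_field\<^esub> = 0"
  by (simp_all add: type_field_def)

lemma field_type_field: "field (type_field :: 'k::field ring)"
proof -
  have "\<exists>y. y + x = 0" for x :: 'k using left_minus by blast
  then have "abelian_group (type_field :: 'k ring)"
    by (intro abelian_groupI) (auto simp: algebra_simps)
  moreover have "comm_monoid (type_field :: 'k ring)"
    by (intro comm_monoidI) (auto simp: algebra_simps)
  ultimately interpret cring "type_field :: 'k ring"
    by (intro cringI) (auto simp: algebra_simps)
  have "\<exists>y. y * x = 1 \<and> x * y = 1" if "x \<noteq> 0" for x :: 'k
    using that by (intro exI[of _ "inverse x"]) auto
  then have "Units (type_field :: 'k ring) = carrier type_field - {\<zero>\<^bsub>type_field\<^esub>}"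
    by (auto simp: Units_def)
  then show ?thesis by (rule cring_fieldI)
qed

lemma type_field_uminus [simp]: "\<ominus>\<^bsub>type_field\<^esub> (a :: 'k::field) = - a"
proof -
  interpret field "type_field :: 'k ring" by (rule field_type_field)
  show ?thesis by (rule minus_equality) auto
qed

lemma type_field_inverse [simp]: "a \<noteq> 0 \<Longrightarrow> inv\<^bsub>type_field\<^esub> (a :: 'k::field) = inverse a"
proof -
  assume a: "a \<noteq> 0"
  interpret field "type_field :: 'k ring" by (rule field_type_field)
  show ?thesis using a inv_unique'[of a "inverse a"] by auto
qed

lemma type_field_power [simp]: "(a :: 'k::field) [^]\<^bsub>type_field\<^esub> (n::nat) = a ^ n"
proof -
  interpret field "type_field :: 'k ring" by (rule field_type_field)
  show ?thesis by (induction n) (auto simp: nat_pow_Suc mult.commute)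
qed

lemma type_field_eval:
  "ring.eval type_field p (x :: 'k::field) = (\<Sum>i<length p. rev p ! i * x ^ i)"
proof -
  interpret field "type_field :: 'k ring" by (rule field_type_field)
  show ?thesis by (induction p) (auto simp: nth_append intro!: sum.cong)
qed

lemma type_field_combine:
  "length Ks = length Us \<Longrightarrow>
    ring.combine type_field Ks (Us :: 'k::field list) = (\<Sum>i<length Us. Ks ! i * Us ! i)"
proof -
  interpret field "type_field :: 'k ring" by (rule field_type_field)
  show "length Ks = length Us \<Longrightarrow> combine Ks Us = (\<Sum>i<length Us. Ks ! i * Us ! i)"
  proof (induction Us arbitrary: Ks)
    case (Cons u Us)
    then obtain k Ks' where "Ks = k # Ks'" by (cases Ks) auto
    with Cons show ?case by (simp add: sum.lessThan_Suc_shift del: sum.lessThan_Suc)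
  qed simp
qed

lemma algebraic_type_fieldI:
  fixes k :: "nat \<Rightarrow> 'k::field"
  assumes K: "\<And>i. i < m \<Longrightarrow> k i \<in> K" and nz: "\<exists>i<m. k i \<noteq> 0" and z: "(\<Sum>i<m. k i * x ^ i) = 0"
  shows "ring.algebraic type_field K x"
proof -
  interpret field "type_field :: 'k ring" by (rule field_type_field)
  \<comment> \<open>A coefficient list must begin with a nonzero leading coefficient, so the sum is
    cut at its highest nonzero index.\<close>
  define d where "d = Max {i. i < m \<and> k i \<noteq> 0}"
  have "d \<in> {i. i < m \<and> k i \<noteq> 0}" unfolding d_def using nz by (intro Max_in) auto
  then have d: "d < m" "k d \<noteq> 0" by auto
  have above: "k i = 0" if "i < m" "d < i" for i
    using that Max_ge[of "{i. i < m \<and> k i \<noteq> 0}" i] by (fastforce simp: d_def)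
  let ?p = "rev (map k [0..<Suc d])"
  have "(\<Sum>i<Suc d. k i * x ^ i) = (\<Sum>i<m. k i * x ^ i)"
    using d above by (intro sum.mono_neutral_left) auto
  then have "eval ?p x = 0"
    unfolding type_field_eval rev_rev_ident using z
    by (simp del: upt_Suc sum.lessThan_Suc)
  moreover have "?p \<in> carrier (univ_poly type_field K)"
    using K d by (auto simp: univ_poly_def polynomial_def)
  ultimately have "(algebraic over K) x" by (intro algebraicI[of ?p]) auto
  then show ?thesis by (simp add: over_def)
qed

lemma algebraic_type_fieldE:
  fixes x :: "'k::field"
  assumes "subring K type_field" "ring.algebraic type_field K x"
  shows "\<exists>k (m::nat). (\<forall>i<m. k i \<in> K) \<and> (\<exists>i<m. k i \<noteq> 0) \<and> (\<Sum>i<m. k i * x ^ i) = 0"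
proof -
  interpret field "type_field :: 'k ring" by (rule field_type_field)
  obtain p where p: "p \<in> carrier (univ_poly type_field K)" "p \<noteq> []" "eval p x = 0"
    using algebraicE[OF assms(1), of x] assms(2) by (auto simp: over_def)
  then have "set p \<subseteq> K" "hd p \<noteq> 0" by (auto simp: univ_poly_def polynomial_def)
  show ?thesis
  proof (rule exI[of _ "\<lambda>i. rev p ! i"], rule exI[of _ "length p"], intro conjI allI impI)
    show "rev p ! i \<in> K" if "i < length p" for i
      using that \<open>set p \<subseteq> K\<close> by (metis length_rev nth_mem set_rev subsetD)
    show "\<exists>i<length p. rev p ! i \<noteq> 0"
      using p(2) \<open>hd p \<noteq> 0\<close> by (intro exI[of _ "length p - 1"]) (auto simp: rev_nth hd_conv_nth)
    show "(\<Sum>i<length p. rev p ! i * x ^ i) = 0" using p(3) by (simp add: type_field_eval)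
  qed
qed

context extension_field
begin

lemma subfield_F: "subfield F type_field"
proof -
  interpret field "type_field :: 'k ring" by (rule field_type_field)
  have "subring F type_field"
    by (rule subringI) auto
  then show ?thesis
    by (rule subfieldI') auto
qed

end

section \<open>The field generated by one function over the constants\<close>

context complex_subfield
begin

definition adjoin :: "'k \<Rightarrow> 'k set" where
  "adjoin x = generate_field type_field (insert x (range \<iota>))"

lemma subfield_adjoin: "subfield (adjoin x) type_field"
  unfolding adjoin_def using field.generate_field_is_subfield[OF field_type_field] by simp

lemma adjoin_ev: "ev p x \<in> adjoin x"
proof (induction p)
  case 0
  then show ?case using field.zero_in_generate[OF field_type_field] by (simp add: adjoin_def)
next
  case (pCons a p)
  have x: "x \<in> adjoin x" and a: "\<iota> a \<in> adjoin x" by (auto simp: adjoin_def intro: generate_field.incl)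
  have "x * ev p x \<in> adjoin x"
    using generate_field.eng_mult[OF x[unfolded adjoin_def] pCons(2)[unfolded adjoin_def]]
    by (simp add: adjoin_def)
  from generate_field.eng_add[OF a[unfolded adjoin_def] this[unfolded adjoin_def]]
  show ?case by (simp add: adjoin_def)
qed

lemma adjoin_fraction:
  assumes "k \<in> adjoin x"
  shows "\<exists>p q. ev q x \<noteq> 0 \<and> k = ev p x / ev q x"
  using assms unfolding adjoin_def
proof (induction rule: generate_field.induct)
  case one
  show ?case by (intro exI[of _ 1]) auto
next
  case (incl h)
  then consider "h = x" | c where "h = \<iota> c" by blast
  then show ?case
  proof cases
    case 1
    then show ?thesis by (intro exI[of _ "[:0, 1:]"] exI[of _ 1]) auto
  next
    case 2
    then show ?thesis by (intro exI[of _ "[:c:]"] exI[of _ 1]) auto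
  qed
next
  case (a_inv h)
  then obtain p q where "ev q x \<noteq> 0" "h = ev p x / ev q x" by blast
  then show ?case by (intro exI[of _ "- p"] exI[of _ q]) (auto simp: ev_minus)
next
  case (m_inv h)
  then obtain p q where "ev q x \<noteq> 0" "h = ev p x / ev q x" by blast
  with m_inv show ?case by (intro exI[of _ q] exI[of _ p]) auto
next
  case (eng_add h1 h2)
  then obtain p q r s where "ev q x \<noteq> 0" "h1 = ev p x / ev q x" "ev s x \<noteq> 0" "h2 = ev r x / ev s x"
    by blast
  then show ?case
    by (intro exI[of _ "p * s + r * q"] exI[of _ "q * s"]) (auto simp: ev_add ev_mult add_frac_eq)
next
  case (eng_mult h1 h2)
  then obtain p q r s where "ev q x \<noteq> 0" "h1 = ev p x / ev q x" "ev s x \<noteq> 0" "h2 = ev r x / ev s x"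
    by blast
  then show ?case by (intro exI[of _ "p * r"] exI[of _ "q * s"]) (auto simp: ev_mult)
qed

lemma common_denominator:
  fixes k :: "nat \<Rightarrow> 'k"
  assumes "\<And>i. i < m \<Longrightarrow> k i \<in> adjoin x"
  shows "\<exists>p d. ev d x \<noteq> 0 \<and> (\<forall>i<m. ev (p i) x = ev d x * k i)"
  using assms
proof (induction m)
  case 0
  show ?case by (intro exI[of _ 1] exI[of _ "\<lambda>_. 0"]) auto
next
  case (Suc m)
  then obtain p d where pd: "ev d x \<noteq> 0" "\<forall>i<m. ev (p i) x = ev d x * k i" by auto
  obtain a b where ab: "ev b x \<noteq> 0" "k m = ev a x / ev b x" using adjoin_fraction[of "k m"] Suc by blast
  show ?case
    using pd ab by (intro exI[of _ "\<lambda>i. if i = m then a * d else p i * b"] exI[of _ "d * b"])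
      (auto simp: ev_mult less_Suc_eq)
qed

text \<open>Steinitz exchange for one element: after clearing denominators the relation is a
  polynomial in both \<open>t\<close> and \<open>x\<close>, and is reordered by powers of
  \<open>t\<close>. Its coefficients in C[x] do not all vanish because \<open>x\<close> is
  transcendental.\<close>

lemma exchange:
  assumes x: "x \<notin> range \<iota>" and alg: "ring.algebraic type_field (adjoin t) x"
  shows "ring.algebraic type_field (adjoin x) t"
proof -
  obtain k and m :: nat where k: "\<forall>i<m. k i \<in> adjoin t" "\<exists>i<m. k i \<noteq> 0"
    "(\<Sum>i<m. k i * x ^ i) = 0"
    using algebraic_type_fieldE[OF subfieldE(1)[OF subfield_adjoin] alg] by blast
  obtain p d where pd: "ev d t \<noteq> 0" "\<forall>i<m. ev (p i) t = ev d t * k i"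
    using common_denominator[of m k t] k(1) by blast
  have "(\<Sum>i<m. ev (p i) t * x ^ i) = ev d t * (\<Sum>i<m. k i * x ^ i)"
    using pd by (simp add: sum_distrib_left mult.assoc)
  then have rel: "(\<Sum>i<m. ev (p i) t * x ^ i) = 0" using k(3) by simp
  obtain i0 where i0: "i0 < m" "p i0 \<noteq> 0" using k(2) pd by fastforce
  \<comment> \<open>A common strict bound for all degrees, so that both orders of summation run over
    the same rectangle.\<close>
  define D where "D = Suc (\<Sum>i<m. Polynomial.degree (p i))"
  have deg: "Polynomial.degree (p i) < D" if "i < m" for i
    unfolding D_def using that member_le_sum[of i "{..<m}" "\<lambda>i. Polynomial.degree (p i)"] by simp
  have ev_D: "ev (p i) t = (\<Sum>j<D. \<iota> (Polynomial.coeff (p i) j) * t ^ j)" if "i < m" for i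
    unfolding ev_altdef using deg[OF that]
    by (intro sum.mono_neutral_left) (auto simp: coeff_eq_0)
  define q where "q j = (\<Sum>i<m. Polynomial.monom (Polynomial.coeff (p i) j) i)" for j
  have "(\<Sum>j<D. ev (q j) x * t ^ j) = (\<Sum>j<D. \<Sum>i<m. \<iota> (Polynomial.coeff (p i) j) * t ^ j * x ^ i)"
    by (simp add: q_def ev_sum ev_monom sum_distrib_left sum_distrib_right ac_simps)
  also have "\<dots> = (\<Sum>i<m. \<Sum>j<D. \<iota> (Polynomial.coeff (p i) j) * t ^ j * x ^ i)" by (rule sum.swap)
  also have "\<dots> = (\<Sum>i<m. ev (p i) t * x ^ i)" by (simp add: ev_D sum_distrib_right)
  finally have "(\<Sum>j<D. ev (q j) x * t ^ j) = 0" using rel by simp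
  moreover have "\<exists>j<D. ev (q j) x \<noteq> 0"
  proof (intro exI conjI)
    let ?j = "Polynomial.degree (p i0)"
    show "?j < D" by (rule deg[OF i0(1)])
    have "Polynomial.coeff (q ?j) i0 = Polynomial.coeff (p i0) ?j"
      using i0(1) by (simp add: q_def coeff_sum)
    then have "q ?j \<noteq> 0" using i0(2) by auto
    then show "ev (q ?j) x \<noteq> 0" by (rule ev_nonzero[OF x])
  qed
  ultimately show ?thesis using adjoin_ev by (intro algebraic_type_fieldI[of D "\<lambda>j. ev (q j) x"])
qed

end

context extension_field
begin

lemma subalgebra_F: "K \<subseteq> F \<Longrightarrow> subalgebra K F type_field"
  using subring.axioms(1)[OF subfieldE(1)[OF subfield_F]]
  by (auto simp: subalgebra_def subalgebra_axioms_def)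

lemma adjoin_subset: "x \<in> F \<Longrightarrow> adjoin x \<subseteq> F"
  unfolding adjoin_def
  using field.generate_field_min_subfield1[OF field_type_field, of "insert x (range \<iota>)" F] subfield_F
  by auto

text \<open>A tower of two finite extensions over C(x) reaches \<open>F\<close>: \<open>t\<close> is
  algebraic over C(x) by \<open>exchange\<close>, and the generators \<open>gs\<close> are algebraic
  over C(t). Generation is expressed through the subfields that contain \<open>gs\<close> and the
  constants.\<close>

lemma finite_dimension_over_adjoin:
  assumes t: "t \<in> F" "\<And>z. z \<in> F \<Longrightarrow> ring.algebraic type_field (adjoin t) z"
    and gs: "set gs \<subseteq> F" "\<And>L. subfield L type_field \<Longrightarrow> range \<iota> \<subseteq> L \<Longrightarrow> set gs \<subseteq> L \<Longrightarrow> F \<subseteq> L"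
    and x: "x \<in> F" "x \<notin> range \<iota>"
  shows "ring.finite_dimension type_field (adjoin x) F"
proof -
  interpret K: field "type_field :: 'k ring" by (rule field_type_field)
  note sx = subfield_adjoin[of x]
  have t_alg: "(K.algebraic over adjoin x) t" using exchange[OF x(2) t(2)[OF x(1)]] by (simp add: over_def)
  define L where "L = K.finite_extension (adjoin x) [t]"
  have L: "subfield L type_field" "K.finite_dimension (adjoin x) L"
    unfolding L_def using t_alg
    by (intro K.finite_extension_is_subfield[OF sx] K.finite_extension_finite_dimension(1)[OF sx]; simp)+
  have xL: "adjoin x \<subseteq> L" unfolding L_def by (rule K.finite_extension_incl) auto
  have tL: "t \<in> L" using K.finite_extension_mem[OF subfieldE(1)[OF sx], of "[t]"] by (simp add: L_def)
  have iL: "range \<iota> \<subseteq> L" using xL by (auto simp: adjoin_def intro: generate_field.incl)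
  have "adjoin t \<subseteq> L" unfolding adjoin_def
    using K.generate_field_min_subfield1[OF _ L(1), of "insert t (range \<iota>)"] tL iL by auto
  then have gs_alg: "(K.algebraic over L) g" if "g \<in> set gs" for g
    using K.algebraic_mono[of "adjoin t" L g] t(2) gs(1) that by (auto simp: over_def)
  define M where "M = K.finite_extension L gs"
  have M: "subfield M type_field" "K.finite_dimension L M"
    unfolding M_def using gs_alg
    by (intro K.finite_extension_is_subfield[OF L(1)] K.finite_extension_finite_dimension(1)[OF L(1)]; simp)+
  have "L \<subseteq> M" unfolding M_def by (rule K.finite_extension_incl) auto
  moreover have "set gs \<subseteq> M" unfolding M_def by (rule K.finite_extension_mem[OF subfieldE(1)[OF L(1)]]) simp
  ultimately have "F \<subseteq> M" using gs(2)[OF M(1)] iL by blast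
  moreover have "K.finite_dimension (adjoin x) M" by (rule K.telescopic_base_dim(1)[OF sx L(1,2) M(2)])
  ultimately show ?thesis
    using K.subalbegra_incl_imp_finite_dimension[OF sx _ subalgebra_F[OF adjoin_subset[OF x(1)]]] by blast
qed

lemma dependent_of_dimension:
  fixes w :: "nat \<Rightarrow> 'k"
  assumes K: "subfield K type_field" and dim: "ring.dimension type_field n K F"
    and w: "\<forall>i<Suc n. w i \<in> F"
  shows "\<exists>c. (\<forall>i<Suc n. c i \<in> K) \<and> (\<exists>i<Suc n. c i \<noteq> 0) \<and> (\<Sum>i<Suc n. c i * w i) = 0"
proof -
  interpret R: field "type_field :: 'k ring" by (rule field_type_field)
  let ?Us = "map w [0..<Suc n]"
  have "set ?Us \<subseteq> F" using w by (auto simp del: upt_Suc)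
  then have "\<not> R.independent K ?Us"
    using R.independent_length_le_dimension[OF K dim, of ?Us] by (auto simp del: upt_Suc)
  then obtain Ks where Ks: "length Ks = length ?Us" "R.combine Ks ?Us = \<zero>\<^bsub>type_field\<^esub>"
    "set Ks \<subseteq> K" "set Ks \<noteq> {\<zero>\<^bsub>type_field\<^esub>}"
    using R.dependent_imp_non_trivial_combine[OF K, of ?Us] by auto
  have len: "length Ks = Suc n" using Ks(1) by simp
  show ?thesis
  proof (intro exI[of _ "\<lambda>i. Ks ! i"] conjI allI impI)
    show "Ks ! i \<in> K" if "i < Suc n" for i using that len Ks(3) by (metis nth_mem subsetD)
    have "\<exists>k\<in>set Ks. k \<noteq> 0"
    proof (rule ccontr)
      assume "\<not> ?thesis"
      then have "set Ks \<subseteq> {0}" by blast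
      moreover have "set Ks \<noteq> {}" using len by auto
      ultimately have "set Ks = {0}" by (metis subset_singletonD)
      then show False using Ks(4) by simp
    qed
    then show "\<exists>i<Suc n. Ks ! i \<noteq> 0" using len by (metis in_set_conv_nth)
    have "R.combine Ks ?Us = (\<Sum>i<length ?Us. Ks ! i * ?Us ! i)" using Ks(1) by (rule type_field_combine)
    also have "\<dots> = (\<Sum>i<Suc n. Ks ! i * w i)" by (intro sum.cong) (auto simp del: upt_Suc)
    finally show "(\<Sum>i<Suc n. Ks ! i * w i) = 0" using Ks(2) by simp
  qed
qed

lemma curve_fieldI:
  assumes "\<And>x. x \<in> F \<Longrightarrow> x \<notin> range \<iota> \<Longrightarrow> ring.finite_dimension type_field (adjoin x) F"
  shows "curve_field \<iota> F"
proof
  fix x assume x: "x \<in> F" "x \<notin> range \<iota>"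
  interpret R: field "type_field :: 'k ring" by (rule field_type_field)
  obtain n where n: "R.dimension n (adjoin x) F" using assms[OF x] by (auto simp: R.finite_dimension_def)
  show "\<exists>N. \<forall>w::nat \<Rightarrow> 'k. (\<forall>i<N. w i \<in> F) \<longrightarrow>
      (\<exists>p. (\<exists>i<N. p i \<noteq> 0) \<and> (\<Sum>i<N. ev (p i) x * w i) = 0)"
  proof (intro exI[of _ "Suc n"] allI impI)
    fix w :: "nat \<Rightarrow> 'k" assume w: "\<forall>i<Suc n. w i \<in> F"
    obtain c where c: "\<forall>i<Suc n. c i \<in> adjoin x" "\<exists>i<Suc n. c i \<noteq> 0" "(\<Sum>i<Suc n. c i * w i) = 0"
      using dependent_of_dimension[OF subfield_adjoin n w] by blast
    obtain p d where pd: "ev d x \<noteq> 0" "\<forall>i<Suc n. ev (p i) x = ev d x * c i"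
      using common_denominator[of "Suc n" c x] c(1) by blast
    have "(\<Sum>i<Suc n. ev (p i) x * w i) = ev d x * (\<Sum>i<Suc n. c i * w i)"
      unfolding sum_distrib_left using pd by (intro sum.cong) (auto simp: mult.assoc)
    then have "(\<Sum>i<Suc n. ev (p i) x * w i) = 0" using c(3) by simp
    moreover obtain i where "i < Suc n" "c i \<noteq> 0" using c(2) by blast
    then have "p i \<noteq> 0" using pd by auto
    ultimately show "\<exists>p. (\<exists>i<Suc n. p i \<noteq> 0) \<and> (\<Sum>i<Suc n. ev (p i) x * w i) = 0"
      using \<open>i < Suc n\<close> by blast
  qed
qed

text \<open>A list that spans over \<open>K\<close> still spans over the larger field
  \<open>L\<close>.\<close>

lemma finite_dimension_over_subfield:
  assumes K: "subfield K type_field" and KL: "K \<subseteq> L" and L: "subfield L type_field" and LF: "L \<subseteq> F"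
    and fin: "ring.finite_dimension type_field K F"
  shows "ring.finite_dimension type_field L F"
proof -
  interpret R: field "type_field :: 'k ring" by (rule field_type_field)
  obtain n where "R.dimension n K F" using fin by (auto simp: R.finite_dimension_def)
  then obtain Us where Us: "R.Span K Us = F" using R.exists_base[OF K] by blast
  have Us_F: "set Us \<subseteq> F" using R.Span_base_incl[OF K, of Us] Us by simp
  have "R.finite_dimension L (R.Span L Us)" by (rule R.Span_finite_dimension[OF L]) simp
  moreover have "F \<subseteq> R.Span L Us"
  proof
    fix y assume "y \<in> F"
    then obtain Ks where "y = R.combine Ks Us" "set Ks \<subseteq> K"
      using R.Span_eq_combine_set[OF K, of Us] Us by auto
    with KL have "\<exists>Ks. y = R.combine Ks Us \<and> set Ks \<subseteq> L" by blast
    then show "y \<in> R.Span L Us" using R.Span_eq_combine_set[OF L, of Us] by simp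
  qed
  ultimately show ?thesis
    using R.subalbegra_incl_imp_finite_dimension[OF L _ subalgebra_F[OF LF]] by blast
qed

lemma curve_field_extensionI:
  assumes F: "curve_field \<iota> F" and F': "extension_field \<iota> F'" "F' \<subseteq> F"
    and dim: "ring.dimension type_field n F' F"
  shows "\<exists>b. curve_field_extension \<iota> F F' n b"
proof -
  interpret R: field "type_field :: 'k ring" by (rule field_type_field)
  interpret F: curve_field \<iota> F by (rule F)
  interpret F': extension_field \<iota> F' by (rule F'(1))
  note sub = F'.subfield_F
  obtain Vs where Vs: "R.independent F' Vs" "length Vs = n" "R.Span F' Vs = F"
    using R.exists_base[OF sub dim] by blast
  have VsF: "set Vs \<subseteq> F" using R.Span_base_incl[OF sub, of Vs] Vs(3) by simp
  have "curve_field_extension \<iota> F F' n (\<lambda>i. Vs ! i)"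
  proof
    show "F' \<subseteq> F" by (rule F'(2))
    show "Vs ! i \<in> F" if "i < n" for i using that VsF Vs(2) by (metis nth_mem subsetD)
    show "\<forall>i<n. c i = 0" if c: "\<And>i. i < n \<Longrightarrow> c i \<in> F'" "(\<Sum>i<n. c i * Vs ! i) = 0" for c
    proof -
      let ?Ks = "map c [0..<n]"
      have "R.combine ?Ks Vs = (\<Sum>i<length Vs. ?Ks ! i * Vs ! i)"
        by (rule type_field_combine) (simp add: Vs(2))
      also have "\<dots> = 0" using c(2) by (simp add: Vs(2))
      finally have "set (take (length Vs) ?Ks) \<subseteq> {\<zero>\<^bsub>type_field\<^esub>}"
        using c(1) by (intro R.independent_imp_trivial_combine[OF sub Vs(1)]) auto
      then show ?thesis by (auto simp: Vs(2) image_subset_iff)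
    qed
    show "\<exists>c. (\<forall>i<Suc n. c i \<in> F') \<and> (\<exists>i<Suc n. c i \<noteq> 0) \<and> (\<Sum>i<Suc n. c i * w i) = 0"
      if "\<forall>i<Suc n. w i \<in> F" for w
      by (rule dependent_of_dimension[OF sub dim that])
  qed
  then show ?thesis by blast
qed

end

section \<open>Fields of fractions inside a field type\<close>

text \<open>\<open>frac_field\<close> and \<open>pullback\<close> define operations on classes as
  unions over all representatives; such a union collapses once its members do not depend on the
  representative.\<close>

lemma UN_pair_constant:
  "A \<noteq> {} \<Longrightarrow> (\<And>a b. (a, b) \<in> A \<Longrightarrow> g a b = y) \<Longrightarrow> (\<Union>(a, b)\<in>A. g a b) = y"
  by fastforce

text \<open>An injective homomorphism into a field type turns formal fractions into quotients there.
  It is instantiated twice with the same target: for the coordinate ring of C, and for that of C'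
  composed with the projection.\<close>

locale fraction_embedding = complex_subfield \<iota> for \<iota> :: "complex \<Rightarrow> 'k::field" +
  fixes R :: "'a ring" (structure) and \<psi> :: "'a \<Rightarrow> 'k"
  assumes R_zero: "\<zero> \<in> carrier R" "\<psi> \<zero> = 0"
    and R_one: "\<one> \<in> carrier R" "\<psi> \<one> = 1"
    and R_add: "a \<in> carrier R \<Longrightarrow> b \<in> carrier R \<Longrightarrow> a \<oplus> b \<in> carrier R \<and> \<psi> (a \<oplus> b) = \<psi> a + \<psi> b"
    and R_mult: "a \<in> carrier R \<Longrightarrow> b \<in> carrier R \<Longrightarrow> a \<otimes> b \<in> carrier R \<and> \<psi> (a \<otimes> b) = \<psi> a * \<psi> b"
    and R_const: "\<exists>a\<in>carrier R. \<psi> a = \<iota> c"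
    and \<psi>_inj: "inj_on \<psi> (carrier R)"
begin

abbreviation "FF \<equiv> frac_field R"

definition value_field :: "'k set" where
  "value_field = {\<psi> a / \<psi> b |a b. a \<in> carrier R \<and> b \<in> carrier R - {\<zero>}}"

text \<open>The inverse of taking the value of a fraction: on \<open>value_field\<close>, an
  isomorphism onto \<open>frac_field R\<close>.\<close>

definition cls :: "'k \<Rightarrow> ('a \<times> 'a) set" where
  "cls k = {(a, b). a \<in> carrier R \<and> b \<in> carrier R - {\<zero>} \<and> \<psi> a = k * \<psi> b}"

lemma value_fieldI:
  "a \<in> carrier R \<Longrightarrow> b \<in> carrier R - {\<zero>} \<Longrightarrow> x = \<psi> a / \<psi> b \<Longrightarrow> x \<in> value_field"
  unfolding value_field_def by blast

lemma \<psi>_eq_iff: "a \<in> carrier R \<Longrightarrow> b \<in> carrier R \<Longrightarrow> \<psi> a = \<psi> b \<longleftrightarrow> a = b"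
  using \<psi>_inj by (auto simp: inj_on_def)

lemma \<psi>_nonzero: "b \<in> carrier R - {\<zero>} \<Longrightarrow> \<psi> b \<noteq> 0"
  using \<psi>_eq_iff[of b "\<zero>"] R_zero by auto

lemma nonzero_mult: "a \<in> carrier R - {\<zero>} \<Longrightarrow> b \<in> carrier R - {\<zero>} \<Longrightarrow>
    a \<otimes> b \<in> carrier R - {\<zero>}"
  using R_mult[of a b] \<psi>_nonzero[of a] \<psi>_nonzero[of b] R_zero by auto

lemma nonzero_one: "\<one> \<in> carrier R - {\<zero>}"
  using R_one R_zero by auto

sublocale V: extension_field \<iota> value_field
proof
  show "\<iota> c \<in> value_field" for c
  proof -
    obtain a where a: "a \<in> carrier R" "\<psi> a = \<iota> c" using R_const by blast
    then have "\<iota> c = \<psi> a / \<psi> \<one>" using R_one by simp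
    then show ?thesis unfolding value_field_def using a nonzero_one by blast
  qed
  fix x assume "x \<in> value_field"
  then obtain a b where x: "x = \<psi> a / \<psi> b" "a \<in> carrier R" "b \<in> carrier R - {\<zero>}"
    by (auto simp: value_field_def)
  show "inverse x \<in> value_field"
  proof (cases "a = \<zero>")
    case True
    then have "inverse x = \<psi> \<zero> / \<psi> \<one>" using x R_zero by simp
    then show ?thesis unfolding value_field_def using nonzero_one R_zero by blast
  next
    case False
    then have "inverse x = \<psi> b / \<psi> a" using x by simp
    then show ?thesis unfolding value_field_def using x False by blast
  qed
  fix y assume "y \<in> value_field"
  then obtain c d where y: "y = \<psi> c / \<psi> d" "c \<in> carrier R" "d \<in> carrier R - {\<zero>}"
    by (auto simp: value_field_def)
  note nz = \<psi>_nonzero[OF x(3)] \<psi>_nonzero[OF y(3)]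
  have bd: "b \<otimes> d \<in> carrier R - {\<zero>}" "\<psi> (b \<otimes> d) = \<psi> b * \<psi> d"
    using nonzero_mult[OF x(3) y(3)] R_mult x y by auto
  have "a \<otimes> d \<oplus> c \<otimes> b \<in> carrier R" "\<psi> (a \<otimes> d \<oplus> c \<otimes> b) = \<psi> a * \<psi> d + \<psi> c * \<psi> b"
    using R_add R_mult x y by auto
  moreover have "x + y = (\<psi> a * \<psi> d + \<psi> c * \<psi> b) / (\<psi> b * \<psi> d)" using nz x y by (simp add: add_frac_eq)
  ultimately show "x + y \<in> value_field" using bd by (intro value_fieldI[OF _ bd(1)]) auto
  have "a \<otimes> c \<in> carrier R" "\<psi> (a \<otimes> c) = \<psi> a * \<psi> c" using R_mult x y by auto
  moreover have "x * y = (\<psi> a * \<psi> c) / (\<psi> b * \<psi> d)" using x y by simp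
  ultimately show "x * y \<in> value_field" using bd by (intro value_fieldI[OF _ bd(1)]) auto
qed

lemma frac_rel_iff: "((a, b), (c, d)) \<in> frac_rel R \<longleftrightarrow>
    a \<in> carrier R \<and> b \<in> carrier R - {\<zero>} \<and> c \<in> carrier R \<and> d \<in> carrier R - {\<zero>} \<and>
    \<psi> a * \<psi> d = \<psi> c * \<psi> b"
proof -
  have "a \<otimes> d = c \<otimes> b \<longleftrightarrow> \<psi> a * \<psi> d = \<psi> c * \<psi> b"
    if "a \<in> carrier R" "b \<in> carrier R" "c \<in> carrier R" "d \<in> carrier R"
    using that R_mult[of a d] R_mult[of c b] \<psi>_eq_iff[of "a \<otimes> d" "c \<otimes> b"] by auto
  then show ?thesis by (auto simp: frac_rel_def)
qed

lemma fraction_eq: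
  assumes "a \<in> carrier R" "b \<in> carrier R - {\<zero>}"
  shows "fraction R a b = cls (\<psi> a / \<psi> b)"
proof -
  have key: "\<psi> a * \<psi> d = \<psi> c * \<psi> b \<longleftrightarrow> \<psi> c = \<psi> a / \<psi> b * \<psi> d" for c d
    using \<psi>_nonzero[OF assms(2)] by (auto simp: field_simps)
  have "fraction R a b = {(c, d). ((a, b), (c, d)) \<in> frac_rel R}" by (auto simp: fraction_def)
  then show ?thesis using assms unfolding frac_rel_iff key cls_def by simp
qed

lemma carrier_FF: "carrier FF = cls ` value_field"
proof -
  have "carrier FF = (\<lambda>(a, b). fraction R a b) ` (carrier R \<times> (carrier R - {\<zero>}))"
    by (auto simp: frac_field_def quotient_def fraction_def)
  also have "\<dots> = (\<lambda>(a, b). cls (\<psi> a / \<psi> b)) ` (carrier R \<times> (carrier R - {\<zero>}))"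
    by (rule image_cong) (auto simp: fraction_eq)
  also have "\<dots> = cls ` value_field" by (auto simp: value_field_def image_def)
  finally show ?thesis .
qed

lemma cls_memD:
  assumes "(a, b) \<in> cls k"
  shows "a \<in> carrier R" "b \<in> carrier R - {\<zero>}" "k = \<psi> a / \<psi> b"
  using assms \<psi>_nonzero[of b] by (auto simp: cls_def)

lemma cls_nonempty: "k \<in> value_field \<Longrightarrow> cls k \<noteq> {}"
  using \<psi>_nonzero by (fastforce simp: value_field_def cls_def)

lemma inj_cls: "inj_on cls value_field"
proof (rule inj_onI)
  fix k l assume "k \<in> value_field" "cls k = cls l"
  moreover obtain a b where "(a, b) \<in> cls k" using cls_nonempty[OF \<open>k \<in> value_field\<close>] by auto
  ultimately show "k = l" using cls_memD(3)[of a b k] cls_memD(3)[of a b l] by simp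
qed

lemma UN_cls2:
  assumes "k \<in> value_field" "l \<in> value_field"
    and "\<And>a b c d. (a, b) \<in> cls k \<Longrightarrow> (c, d) \<in> cls l \<Longrightarrow> f a b c d = y"
  shows "(\<Union>(a, b)\<in>cls k. \<Union>(c, d)\<in>cls l. f a b c d) = y"
proof -
  have inner: "(\<Union>(c, d)\<in>cls l. f a b c d) = y" if "(a, b) \<in> cls k" for a b
    by (rule UN_pair_constant[OF cls_nonempty[OF assms(2)] assms(3)[OF that]])
  show ?thesis by (rule UN_pair_constant[OF cls_nonempty[OF assms(1)] inner])
qed

lemma FF_mult:
  assumes "k \<in> value_field" "l \<in> value_field"
  shows "cls k \<otimes>\<^bsub>FF\<^esub> cls l = cls (k * l)"
proof -
  have "(\<Union>(a, b)\<in>cls k. \<Union>(c, d)\<in>cls l. fraction R (a \<otimes> c) (b \<otimes> d)) = cls (k * l)"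
  proof (rule UN_cls2[OF assms])
    fix a b c d assume "(a, b) \<in> cls k" "(c, d) \<in> cls l"
    note m = cls_memD[OF this(1)] cls_memD[OF this(2)]
    show "fraction R (a \<otimes> c) (b \<otimes> d) = cls (k * l)"
      using m R_mult[of a c] R_mult[of b d] nonzero_mult[of b d] by (subst fraction_eq) auto
  qed
  then show ?thesis by (simp add: frac_field_def)
qed

lemma FF_add:
  assumes "k \<in> value_field" "l \<in> value_field"
  shows "cls k \<oplus>\<^bsub>FF\<^esub> cls l = cls (k + l)"
proof -
  have "(\<Union>(a, b)\<in>cls k. \<Union>(c, d)\<in>cls l.
      fraction R (a \<otimes> d \<oplus> c \<otimes> b) (b \<otimes> d)) = cls (k + l)"
  proof (rule UN_cls2[OF assms])
    fix a b c d assume "(a, b) \<in> cls k" "(c, d) \<in> cls l"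
    note m = cls_memD[OF this(1)] cls_memD[OF this(2)]
    have "\<psi> (a \<otimes> d \<oplus> c \<otimes> b) / \<psi> (b \<otimes> d) = k + l"
      using m R_mult[of a d] R_mult[of c b] R_mult[of b d] R_add[of "a \<otimes> d" "c \<otimes> b"]
        \<psi>_nonzero[OF m(2)] \<psi>_nonzero[OF m(5)] by (simp add: add_frac_eq)
    then show "fraction R (a \<otimes> d \<oplus> c \<otimes> b) (b \<otimes> d) = cls (k + l)"
      using m R_mult[of a d] R_mult[of c b] R_add[of "a \<otimes> d" "c \<otimes> b"] nonzero_mult[of b d]
      by (subst fraction_eq) auto
  qed
  then show ?thesis by (simp add: frac_field_def)
qed

lemma FF_one: "\<one>\<^bsub>FF\<^esub> = cls 1"
  using fraction_eq[OF R_one(1) nonzero_one] R_one by (simp add: frac_field_def)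

lemma FF_zero: "\<zero>\<^bsub>FF\<^esub> = cls 0"
  using fraction_eq[OF R_zero(1) nonzero_one] R_zero by (simp add: frac_field_def)

lemma cls_eq_iff: "k \<in> value_field \<Longrightarrow> l \<in> value_field \<Longrightarrow> cls k = cls l \<longleftrightarrow> k = l"
  using inj_cls by (auto simp: inj_on_def)

lemma field_FF: "field FF"
proof -
  interpret T: field "type_field :: 'k ring" by (rule field_type_field)
  have sub: "field (type_field \<lparr>carrier := value_field\<rparr>)"
    by (rule T.subfield_iff(2)[OF V.subfield_F])
  have "cls \<in> ring_iso (type_field \<lparr>carrier := value_field\<rparr>) FF"
    using inj_cls by (intro ring_iso_memI) (auto simp: carrier_FF FF_mult FF_add FF_one bij_betw_def)
  from field.ring_iso_imp_img_field[OF sub this] show ?thesis by (simp add: FF_zero[symmetric])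
qed

sublocale FF: field FF
  by (rule field_FF)

lemma FF_uminus: "k \<in> value_field \<Longrightarrow> \<ominus>\<^bsub>FF\<^esub> cls k = cls (- k)"
  by (rule FF.minus_equality) (auto simp: carrier_FF FF_add FF_zero V.uminus_mem)

lemma FF_inverse: "k \<in> value_field \<Longrightarrow> k \<noteq> 0 \<Longrightarrow> inv\<^bsub>FF\<^esub> cls k = cls (inverse k)"
  using FF.inv_unique'[of "cls k" "cls (inverse k)"]
  by (auto simp: carrier_FF FF_mult FF_one V.inverse_mem)

definition uncls :: "('a \<times> 'a) set \<Rightarrow> 'k" where
  "uncls = the_inv_into value_field cls"

lemma uncls_cls [simp]: "k \<in> value_field \<Longrightarrow> uncls (cls k) = k"
  unfolding uncls_def by (rule the_inv_into_f_f[OF inj_cls])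

lemma uncls_hom: "ring_hom_ring FF type_field uncls"
proof -
  interpret T: field "type_field :: 'k ring" by (rule field_type_field)
  show ?thesis
  proof (rule ring_hom_ringI)
    show "ring FF" by (rule FF.ring_axioms)
    show "ring (type_field :: 'k ring)" by (rule T.ring_axioms)
  qed (auto simp: carrier_FF FF_mult FF_add FF_one V.mult_mem V.add_mem)
qed

lemma uncls_image: "K \<subseteq> value_field \<Longrightarrow> uncls ` cls ` K = K"
  by (force simp: image_image)

lemma uncls_eval:
  assumes "set p \<subseteq> carrier FF" "z \<in> carrier FF"
  shows "uncls (FF.eval p z) = ring.eval type_field (map uncls p) (uncls z)"
proof -
  interpret T: field "type_field :: 'k ring" by (rule field_type_field)
  interpret h: ring_hom_ring FF type_field uncls by (rule uncls_hom)
  show ?thesis using assms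
  proof (induction p)
    case (Cons c p)
    have "FF.eval p z \<in> carrier FF" using Cons by (intro FF.eval_in_carrier) auto
    moreover have "uncls (z [^]\<^bsub>FF\<^esub> n) = uncls z ^ n" for n :: nat
      using h.hom_nat_pow[OF Cons.prems(2), of n] by simp
    ultimately show ?case using Cons by (simp add: h.hom_add h.hom_mult)
  qed simp
qed

lemma uncls_generate_field:
  assumes "H \<subseteq> carrier FF" "y \<in> generate_field FF H"
  shows "uncls y \<in> generate_field type_field (uncls ` H)"
  using assms(2)
proof (induction rule: generate_field.induct)
  case one
  then show ?case using generate_field.one[of type_field "uncls ` H"] by (simp add: FF_one)
next
  case (incl h)
  then show ?case by (auto intro: generate_field.incl)
next
  case (a_inv h)
  have "h \<in> carrier FF" using FF.generate_field_in_carrier[OF assms(1) a_inv(1)] .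
  then obtain k where "k \<in> value_field" "h = cls k" by (auto simp: carrier_FF)
  then show ?case using generate_field.a_inv[OF a_inv(2)] by (simp add: FF_uminus V.uminus_mem)
next
  case (m_inv h)
  have "h \<in> carrier FF" using FF.generate_field_in_carrier[OF assms(1) m_inv(1)] .
  then obtain k where k: "k \<in> value_field" "h = cls k" by (auto simp: carrier_FF)
  with m_inv(2) have "k \<noteq> 0" by (auto simp: FF_zero)
  with k show ?case using generate_field.m_inv[OF m_inv(3)] by (simp add: FF_inverse V.inverse_mem)
next
  case (eng_add h1 h2)
  have "h1 \<in> carrier FF" "h2 \<in> carrier FF" using FF.generate_field_in_carrier[OF assms(1)] eng_add by blast+
  then obtain k l where "k \<in> value_field" "h1 = cls k" "l \<in> value_field" "h2 = cls l"
    by (auto simp: carrier_FF)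
  then show ?case using generate_field.eng_add[OF eng_add(3,4)] by (simp add: FF_add V.add_mem)
next
  case (eng_mult h1 h2)
  have "h1 \<in> carrier FF" "h2 \<in> carrier FF" using FF.generate_field_in_carrier[OF assms(1)] eng_mult by blast+
  then obtain k l where "k \<in> value_field" "h1 = cls k" "l \<in> value_field" "h2 = cls l"
    by (auto simp: carrier_FF)
  then show ?case using generate_field.eng_mult[OF eng_mult(3,4)] by (simp add: FF_mult V.mult_mem)
qed

lemma algebraic_adjoin:
  assumes t: "t \<in> carrier FF" and z: "z \<in> carrier FF"
    and alg: "FF.algebraic (generate_field FF (insert t (cls ` range \<iota>))) z"
  shows "ring.algebraic type_field (adjoin (uncls t)) (uncls z)"
proof -
  interpret T: field "type_field :: 'k ring" by (rule field_type_field)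
  let ?H = "insert t (cls ` range \<iota>)"
  have H: "?H \<subseteq> carrier FF" using t by (auto simp: carrier_FF)
  note sub = FF.generate_field_is_subfield[OF H]
  obtain p where p: "p \<in> carrier (univ_poly FF (generate_field FF ?H))" "p \<noteq> []" "FF.eval p z = \<zero>\<^bsub>FF\<^esub>"
    using FF.algebraicE[OF subfieldE(1)[OF sub] z] alg by (auto simp: over_def)
  then have set_p: "set p \<subseteq> generate_field FF ?H" and lead: "hd p \<noteq> \<zero>\<^bsub>FF\<^esub>"
    by (auto simp: univ_poly_def polynomial_def)
  have p_carr: "set p \<subseteq> carrier FF" using set_p FF.generate_field_incl[OF H] by blast
  have im: "uncls ` ?H = insert (uncls t) (range \<iota>)" by (simp add: uncls_image image_subset_iff)
  have "uncls ` set p \<subseteq> adjoin (uncls t)"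
    using uncls_generate_field[OF H] set_p unfolding adjoin_def im[symmetric] by blast
  moreover have "uncls (hd p) \<noteq> 0"
  proof
    assume "uncls (hd p) = 0"
    moreover obtain k where "k \<in> value_field" "hd p = cls k"
      using p_carr p(2) by (auto simp: carrier_FF dest!: hd_in_set)
    ultimately show False using lead by (simp add: FF_zero)
  qed
  ultimately have "map uncls p \<in> carrier (univ_poly type_field (adjoin (uncls t)))"
    using p(2) by (auto simp: univ_poly_def polynomial_def hd_map)
  moreover have "T.eval (map uncls p) (uncls z) = \<zero>\<^bsub>type_field\<^esub>"
    using uncls_eval[OF p_carr z] p(3) by (simp add: FF_zero)
  ultimately have "(T.algebraic over adjoin (uncls t)) (uncls z)"
    using p(2) by (intro T.algebraicI[of "map uncls p"]) auto
  then show ?thesis by (simp add: over_def)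
qed

lemma subfield_cls:
  assumes K: "extension_field \<iota> K" "K \<subseteq> value_field"
  shows "subfield (cls ` K) FF"
proof -
  interpret K: extension_field \<iota> K by (rule K(1))
  have mem: "k \<in> value_field" if "k \<in> K" for k using that K(2) by blast
  have "subring (cls ` K) FF"
    by (rule FF.subringI)
      (auto simp: carrier_FF FF_one FF_uminus FF_mult FF_add mem K.uminus_mem K.mult_mem K.add_mem)
  then show "subfield (cls ` K) FF"
  proof (rule FF.subfieldI')
    fix y assume y: "y \<in> cls ` K - {\<zero>\<^bsub>FF\<^esub>}"
    then obtain k where k: "k \<in> K" "y = cls k" by blast
    with y have "k \<noteq> 0" by (auto simp: FF_zero)
    with k show "inv\<^bsub>FF\<^esub> y \<in> cls ` K" by (simp add: FF_inverse mem K.inverse_mem)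
  qed
qed

text \<open>\<open>dim\<close> is meaningful only for finite dimensions, so finiteness is first
  carried over to the fraction field and the number is transferred afterwards.\<close>

lemma dimension_value_field:
  assumes K: "extension_field \<iota> K" "K \<subseteq> value_field"
    and fin: "ring.finite_dimension type_field K value_field"
  shows "ring.dimension type_field (FF.dim (cls ` K) (carrier FF)) K value_field"
proof -
  interpret T: field "type_field :: 'k ring" by (rule field_type_field)
  interpret h: ring_hom_ring FF type_field uncls by (rule uncls_hom)
  note sub = subfield_cls[OF K]
  have inj: "inj_on uncls (carrier FF)" by (auto simp: inj_on_def carrier_FF)
  have im: "uncls ` cls ` K = K" "uncls ` carrier FF = value_field"
    using K(2) by (auto simp: uncls_image carrier_FF)
  have "FF.finite_dimension (cls ` K) (carrier FF)"
  proof (rule ccontr)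
    assume "\<not> ?thesis"
    from h.infinite_dimension_hom[OF sub _ inj FF.carrier_is_subalgebra this] subfieldE(3)[OF sub] fin
    show False by (simp add: im)
  qed
  then have "FF.dimension (FF.dim (cls ` K) (carrier FF)) (cls ` K) (carrier FF)"
    using FF.finite_dimensionE[OF sub] by (simp add: over_def)
  from h.inj_hom_dimension[OF sub _ inj this] show ?thesis by (simp add: im)
qed

text \<open>Repeats the form of \<open>Val\<close> for an arbitrary fraction field, so that the two
  agree on unfolding once the constants are identified.\<close>

definition frac_Vals :: "(('a \<times> 'a) set \<Rightarrow> int) set" where
  "frac_Vals = (let U = carrier FF - {\<zero>\<^bsub>FF\<^esub>} in
     {\<nu> \<in> U \<rightarrow>\<^sub>E UNIV.
        (\<forall>a\<in>U. \<forall>b\<in>U. \<nu> (a \<otimes>\<^bsub>FF\<^esub> b) = \<nu> a + \<nu> b) \<and>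
        (\<forall>a\<in>U. \<forall>b\<in>U. a \<oplus>\<^bsub>FF\<^esub> b \<noteq> \<zero>\<^bsub>FF\<^esub> \<longrightarrow> min (\<nu> a) (\<nu> b) \<le> \<nu> (a \<oplus>\<^bsub>FF\<^esub> b)) \<and>
        (\<forall>c \<in> cls ` range \<iota> - {\<zero>\<^bsub>FF\<^esub>}. \<nu> c = 0) \<and>
        \<nu> ` U = UNIV})"

lemma Vals_bij:
  "bij_betw (\<lambda>\<nu>. restrict (\<lambda>k. \<nu> (cls k)) (value_field - {0})) frac_Vals (Vals value_field)"
proof -
  let ?U = "carrier FF - {\<zero>\<^bsub>FF\<^esub>}"
  let ?f = "\<lambda>\<nu>. restrict (\<lambda>k. \<nu> (cls k)) (value_field - {0})"
  let ?g = "\<lambda>v. restrict (\<lambda>A. v (uncls A)) ?U"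
  have U: "?U = cls ` (value_field - {0})"
    by (auto simp: carrier_FF FF_zero cls_eq_iff)
  have Ucase: "\<exists>k. A = cls k \<and> k \<in> value_field \<and> k \<noteq> 0" if "A \<in> ?U" for A
    using that unfolding U by blast
  have z: "cls k = \<zero>\<^bsub>FF\<^esub> \<longleftrightarrow> k = 0" if "k \<in> value_field" for k
    using that by (simp add: FF_zero cls_eq_iff)
  show ?thesis
  proof (rule bij_betwI[of ?f _ _ ?g])
    show "?f \<in> frac_Vals \<rightarrow> Vals value_field"
    proof
      fix \<nu> assume "\<nu> \<in> frac_Vals"
      then have nu0: "(\<forall>a\<in>?U. \<forall>b\<in>?U. \<nu> (a \<otimes>\<^bsub>FF\<^esub> b) = \<nu> a + \<nu> b) \<and>
        (\<forall>a\<in>?U. \<forall>b\<in>?U. a \<oplus>\<^bsub>FF\<^esub> b \<noteq> \<zero>\<^bsub>FF\<^esub> \<longrightarrow> min (\<nu> a) (\<nu> b) \<le> \<nu> (a \<oplus>\<^bsub>FF\<^esub> b)) \<and>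
        (\<forall>c \<in> cls ` range \<iota> - {\<zero>\<^bsub>FF\<^esub>}. \<nu> c = 0) \<and> \<nu> ` ?U = UNIV"
        unfolding frac_Vals_def Let_def mem_Collect_eq by (rule conjunct2)
      have nu: "\<And>a b. a \<in> ?U \<Longrightarrow> b \<in> ?U \<Longrightarrow> \<nu> (a \<otimes>\<^bsub>FF\<^esub> b) = \<nu> a + \<nu> b"
        "\<And>a b. a \<in> ?U \<Longrightarrow> b \<in> ?U \<Longrightarrow> a \<oplus>\<^bsub>FF\<^esub> b \<noteq> \<zero>\<^bsub>FF\<^esub> \<Longrightarrow> min (\<nu> a) (\<nu> b) \<le> \<nu> (a \<oplus>\<^bsub>FF\<^esub> b)"
        "\<And>c. c \<in> cls ` range \<iota> - {\<zero>\<^bsub>FF\<^esub>} \<Longrightarrow> \<nu> c = 0" "\<nu> ` ?U = UNIV"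
        by ((rule nu0[THEN conjunct1, THEN bspec, THEN bspec]; assumption),
            (rule nu0[THEN conjunct2, THEN conjunct1, THEN bspec, THEN bspec, THEN mp]; assumption),
            (rule nu0[THEN conjunct2, THEN conjunct2, THEN conjunct1, THEN bspec]; assumption),
            rule nu0[THEN conjunct2, THEN conjunct2, THEN conjunct2])
      have mem: "cls k \<in> ?U" if "k \<in> value_field" "k \<noteq> 0" for k using that U by blast
      have "valuation_on value_field (?f \<nu>)"
        unfolding valuation_on_def
      proof (intro conjI ballI allI impI)
        fix a b assume ab: "a \<in> value_field - {0}" "b \<in> value_field - {0}"
        then show "?f \<nu> (a * b) = ?f \<nu> a + ?f \<nu> b"
          using nu(1)[of "cls a" "cls b"] mem by (auto simp: FF_mult V.mult_mem)
        assume "a + b \<noteq> 0"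
        then show "min (?f \<nu> a) (?f \<nu> b) \<le> ?f \<nu> (a + b)"
          using ab nu(2)[of "cls a" "cls b"] mem z[of "a + b"] by (auto simp: FF_add V.add_mem)
      next
        fix c :: complex assume "c \<noteq> 0"
        then show "?f \<nu> (\<iota> c) = 0" using nu(3)[of "cls (\<iota> c)"] z[of "\<iota> c"] by auto
      qed
      moreover have "?f \<nu> ` (value_field - {0}) = UNIV"
        using nu(4) unfolding U by (simp add: image_image)
      ultimately show "?f \<nu> \<in> Vals value_field" by (auto simp: Vals_def)
    qed
    show "?g \<in> Vals value_field \<rightarrow> frac_Vals"
    proof
      fix v assume v: "v \<in> Vals value_field"
      note V = V.ValsD(1)[OF v]
      have sur: "v ` (value_field - {0}) = UNIV" using v by (simp add: Vals_def)
      have g: "?g v (cls k) = v k" if "k \<in> value_field" "k \<noteq> 0" for k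
        using that z[of k] by (auto simp: carrier_FF)
      have "?g v (a \<otimes>\<^bsub>FF\<^esub> b) = ?g v a + ?g v b" if "a \<in> ?U" "b \<in> ?U" for a b
      proof -
        obtain k where k: "a = cls k" "k \<in> value_field" "k \<noteq> 0" using Ucase[OF \<open>a \<in> ?U\<close>] by blast
        obtain l where l: "b = cls l" "l \<in> value_field" "l \<noteq> 0" using Ucase[OF \<open>b \<in> ?U\<close>] by blast
        have "?g v (cls (k * l)) = v (k * l)" using k l by (intro g) auto
        also have "\<dots> = v k + v l" using k l by (intro V.val_mult[OF V])
        finally show ?thesis
          unfolding k(1) l(1) FF_mult[OF k(2) l(2)] g[OF k(2,3)] g[OF l(2,3)] .
      qed
      moreover have "min (?g v a) (?g v b) \<le> ?g v (a \<oplus>\<^bsub>FF\<^esub> b)"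
        if "a \<in> ?U" "b \<in> ?U" "a \<oplus>\<^bsub>FF\<^esub> b \<noteq> \<zero>\<^bsub>FF\<^esub>" for a b
      proof -
        obtain k where k: "a = cls k" "k \<in> value_field" "k \<noteq> 0" using Ucase[OF \<open>a \<in> ?U\<close>] by blast
        obtain l where l: "b = cls l" "l \<in> value_field" "l \<noteq> 0" using Ucase[OF \<open>b \<in> ?U\<close>] by blast
        have kl: "k + l \<noteq> 0" using that(3) k l by (auto simp: FF_add FF_zero)
        have "?g v (cls (k + l)) = v (k + l)" using k l kl by (intro g) auto
        moreover have "min (v k) (v l) \<le> v (k + l)" using k l kl by (intro V.val_add[OF V])
        ultimately show ?thesis
          unfolding k(1) l(1) FF_add[OF k(2) l(2)] g[OF k(2,3)] g[OF l(2,3)] by simp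
      qed
      moreover have "?g v c = 0" if c: "c \<in> cls ` range \<iota> - {\<zero>\<^bsub>FF\<^esub>}" for c
      proof -
        obtain w where w: "c = cls (\<iota> w)" using c by blast
        then have "w \<noteq> 0" using c by (auto simp: FF_zero)
        then show ?thesis using g[of "\<iota> w"] V.val_iota[OF V, of w] w by simp
      qed
      moreover have "?g v ` ?U = UNIV"
      proof -
        have "?g v ` ?U = (\<lambda>k. ?g v (cls k)) ` (value_field - {0})" unfolding U by (rule image_image)
        also have "\<dots> = v ` (value_field - {0})" using g by (intro image_cong) auto
        finally show ?thesis using sur by simp
      qed
      moreover have "?g v \<in> ?U \<rightarrow>\<^sub>E UNIV" by simp
      ultimately show "?g v \<in> frac_Vals" unfolding frac_Vals_def Let_def mem_Collect_eq
        by (intro conjI ballI impI)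
    qed
    show "?g (?f \<nu>) = \<nu>" if "\<nu> \<in> frac_Vals" for \<nu>
    proof (rule PiE_ext[where k = ?U and s = "\<lambda>_. UNIV"])
      show "\<nu> \<in> ?U \<rightarrow>\<^sub>E UNIV" using that by (simp add: frac_Vals_def Let_def)
      show "?g (?f \<nu>) A = \<nu> A" if A: "A \<in> ?U" for A
      proof -
        obtain k where "A = cls k" "k \<in> value_field" "k \<noteq> 0" using Ucase[OF A] by blast
        with A show ?thesis by simp
      qed
    qed auto
    show "?f (?g v) = v" if "v \<in> Vals value_field" for v
    proof (rule PiE_ext[where k = "value_field - {0}" and s = "\<lambda>_. UNIV"])
      show "v \<in> (value_field - {0}) \<rightarrow>\<^sub>E UNIV" using that by (simp add: Vals_def)
      show "?f (?g v) k = v k" if "k \<in> value_field - {0}" for k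
        using that z[of k] by (auto simp: carrier_FF)
    qed auto
  qed
qed

end

section \<open>Function fields inside the ultrapower\<close>

lemma poly_funs_uminus: "p \<in> poly_funs I \<Longrightarrow> (\<lambda>x. - p x) \<in> poly_funs I"
  using poly_funs.mult[OF poly_funs.const[of "-1"], of p I] by simp

lemma poly_funs_diff: "p \<in> poly_funs I \<Longrightarrow> q \<in> poly_funs I \<Longrightarrow> (\<lambda>x. p x - q x) \<in> poly_funs I"
  using poly_funs.add[of p I "\<lambda>x. - q x"] poly_funs_uminus[of q I] by simp

lemma poly_funs_projection:
  assumes "p \<in> poly_funs J" "J \<subseteq> I"
  shows "(\<lambda>x. p (projection J x)) \<in> poly_funs I"
  using assms(1)
proof (induction rule: poly_funs.induct)
  case (coord i)
  then show ?case using assms(2) poly_funs.coord[of i I] by (auto simp: projection_def)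
qed (auto intro: poly_funs.intros)

lemma coord_ring_simps:
  "carrier (coord_ring I S) = (\<lambda>p. restrict p S) ` poly_funs I"
  "f \<otimes>\<^bsub>coord_ring I S\<^esub> g = (\<lambda>x\<in>S. f x * g x)" "f \<oplus>\<^bsub>coord_ring I S\<^esub> g = (\<lambda>x\<in>S. f x + g x)"
  "\<one>\<^bsub>coord_ring I S\<^esub> = (\<lambda>x\<in>S. 1)" "\<zero>\<^bsub>coord_ring I S\<^esub> = (\<lambda>x\<in>S. 0)"
  by (simp_all add: coord_ring_def)

lemma coord_ring_closed:
  assumes "f \<in> carrier (coord_ring I S)" "g \<in> carrier (coord_ring I S)"
  shows "(\<lambda>x\<in>S. f x + g x) \<in> carrier (coord_ring I S)"
    and "(\<lambda>x\<in>S. f x * g x) \<in> carrier (coord_ring I S)"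
    and "(\<lambda>x\<in>S. f x - g x) \<in> carrier (coord_ring I S)"
proof -
  obtain p q where pq: "p \<in> poly_funs I" "q \<in> poly_funs I" "f = restrict p S" "g = restrict q S"
    using assms by (auto simp: coord_ring_simps)
  have "(\<lambda>x\<in>S. f x + g x) = restrict (\<lambda>x. p x + q x) S" "(\<lambda>x\<in>S. f x * g x) = restrict (\<lambda>x. p x * q x) S"
    "(\<lambda>x\<in>S. f x - g x) = restrict (\<lambda>x. p x - q x) S"
    using pq(3,4) by (auto simp: restrict_def)
  then show "(\<lambda>x\<in>S. f x + g x) \<in> carrier (coord_ring I S)"
    "(\<lambda>x\<in>S. f x * g x) \<in> carrier (coord_ring I S)" "(\<lambda>x\<in>S. f x - g x) \<in> carrier (coord_ring I S)"
    using pq(1,2) poly_funs.add poly_funs.mult poly_funs_diff unfolding coord_ring_simps by blast+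
qed

lemma irreducible_no_zero_divisors:
  assumes S: "irreducible_variety I S" and p: "p \<in> poly_funs I" and q: "q \<in> poly_funs I"
    and z: "\<And>x. x \<in> S \<Longrightarrow> p x * q x = 0"
  shows "(\<forall>x\<in>S. p x = 0) \<or> (\<forall>x\<in>S. q x = 0)"
proof -
  obtain P where P: "P \<subseteq> poly_funs I" "S = zero_locus I P"
    using S by (auto simp: irreducible_variety_def algebraic_set_def)
  have alg: "algebraic_set I {x \<in> S. r x = 0}" if "r \<in> poly_funs I" for r
    unfolding algebraic_set_def
    using P that by (intro exI[of _ "insert r P"]) (auto simp: zero_locus_def)
  have "S = {x \<in> S. p x = 0} \<union> {x \<in> S. q x = 0}" using z by auto
  then have "S = {x \<in> S. p x = 0} \<or> S = {x \<in> S. q x = 0}"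
    using S alg[OF p] alg[OF q] unfolding irreducible_variety_def by blast
  then show ?thesis by blast
qed

text \<open>On an irreducible variety a product of nonzero functions is nonzero. The induction
  carries one polynomial, a product of representatives, whose nonvanishing at a point forces that of
  all members of \<open>G\<close>.\<close>

lemma common_nonzero_point:
  assumes S: "irreducible_variety I S" and "finite G"
    and "G \<subseteq> carrier (coord_ring I S) - {\<zero>\<^bsub>coord_ring I S\<^esub>}"
  shows "\<exists>x\<in>S. \<forall>f\<in>G. f x \<noteq> 0"
proof -
  have "\<exists>p\<in>poly_funs I. (\<exists>x\<in>S. p x \<noteq> 0) \<and> (\<forall>x\<in>S. p x \<noteq> 0 \<longrightarrow> (\<forall>f\<in>G. f x \<noteq> 0))"
    using assms(2,3)
  proof (induction G rule: finite_induct)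
    case empty
    have "S \<noteq> {}" using S by (simp add: irreducible_variety_def)
    then show ?case by (intro bexI[of _ "\<lambda>x. 1"]) (auto intro: poly_funs.const)
  next
    case (insert f G)
    then obtain p where p: "p \<in> poly_funs I" "\<exists>x\<in>S. p x \<noteq> 0" "\<forall>x\<in>S. p x \<noteq> 0 \<longrightarrow> (\<forall>f\<in>G. f x \<noteq> 0)"
      by auto
    obtain q where q: "q \<in> poly_funs I" "f = restrict q S"
      using insert.prems by (auto simp: coord_ring_simps)
    have "\<exists>x\<in>S. q x \<noteq> 0"
    proof (rule ccontr)
      assume "\<not> ?thesis"
      then have "f = \<zero>\<^bsub>coord_ring I S\<^esub>" unfolding q(2) coord_ring_simps by (intro restrict_ext) auto
      with insert.prems show False by blast
    qed
    then have "\<exists>x\<in>S. p x * q x \<noteq> 0" using irreducible_no_zero_divisors[OF S p(1) q(1)] p(2) by blast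
    then show ?case using p(1,3) q by (intro bexI[of _ "\<lambda>x. p x * q x"]) (auto intro: poly_funs.mult)
  qed
  then show ?thesis by blast
qed

text \<open>The index \<open>j\<close> is read as a finite list of functions, and the point avoids
  the zeros of its nonzero members. For infinite \<open>j\<close> any point of \<open>S\<close>
  serves, since almost all indices are finite.\<close>

definition sample_point :: "'i set \<Rightarrow> ('i \<Rightarrow> complex) set \<Rightarrow> (('i \<Rightarrow> complex) \<Rightarrow> complex) set \<Rightarrow> ('i \<Rightarrow> complex)" where
  "sample_point I S j = (SOME x. x \<in> S \<and> (finite j \<longrightarrow>
     (\<forall>f\<in>j \<inter> (carrier (coord_ring I S) - {\<zero>\<^bsub>coord_ring I S\<^esub>}). f x \<noteq> 0)))"

lemma sample_point:
  assumes S: "irreducible_variety I S"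
  shows "sample_point I S j \<in> S"
    and "finite j \<Longrightarrow> f \<in> j \<Longrightarrow> f \<in> carrier (coord_ring I S) \<Longrightarrow> f \<noteq> \<zero>\<^bsub>coord_ring I S\<^esub> \<Longrightarrow>
      f (sample_point I S j) \<noteq> 0"
proof -
  have "\<exists>x. x \<in> S \<and> (finite j \<longrightarrow>
     (\<forall>f\<in>j \<inter> (carrier (coord_ring I S) - {\<zero>\<^bsub>coord_ring I S\<^esub>}). f x \<noteq> 0))"
  proof (cases "finite j")
    case True
    then have "\<exists>x\<in>S. \<forall>f\<in>j \<inter> (carrier (coord_ring I S) - {\<zero>\<^bsub>coord_ring I S\<^esub>}). f x \<noteq> 0"
      by (intro common_nonzero_point[OF S]) auto
    then show ?thesis by blast
  next
    case False
    moreover have "S \<noteq> {}" using S by (simp add: irreducible_variety_def)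
    ultimately show ?thesis by blast
  qed
  from someI_ex[OF this]
  have *: "sample_point I S j \<in> S \<and> (finite j \<longrightarrow>
     (\<forall>f\<in>j \<inter> (carrier (coord_ring I S) - {\<zero>\<^bsub>coord_ring I S\<^esub>}). f (sample_point I S j) \<noteq> 0))"
    unfolding sample_point_def .
  show "sample_point I S j \<in> S" using * by (rule conjunct1)
  show "f (sample_point I S j) \<noteq> 0" if "finite j" "f \<in> j" "f \<in> carrier (coord_ring I S)"
    "f \<noteq> \<zero>\<^bsub>coord_ring I S\<^esub>"
    by (rule conjunct2[OF *, THEN mp, OF that(1), THEN bspec]) (use that in simp)
qed

definition ultra_eval ::
  "'i set \<Rightarrow> ('i \<Rightarrow> complex) set \<Rightarrow> (('i \<Rightarrow> complex) \<Rightarrow> complex) \<Rightarrow> (('i \<Rightarrow> complex) \<Rightarrow> complex) ultracomplex" where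
  "ultra_eval I S f = abs_ultracomplex (\<lambda>j. f (sample_point I S j))"

lemma ultra_eval_hom:
  assumes S: "irreducible_variety I S"
  shows "ultra_eval I S (\<lambda>x\<in>S. f x + g x) = ultra_eval I S f + ultra_eval I S g"
    and "ultra_eval I S (\<lambda>x\<in>S. f x * g x) = ultra_eval I S f * ultra_eval I S g"
    and "ultra_eval I S (\<lambda>x\<in>S. f x - g x) = ultra_eval I S f - ultra_eval I S g"
    and "ultra_eval I S (\<lambda>x\<in>S. c) = ultra_const c"
    and "(\<And>x. x \<in> S \<Longrightarrow> f x = g x) \<Longrightarrow> ultra_eval I S f = ultra_eval I S g"
  using sample_point(1)[OF S]
  by (auto simp: ultra_eval_def plus_ultracomplex.abs_eq times_ultracomplex.abs_eq
      minus_ultracomplex.abs_eq ultra_const.abs_eq)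

text \<open>Two distinct functions differ at the sample point of every finite \<open>j\<close> that
  contains their difference, hence at almost every index.\<close>

lemma ultra_eval_inj:
  assumes S: "irreducible_variety I S"
    and fg: "f \<in> carrier (coord_ring I S)" "g \<in> carrier (coord_ring I S)"
    and eq: "ultra_eval I S f = ultra_eval I S g" and x: "x \<in> S"
  shows "f x = g x"
proof (rule ccontr)
  assume neq: "f x \<noteq> g x"
  define h where "h = (\<lambda>x\<in>S. f x - g x)"
  have h: "h \<in> carrier (coord_ring I S)" unfolding h_def by (rule coord_ring_closed(3)[OF fg])
  have "h x \<noteq> \<zero>\<^bsub>coord_ring I S\<^esub> x" using neq x by (simp add: h_def coord_ring_simps)
  then have hn: "h \<noteq> \<zero>\<^bsub>coord_ring I S\<^esub>" by metis
  have "{j. f (sample_point I S j) = g (sample_point I S j)} \<in> large_sets"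
    using eq by (simp add: ultra_eval_def ultracomplex.abs_eq_iff almost_eq_def)
  from large_Int[OF this large_member[of h]]
  have "{j. f (sample_point I S j) = g (sample_point I S j)} \<inter> {j. finite j \<and> h \<in> j} \<noteq> {}"
    using large_empty by metis
  then obtain j where j: "f (sample_point I S j) = g (sample_point I S j)" "finite j" "h \<in> j" by blast
  have "h (sample_point I S j) \<noteq> 0" by (rule sample_point(2)[OF S j(2,3) h hn])
  with sample_point(1)[OF S, of j] j(1) show False by (simp add: h_def)
qed

lemma coord_ring_eqI:
  assumes "f \<in> carrier (coord_ring I S)" "g \<in> carrier (coord_ring I S)" "\<And>x. x \<in> S \<Longrightarrow> f x = g x"
  shows "f = g"
proof -
  have "f \<in> extensional S" "g \<in> extensional S" using assms(1,2) by (auto simp: coord_ring_simps)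
  then show ?thesis using assms(3) by (intro extensionalityI) auto
qed

lemma fraction_embedding_ultra_eval:
  assumes S: "irreducible_variety I S"
  shows "fraction_embedding ultra_const (coord_ring I S) (ultra_eval I S)"
proof -
  interpret complex_subfield ultra_const by (rule ultra_const)
  have const: "(\<lambda>x\<in>S. c) \<in> carrier (coord_ring I S)" for c
    unfolding coord_ring_simps using poly_funs.const by blast
  show ?thesis
  proof
    show "\<zero>\<^bsub>coord_ring I S\<^esub> \<in> carrier (coord_ring I S)" "\<one>\<^bsub>coord_ring I S\<^esub> \<in> carrier (coord_ring I S)"
      using const[of 0] const[of 1] by (simp_all add: coord_ring_simps)
    show "ultra_eval I S \<zero>\<^bsub>coord_ring I S\<^esub> = 0" "ultra_eval I S \<one>\<^bsub>coord_ring I S\<^esub> = 1"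
      using ultra_eval_hom(4)[OF S, of 0] ultra_eval_hom(4)[OF S, of 1] by (simp_all add: coord_ring_simps)
    show "\<exists>a\<in>carrier (coord_ring I S). ultra_eval I S a = ultra_const c" for c
      using const[of c] ultra_eval_hom(4)[OF S, of c] by blast
    show "inj_on (ultra_eval I S) (carrier (coord_ring I S))"
      by (rule inj_onI, rule coord_ring_eqI, assumption+) (rule ultra_eval_inj[OF S])
    fix f g assume fg: "f \<in> carrier (coord_ring I S)" "g \<in> carrier (coord_ring I S)"
    show "f \<oplus>\<^bsub>coord_ring I S\<^esub> g \<in> carrier (coord_ring I S) \<and>
        ultra_eval I S (f \<oplus>\<^bsub>coord_ring I S\<^esub> g) = ultra_eval I S f + ultra_eval I S g"
      unfolding coord_ring_simps(3) by (rule conjI[OF coord_ring_closed(1)[OF fg] ultra_eval_hom(1)[OF S]])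
    show "f \<otimes>\<^bsub>coord_ring I S\<^esub> g \<in> carrier (coord_ring I S) \<and>
        ultra_eval I S (f \<otimes>\<^bsub>coord_ring I S\<^esub> g) = ultra_eval I S f * ultra_eval I S g"
      unfolding coord_ring_simps(2) by (rule conjI[OF coord_ring_closed(2)[OF fg] ultra_eval_hom(2)[OF S]])
  qed
qed

section \<open>The function field of the projection\<close>

lemma projection_closure:
  assumes "x \<in> S"
  shows "projection J x \<in> zariski_closure J (projection J ` S)"
  using assms by (auto simp: zariski_closure_def)

lemma vanish_on_closure:
  assumes p: "p \<in> poly_funs J" and z: "\<And>x. x \<in> S \<Longrightarrow> p (projection J x) = 0"
    and y: "y \<in> zariski_closure J (projection J ` S)"
  shows "p y = 0"
proof -
  have "projection J ` S \<subseteq> zero_locus J {p}"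
    using z by (auto simp: zero_locus_def affine_space_def projection_def)
  moreover have "algebraic_set J (zero_locus J {p})"
    using p by (auto simp: algebraic_set_def intro!: exI[of _ "{p}"])
  ultimately have "y \<in> zero_locus J {p}" using y by (auto simp: zariski_closure_def)
  then show ?thesis by (simp add: zero_locus_def)
qed

lemma carrier_projection:
  assumes "a \<in> carrier (coord_ring J (zariski_closure J (projection J ` S)))" "J \<subseteq> I"
  shows "(\<lambda>x\<in>S. a (projection J x)) \<in> carrier (coord_ring I S)"
proof -
  obtain p where p: "p \<in> poly_funs J" "a = restrict p (zariski_closure J (projection J ` S))"
    using assms(1) by (auto simp: coord_ring_simps)
  have "(\<lambda>x\<in>S. a (projection J x)) = restrict (\<lambda>x. p (projection J x)) S"
    using projection_closure[of _ S J] by (intro restrict_ext) (simp add: p(2))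
  then show ?thesis using poly_funs_projection[OF p(1) assms(2)] by (auto simp: coord_ring_simps)
qed

text \<open>Functions on the projection are evaluated at the projected sample points of
  \<open>S\<close>, not at sample points of their own. The image then lies in that of the function
  field of \<open>S\<close>, so that degree and restriction of valuations refer to an actual
  subfield.\<close>

lemma fraction_embedding_projection:
  assumes S: "irreducible_variety I S" and J: "J \<subseteq> I"
  defines "Y \<equiv> zariski_closure J (projection J ` S)"
  shows "fraction_embedding ultra_const (coord_ring J Y) (\<lambda>a. ultra_eval I S (\<lambda>x\<in>S. a (projection J x)))"
proof -
  interpret complex_subfield ultra_const by (rule ultra_const)
  have const: "(\<lambda>y\<in>Y. c) \<in> carrier (coord_ring J Y)" for c
    unfolding coord_ring_simps using poly_funs.const by blast
  have proj: "projection J x \<in> Y" if "x \<in> S" for x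
    unfolding Y_def by (rule projection_closure[OF that])
  let ?\<psi> = "\<lambda>a. ultra_eval I S (\<lambda>x\<in>S. a (projection J x))"
  have c: "?\<psi> (\<lambda>y\<in>Y. c) = ultra_const c" for c
  proof -
    have "(\<lambda>x\<in>S. (\<lambda>y\<in>Y. c) (projection J x)) = (\<lambda>x\<in>S. c)" using proj by (intro restrict_ext) simp
    then show ?thesis using ultra_eval_hom(4)[OF S, of c] by simp
  qed
  show ?thesis
  proof
    show "\<zero>\<^bsub>coord_ring J Y\<^esub> \<in> carrier (coord_ring J Y)" "\<one>\<^bsub>coord_ring J Y\<^esub> \<in> carrier (coord_ring J Y)"
      using const[of 0] const[of 1] by (simp_all add: coord_ring_simps)
    show "?\<psi> \<zero>\<^bsub>coord_ring J Y\<^esub> = 0" "?\<psi> \<one>\<^bsub>coord_ring J Y\<^esub> = 1"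
      using c[of 0] c[of 1] unfolding coord_ring_simps by simp_all
    show "\<exists>a\<in>carrier (coord_ring J Y). ?\<psi> a = ultra_const z" for z
      using const[of z] c[of z] by blast
    show "inj_on ?\<psi> (carrier (coord_ring J Y))"
    proof (rule inj_onI, rule coord_ring_eqI)
      fix f g y
      assume fg: "f \<in> carrier (coord_ring J Y)" "g \<in> carrier (coord_ring J Y)" and eq: "?\<psi> f = ?\<psi> g"
        and y: "y \<in> Y"
      obtain p q where pq: "p \<in> poly_funs J" "f = restrict p Y" "q \<in> poly_funs J" "g = restrict q Y"
        using fg by (auto simp: coord_ring_simps)
      have eqx: "f (projection J x) = g (projection J x)" if x: "x \<in> S" for x
        using ultra_eval_inj[OF S carrier_projection[OF fg(1)[unfolded Y_def] J]
            carrier_projection[OF fg(2)[unfolded Y_def] J] eq x] x by simp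
      have "p (projection J x) - q (projection J x) = 0" if "x \<in> S" for x
        using eqx[OF that] proj[OF that] pq(2,4) by simp
      from vanish_on_closure[OF poly_funs_diff[OF pq(1,3)] this y[unfolded Y_def]]
      show "f y = g y" using y pq by simp
    qed
    fix f g assume fg: "f \<in> carrier (coord_ring J Y)" "g \<in> carrier (coord_ring J Y)"
    have "(\<lambda>x\<in>S. (f \<oplus>\<^bsub>coord_ring J Y\<^esub> g) (projection J x)) =
        (\<lambda>x\<in>S. (\<lambda>x\<in>S. f (projection J x)) x + (\<lambda>x\<in>S. g (projection J x)) x)"
      "(\<lambda>x\<in>S. (f \<otimes>\<^bsub>coord_ring J Y\<^esub> g) (projection J x)) =
        (\<lambda>x\<in>S. (\<lambda>x\<in>S. f (projection J x)) x * (\<lambda>x\<in>S. g (projection J x)) x)"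
      using proj by (auto simp: coord_ring_simps(2,3) intro!: restrict_ext)
    then show "f \<oplus>\<^bsub>coord_ring J Y\<^esub> g \<in> carrier (coord_ring J Y) \<and>
        ?\<psi> (f \<oplus>\<^bsub>coord_ring J Y\<^esub> g) = ?\<psi> f + ?\<psi> g"
      "f \<otimes>\<^bsub>coord_ring J Y\<^esub> g \<in> carrier (coord_ring J Y) \<and>
        ?\<psi> (f \<otimes>\<^bsub>coord_ring J Y\<^esub> g) = ?\<psi> f * ?\<psi> g"
      using coord_ring_closed[OF fg] ultra_eval_hom(1,2)[OF S]
      by (simp_all only: coord_ring_simps(2,3))
  qed
qed

context fraction_embedding
begin

lemma mem_value_field: "a \<in> carrier R \<Longrightarrow> \<psi> a \<in> value_field"
  by (rule value_fieldI[OF _ nonzero_one]) (simp_all add: R_one)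

lemma fraction_one: "a \<in> carrier R \<Longrightarrow> fraction R a \<one> = cls (\<psi> a)"
  using fraction_eq[OF _ nonzero_one] R_one by simp

lemma curve_field_value_field:
  assumes t: "t \<in> carrier FF" "\<And>z. z \<in> carrier FF \<Longrightarrow> FF.algebraic (generate_field FF (insert t (cls ` range \<iota>))) z"
    and gs: "set gs \<subseteq> value_field"
    and gen: "\<And>L a. subfield L type_field \<Longrightarrow> range \<iota> \<subseteq> L \<Longrightarrow> set gs \<subseteq> L \<Longrightarrow> a \<in> carrier R \<Longrightarrow> \<psi> a \<in> L"
    and x: "x \<in> value_field" "x \<notin> range \<iota>"
  shows "ring.finite_dimension type_field (adjoin x) value_field"
proof (rule V.finite_dimension_over_adjoin[where t = "uncls t" and gs = gs])
  show "uncls t \<in> value_field" using t(1) by (auto simp: carrier_FF)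
  show "ring.algebraic type_field (adjoin (uncls t)) z" if "z \<in> value_field" for z
    using algebraic_adjoin[OF t(1) _ t(2), of "cls z"] that by (auto simp: carrier_FF)
  show "value_field \<subseteq> L" if L: "subfield L type_field" "range \<iota> \<subseteq> L" "set gs \<subseteq> L" for L
  proof
    interpret T: field "type_field :: 'k ring" by (rule field_type_field)
    fix y assume "y \<in> value_field"
    then obtain a b where y: "y = \<psi> a / \<psi> b" "a \<in> carrier R" "b \<in> carrier R - {\<zero>}"
      unfolding value_field_def by blast
    have ab: "\<psi> a \<in> L" "\<psi> b \<in> L" using gen[OF L] y by auto
    have "inverse (\<psi> b) \<in> L"
      using T.subfield_m_inv(1)[OF L(1), of "\<psi> b"] ab(2) \<psi>_nonzero[OF y(3)] by simp
    then show "y \<in> L" using subringE(6)[OF subfieldE(1)[OF L(1)] ab(1)] by (simp add: y(1) divide_inverse)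
  qed
qed (use gs x in auto)

lemma transcendental_not_iota:
  assumes t: "t \<in> carrier FF" "FF.transcendental (cls ` range \<iota>) t"
  shows "uncls t \<notin> range \<iota>"
proof
  assume "uncls t \<in> range \<iota>"
  moreover have "t = cls (uncls t)" using t(1) by (auto simp: carrier_FF)
  ultimately have "t \<in> cls ` range \<iota>" by blast
  moreover have "extension_field \<iota> (range \<iota>)"
  proof
    fix a b assume "a \<in> range \<iota>" "b \<in> range \<iota>"
    then obtain c d where "a = \<iota> c" "b = \<iota> d" by blast
    then have "a + b = \<iota> (c + d)" "a * b = \<iota> (c * d)"
      by (simp_all add: iota_add iota_mult)
    then show "a + b \<in> range \<iota>" "a * b \<in> range \<iota>" by blast+
  next
    fix a assume "a \<in> range \<iota>"
    then obtain c where "a = \<iota> c" by blast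
    then show "inverse a \<in> range \<iota>" using iota_inverse[of c] by (metis rangeI)
  qed auto
  then have "subfield (cls ` range \<iota>) FF" by (rule subfield_cls) auto
  ultimately have "(FF.algebraic over cls ` range \<iota>) t"
    using FF.algebraic_self[OF subfieldE(1)] by blast
  with t(2) show False by (simp add: over_def)
qed

end

section \<open>From the definitions to the embedded fields\<close>

lemma spread_cong:
  assumes "\<And>e. e \<in> E \<Longrightarrow> g e = h e"
  shows "spread E \<delta> g = spread E \<delta> h"
proof -
  have "g ` {e\<in>E. P e} = h ` {e\<in>E. P e}" for P using assms by (intro image_cong) auto
  then show ?thesis by (simp add: spread_def)
qed

text \<open>The bridge to the embedded field: \<open>Vals_bij\<close> reindexes the sum, and
  differences of \<open>a\<close> represent the functions \<open>W\<close>. The embedding is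
  arbitrary, so that C and C' are both covered.\<close>

lemma mu_eq_sum_spread:
  fixes C :: "('v \<times> axis \<Rightarrow> complex) set"
  assumes emb: "fraction_embedding \<iota> (coord_ring (coords V) C) \<psi>"
    and const: "\<And>c. \<psi> (\<lambda>x\<in>C. c) = \<iota> c"
    and W: "\<And>u w. {u, w} \<in> E \<Longrightarrow>
      a w - a u \<in> fraction_embedding.value_field (coord_ring (coords V) C) \<psi> \<and> a w - a u \<noteq> 0 \<and>
      W V C u w = fraction_embedding.cls (coord_ring (coords V) C) \<psi> (a w - a u)"
  shows "mu V E C \<delta> =
    (\<Sum>v\<in>{v \<in> complex_subfield.Vals \<iota> (fraction_embedding.value_field (coord_ring (coords V) C) \<psi>).
      spread E \<delta> (edge_order a v) \<noteq> 0}. spread E \<delta> (edge_order a v))"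
proof -
  interpret fraction_embedding \<iota> "coord_ring (coords V) C" \<psi> by (rule emb)
  have regc: "regular (coords V) C (\<lambda>x. c) = cls (\<iota> c)" for c
  proof -
    have "(\<lambda>x\<in>C. c) \<in> carrier (coord_ring (coords V) C)"
      unfolding coord_ring_simps(1) using poly_funs.const by blast
    from fraction_one[OF this] show ?thesis by (simp only: regular_def const)
  qed
  then have constants_eq: "constants (coords V) C = cls ` range \<iota>"
    unfolding constants_def by (simp add: image_image)
  have Val: "Val (coords V) C = frac_Vals"
    unfolding Val_def frac_Vals_def function_field_def constants_eq by (simp only: Let_def)
  let ?f = "\<lambda>\<nu>. restrict (\<lambda>k. \<nu> (cls k)) (value_field - {0})"
  have ev: "edge_val V C \<nu> e = edge_order a (?f \<nu>) e" if "e \<in> E" for \<nu> e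
  proof -
    have "(\<exists>u w. e = {u, w} \<and> n = \<nu> (W V C u w)) \<longleftrightarrow> (\<exists>u w. e = {u, w} \<and> n = ?f \<nu> (a w - a u))" for n
    proof -
      have eq: "\<nu> (W V C u w) = ?f \<nu> (a w - a u)" if "e = {u, w}" for u w
        using W[of u w] that \<open>e \<in> E\<close> by simp
      then show ?thesis by (intro arg_cong[where f = Ex] HOL.ext conj_cong refl) (simp only: eq)
    qed
    then show ?thesis unfolding edge_val_def edge_order_def by simp
  qed
  have gap: "gap V E C \<delta> \<nu> = spread E \<delta> (edge_order a (?f \<nu>))" for \<nu>
  proof -
    have "gap V E C \<delta> \<nu> = spread E \<delta> (edge_val V C \<nu>)" by (simp add: gap_def spread_def)
    also have "\<dots> = spread E \<delta> (edge_order a (?f \<nu>))" using ev by (intro spread_cong)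
    finally show ?thesis .
  qed
  let ?P = "\<lambda>v. spread E \<delta> (edge_order a v)"
  have bij: "bij_betw ?f {\<nu> \<in> frac_Vals. ?P (?f \<nu>) \<noteq> 0} {v \<in> Vals value_field. ?P v \<noteq> 0}"
    by (rule bij_betw_Collect[OF Vals_bij]) (rule refl)
  have "mu V E C \<delta> = (\<Sum>\<nu>\<in>{\<nu> \<in> frac_Vals. ?P (?f \<nu>) \<noteq> 0}. ?P (?f \<nu>))"
    unfolding mu_def gap Val ..
  also have "\<dots> = (\<Sum>v\<in>{v \<in> Vals value_field. ?P v \<noteq> 0}. ?P v)"
    using sum.reindex_bij_betw[OF bij, of ?P] .
  finally show ?thesis .
qed

theorem theorem3p3:
  fixes V V' :: "'v set" and E E' :: "'v set set" and lam :: "'v set \<Rightarrow> real"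
    and u0 v0 u0' v0' :: 'v and C C' :: "('v \<times> axis \<Rightarrow> complex) set"
    and \<delta>' :: "'v set \<Rightarrow> color"
  assumes "fin_graph V E"
    and "\<forall>e\<in>E. lam e > 0"
    and "algebraic_motion V E lam u0 v0 C"
    and "subgraph_of V' E' V E"
    and "C' = zariski_closure (coords V') (projection (coords V') ` C)"
    and "algebraic_motion V' E' lam u0' v0' C'"
    and "\<delta>' \<in> NAC E'"
  shows "(\<Sum>\<delta> \<in> {\<delta> \<in> NAC E. restrict \<delta> E' = \<delta>'}. mu V E C \<delta>)
           = mu V' E' C' \<delta>' * int (projection_degree (coords V) C (coords V') C')"
proof -
  let ?I = "coords V" and ?J = "coords V'"
  have finV: "finite V" and E_sub: "\<And>e. e \<in> E \<Longrightarrow> e \<subseteq> V" and card2: "\<forall>e\<in>E. card e = 2"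
    using assms(1) by (auto simp: fin_graph_def)
  have finE: "finite E" using finV E_sub by (meson Pow_iff finite_Pow_iff finite_subset subsetI)
  have V'V: "V' \<subseteq> V" and E'E: "E' \<subseteq> E" and E'_sub: "\<And>e. e \<in> E' \<Longrightarrow> e \<subseteq> V'"
    using assms(4) by (auto simp: subgraph_of_def fin_graph_def)
  have JI: "?J \<subseteq> ?I" using V'V by (auto simp: coords_def)
  have curve: "irreducible_curve ?I C" "irreducible_curve ?J C'" and Cc: "C \<subseteq> config_space V E lam u0 v0"
    using assms(3,6) by (auto simp: algebraic_motion_def)
  have irr: "irreducible_variety ?I C" using curve(1) by (simp add: irreducible_curve_def)
  let ?\<psi>' = "\<lambda>a. ultra_eval ?I C (\<lambda>x\<in>C. a (projection ?J x))"
  interpret A: fraction_embedding ultra_const "coord_ring ?I C" "ultra_eval ?I C"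
    by (rule fraction_embedding_ultra_eval[OF irr])
  interpret B: fraction_embedding ultra_const "coord_ring ?J C'" ?\<psi>'
    unfolding assms(5) by (rule fraction_embedding_projection[OF irr JI])
  have A_const: "ultra_eval ?I C (\<lambda>x\<in>C. c) = ultra_const c" for c by (rule ultra_eval_hom(4)[OF irr])
  have proj: "projection ?J x \<in> C'" if "x \<in> C" for x
    unfolding assms(5) by (rule projection_closure[OF that])
  have B_const: "?\<psi>' (\<lambda>x\<in>C'. c) = ultra_const c" for c
  proof -
    have "(\<lambda>x\<in>C. (\<lambda>y\<in>C'. c) (projection ?J x)) = (\<lambda>x\<in>C. c)" using proj by (intro restrict_ext) simp
    then show ?thesis using A_const[of c] by simp
  qed
  have proj_carrier: "(\<lambda>x\<in>C. a (projection ?J x)) \<in> carrier (coord_ring ?I C)"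
    if "a \<in> carrier (coord_ring ?J C')" for a
    using carrier_projection[OF _ JI] that unfolding assms(5) .
  have proj_nonzero: "(\<lambda>x\<in>C. a (projection ?J x)) \<in> carrier (coord_ring ?I C) - {\<zero>\<^bsub>coord_ring ?I C\<^esub>}"
    if "a \<in> carrier (coord_ring ?J C') - {\<zero>\<^bsub>coord_ring ?J C'\<^esub>}" for a
    using proj_carrier[of a] B.\<psi>_nonzero[OF that] that A.R_zero(2) by auto
  have BA: "B.value_field \<subseteq> A.value_field"
  proof
    fix y assume "y \<in> B.value_field"
    then obtain a b where y: "y = ?\<psi>' a / ?\<psi>' b" "a \<in> carrier (coord_ring ?J C')"
      "b \<in> carrier (coord_ring ?J C') - {\<zero>\<^bsub>coord_ring ?J C'\<^esub>}"
      unfolding B.value_field_def by blast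
    show "y \<in> A.value_field"
      by (rule A.value_fieldI[OF proj_carrier[OF y(2)] proj_nonzero[OF y(3)] y(1)])
  qed
  \<comment> \<open>In terms of values in the ultrapower the pullback is the identity; only the
    classes differ.\<close>
  have pull: "pullback ?I C ?J (B.cls k) = A.cls k" if k: "k \<in> B.value_field" for k
    unfolding pullback_def
  proof (rule UN_pair_constant[OF B.cls_nonempty[OF k]])
    fix a b assume "(a, b) \<in> B.cls k"
    note m = B.cls_memD[OF this]
    show "fraction (coord_ring ?I C) (\<lambda>x\<in>C. a (projection ?J x)) (\<lambda>x\<in>C. b (projection ?J x)) = A.cls k"
      unfolding m(3) by (rule A.fraction_eq[OF proj_carrier[OF m(1)] proj_nonzero[OF m(2)]])
  qed
  have A_reg: "regular ?I C p = A.cls (ultra_eval ?I C (restrict p C))" if "p \<in> poly_funs ?I" for p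
    unfolding regular_def using that by (intro A.fraction_one) (auto simp: coord_ring_simps(1))
  have B_reg: "regular ?J C' p = B.cls (?\<psi>' (restrict p C'))" if "p \<in> poly_funs ?J" for p
    unfolding regular_def using that by (intro B.fraction_one) (auto simp: coord_ring_simps(1))
  have A_constants: "constants ?I C = A.cls ` range ultra_const"
    unfolding constants_def by (simp add: A_reg poly_funs.const A_const image_image)
  have B_constants: "constants ?J C' = B.cls ` range ultra_const"
    unfolding constants_def by (simp only: B_reg[OF poly_funs.const] B_const image_image)
  obtain t where t: "t \<in> carrier A.FF"
    "\<And>z. z \<in> carrier A.FF \<Longrightarrow> A.FF.algebraic (generate_field A.FF (insert t (A.cls ` range ultra_const))) z"
    using curve(1) unfolding irreducible_curve_def Let_def function_field_def A_constants by blast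
  \<comment> \<open>A transcendental element of F(C') gives a nonconstant \<open>x\<close> in the
    subfield. F(C) is finite over C(x), hence over F(C'), so the degree of the projection is a
    genuine dimension.\<close>
  obtain s where s: "s \<in> carrier B.FF" "B.FF.transcendental (B.cls ` range ultra_const) s"
    using curve(2) unfolding irreducible_curve_def Let_def function_field_def B_constants by blast
  define x where "x = B.uncls s"
  have x: "x \<in> B.value_field" "x \<notin> range ultra_const"
    using s(1) B.transcendental_not_iota[OF s] by (auto simp: x_def B.carrier_FF)
  have "(UNIV :: axis set) \<subseteq> {Xaxis, Yaxis}"
  proof
    fix z :: axis show "z \<in> {Xaxis, Yaxis}" by (cases z) simp_all
  qed
  then have "finite (UNIV :: axis set)" by (rule finite_subset) simp
  then have "finite ?I" using finV by (simp add: coords_def)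
  then obtain cs where cs: "set cs = ?I" using finite_list by blast
  \<comment> \<open>The finitely many coordinate functions generate F(C) over the constants; this
    supplies the finiteness that a transcendence basis alone does not give.\<close>
  define gs where "gs = map (\<lambda>i. ultra_eval ?I C (\<lambda>x\<in>C. x i)) cs"
  have gs: "set gs \<subseteq> A.value_field"
  proof -
    have "(\<lambda>x\<in>C. x i) \<in> carrier (coord_ring ?I C)" if "i \<in> ?I" for i
      using poly_funs.coord[OF that] by (auto simp: coord_ring_simps(1))
    then show ?thesis using A.mem_value_field by (auto simp: gs_def cs)
  qed
  have gen: "ultra_eval ?I C a \<in> L"
    if L: "subfield L type_field" "range ultra_const \<subseteq> L" "set gs \<subseteq> L"
      and a: "a \<in> carrier (coord_ring ?I C)" for L a
  proof -
    obtain p where p: "p \<in> poly_funs ?I" "a = restrict p C" using a by (auto simp: coord_ring_simps(1))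
    note sub = subringE(6,7)[OF subfieldE(1)[OF L(1)]]
    from p(1) have "ultra_eval ?I C (restrict p C) \<in> L"
    proof (induction rule: poly_funs.induct)
      case (const c)
      show ?case unfolding A_const using L(2) by blast
    next
      case (coord i)
      then have "ultra_eval ?I C (\<lambda>x\<in>C. x i) \<in> (\<lambda>i. ultra_eval ?I C (\<lambda>x\<in>C. x i)) ` ?I"
        by (rule imageI)
      then have "ultra_eval ?I C (\<lambda>x\<in>C. x i) \<in> set gs" by (simp only: gs_def set_map cs)
      then show ?case by (rule subsetD[OF L(3)])
    next
      case (add p q)
      have "restrict (\<lambda>x. p x + q x) C = (\<lambda>x\<in>C. restrict p C x + restrict q C x)" by (auto simp: restrict_def)
      then have eq: "ultra_eval ?I C (restrict (\<lambda>x. p x + q x) C) =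
          ultra_eval ?I C (restrict p C) + ultra_eval ?I C (restrict q C)"
        by (simp only: ultra_eval_hom(1)[OF irr])
      show ?case unfolding eq using sub(2)[OF add(3,4)] by (simp only: type_field_simps)
    next
      case (mult p q)
      have "restrict (\<lambda>x. p x * q x) C = (\<lambda>x\<in>C. restrict p C x * restrict q C x)" by (auto simp: restrict_def)
      then have eq: "ultra_eval ?I C (restrict (\<lambda>x. p x * q x) C) =
          ultra_eval ?I C (restrict p C) * ultra_eval ?I C (restrict q C)"
        by (simp only: ultra_eval_hom(2)[OF irr])
      show ?case unfolding eq using sub(1)[OF mult(3,4)] by (simp only: type_field_simps)
    qed
    then show ?thesis by (simp add: p(2))
  qed
  note fin = A.curve_field_value_field[OF t gs gen]
  have curve_A: "curve_field ultra_const A.value_field" by (rule A.V.curve_fieldI[OF fin])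
  have "ring.finite_dimension type_field B.value_field A.value_field"
    using A.V.finite_dimension_over_subfield[OF A.subfield_adjoin B.V.adjoin_subset[OF x(1)] B.V.subfield_F BA fin]
      x BA by blast
  from A.dimension_value_field[OF B.V.extension_field_axioms BA this]
  have dim: "ring.dimension type_field (A.FF.dim (A.cls ` B.value_field) (carrier A.FF)) B.value_field A.value_field" .
  have "pullback ?I C ?J ` carrier (function_field ?J C') = A.cls ` B.value_field"
    unfolding function_field_def B.carrier_FF image_image using pull by (intro image_cong) auto
  then have n: "projection_degree ?I C ?J C' = A.FF.dim (A.cls ` B.value_field) (carrier A.FF)"
    by (simp add: projection_degree_def function_field_def)
  let ?n = "projection_degree ?I C ?J C'"
  obtain b where "curve_field_extension ultra_const A.value_field B.value_field ?n b"
    using A.V.curve_field_extensionI[OF curve_A B.V.extension_field_axioms BA dim[folded n]] by blast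
  then interpret X: curve_field_extension ultra_const A.value_field B.value_field ?n b .
  \<comment> \<open>The isotropic coordinates x + iy and x - iy: a squared length is the product of
    their differences, so the two edge functions multiply to a nonzero constant and have opposite
    values.\<close>
  define px where "px s u = (\<lambda>\<rho>::'v \<times> axis \<Rightarrow> complex. \<rho> (u, Xaxis) + s * \<rho> (u, Yaxis))" for s u
  have px: "px s u \<in> poly_funs (coords U)" if "u \<in> U" for s u U
    unfolding px_def using that
    by (intro poly_funs.add poly_funs.mult poly_funs.const poly_funs.coord) (auto simp: coords_def)
  define a where "a u = ultra_eval ?I C (restrict (px \<i> u) C)" for u
  define c where "c u = ultra_eval ?I C (restrict (px (- \<i>) u) C)" for u
  have in_V: "u \<in> V" "w \<in> V" if "{u, w} \<in> E" for u w using E_sub[OF that] by auto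
  have in_V': "u \<in> V'" "w \<in> V'" if "{u, w} \<in> E'" for u w using E'_sub[OF that] by auto
  have memA: "ultra_eval ?I C (restrict p C) \<in> A.value_field" if "p \<in> poly_funs ?I" for p
    using that by (intro A.mem_value_field) (auto simp: coord_ring_simps(1))
  \<comment> \<open>For a vertex of G', \<open>a u\<close> is the same element whether read on C or,
    through the projection, on C'. Hence one potential serves both sides.\<close>
  have a_B: "a u = ?\<psi>' (restrict (px \<i> u) C')" if "u \<in> V'" for u
    unfolding a_def using that proj
    by (intro ultra_eval_hom(5)[OF irr]) (auto simp: px_def projection_def coords_def)
  have diff: "a w - a u = ultra_eval ?I C (\<lambda>\<rho>\<in>C. px \<i> w \<rho> - px \<i> u \<rho>)" for u w
  proof -
    have "(\<lambda>\<rho>\<in>C. px \<i> w \<rho> - px \<i> u \<rho>) = (\<lambda>\<rho>\<in>C. restrict (px \<i> w) C \<rho> - restrict (px \<i> u) C \<rho>)"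
      by (intro restrict_ext) simp
    then show ?thesis unfolding a_def by (simp only: ultra_eval_hom(3)[OF irr])
  qed
  have mem: "a w - a u \<in> A.value_field \<and> c w - c u \<in> A.value_field" if "{u, w} \<in> E" for u w
    unfolding a_def c_def using px in_V[OF that] memA by (intro conjI A.V.diff_mem) auto
  have mem': "a w - a u \<in> B.value_field" if "{u, w} \<in> E'" for u w
  proof -
    have "?\<psi>' (restrict (px \<i> z) C') \<in> B.value_field" if "z \<in> V'" for z
      by (rule B.mem_value_field) (simp only: coord_ring_simps(1), rule imageI, rule px[OF that])
    then show ?thesis using in_V'[OF that] by (simp add: a_B B.V.diff_mem)
  qed
  have prod: "\<exists>z. z \<noteq> 0 \<and> (a w - a u) * (c w - c u) = ultra_const z" if uw: "{u, w} \<in> E" for u w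
  proof (intro exI[of _ "(complex_of_real (lam {u, w}))\<^sup>2"] conjI)
    show "(complex_of_real (lam {u, w}))\<^sup>2 \<noteq> 0" using assms(2) uw by fastforce
    have "(a w - a u) * (c w - c u) = ultra_eval ?I C (\<lambda>\<rho>\<in>C.
        (\<lambda>\<rho>\<in>C. restrict (px \<i> w) C \<rho> - restrict (px \<i> u) C \<rho>) \<rho> *
        (\<lambda>\<rho>\<in>C. restrict (px (- \<i>) w) C \<rho> - restrict (px (- \<i>) u) C \<rho>) \<rho>)"
      unfolding a_def c_def by (simp only: ultra_eval_hom(2,3)[OF irr])
    also have "\<dots> = ultra_eval ?I C (\<lambda>\<rho>\<in>C. (complex_of_real (lam {u, w}))\<^sup>2)"
    proof (rule ultra_eval_hom(5)[OF irr])
      fix \<rho> assume \<rho>: "\<rho> \<in> C"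
      then have "(\<rho> (u, Xaxis) - \<rho> (w, Xaxis))\<^sup>2 + (\<rho> (u, Yaxis) - \<rho> (w, Yaxis))\<^sup>2
          = (complex_of_real (lam {u, w}))\<^sup>2"
        using Cc uw unfolding config_space_def by blast
      moreover have "(px \<i> w \<rho> - px \<i> u \<rho>) * (px (- \<i>) w \<rho> - px (- \<i>) u \<rho>)
          = (\<rho> (u, Xaxis) - \<rho> (w, Xaxis))\<^sup>2 + (\<rho> (u, Yaxis) - \<rho> (w, Yaxis))\<^sup>2"
        by (simp add: px_def power2_eq_square algebra_simps)
      ultimately show "(\<lambda>\<rho>\<in>C.
        (\<lambda>\<rho>\<in>C. restrict (px \<i> w) C \<rho> - restrict (px \<i> u) C \<rho>) \<rho> *
        (\<lambda>\<rho>\<in>C. restrict (px (- \<i>) w) C \<rho> - restrict (px (- \<i>) u) C \<rho>) \<rho>) \<rho>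
         = (\<lambda>\<rho>\<in>C. (complex_of_real (lam {u, w}))\<^sup>2) \<rho>" using \<rho> by simp
    qed
    also have "\<dots> = ultra_const ((complex_of_real (lam {u, w}))\<^sup>2)" by (rule A_const)
    finally show "(a w - a u) * (c w - c u) = ultra_const ((complex_of_real (lam {u, w}))\<^sup>2)" .
  qed
  have nz: "a w - a u \<noteq> 0" if "{u, w} \<in> E" for u w using prod[OF that] by auto
  have Wpoly: "(\<lambda>\<rho>. (\<rho> (w, Xaxis) - \<rho> (u, Xaxis)) + \<i> * (\<rho> (w, Yaxis) - \<rho> (u, Yaxis)))
      = (\<lambda>\<rho>. px \<i> w \<rho> - px \<i> u \<rho>)" for u w :: 'v
    by (rule HOL.ext) (simp add: px_def algebra_simps)
  have muA: "mu V E C \<delta> = (\<Sum>v\<in>{v \<in> A.Vals A.value_field. spread E \<delta> (edge_order a v) \<noteq> 0}.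
      spread E \<delta> (edge_order a v))" for \<delta>
  proof (rule mu_eq_sum_spread[OF A.fraction_embedding_axioms A_const])
    fix u w assume uw: "{u, w} \<in> E"
    have "W V C u w = A.cls (a w - a u)"
      unfolding W_def Wpoly diff using px in_V[OF uw] by (intro A_reg poly_funs_diff)
    then show "a w - a u \<in> A.value_field \<and> a w - a u \<noteq> 0 \<and> W V C u w = A.cls (a w - a u)"
      using mem[OF uw] nz[OF uw] by simp
  qed
  have muB: "mu V' E' C' \<delta>' = (\<Sum>v\<in>{v \<in> A.Vals B.value_field. spread E' \<delta>' (edge_order a v) \<noteq> 0}.
      spread E' \<delta>' (edge_order a v))"
  proof (rule mu_eq_sum_spread[OF B.fraction_embedding_axioms B_const])
    fix u w assume uw: "{u, w} \<in> E'"
    have "?\<psi>' (\<lambda>\<rho>\<in>C'. px \<i> w \<rho> - px \<i> u \<rho>) = a w - a u"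
      unfolding diff using in_V'[OF uw] proj
      by (intro ultra_eval_hom(5)[OF irr]) (auto simp: px_def projection_def coords_def)
    moreover have "W V' C' u w = B.cls (?\<psi>' (\<lambda>\<rho>\<in>C'. px \<i> w \<rho> - px \<i> u \<rho>))"
      unfolding W_def Wpoly using px in_V'[OF uw] by (intro B_reg poly_funs_diff)
    ultimately show "a w - a u \<in> B.value_field \<and> a w - a u \<noteq> 0 \<and> W V' C' u w = B.cls (a w - a u)"
      using mem'[OF uw] nz uw E'E by auto
  qed
  show ?thesis
    unfolding muA muB
    using X.sum_gap_extensions[OF finE E'E card2 assms(7) mem mem' prod] .
qed

end
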